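(* Let $\mathcal{X}=[X_1,\dots,X_p]\in\mathbb{R}^{m\times ps}$ with blocks $X_j\in\mathbb{R}^{m\times s}$, and let $\mathcal{X}_k=[X_1,\dots,X_k]$. Let $\widehat{\mathcal{Q}}_k$ and $\widehat{\mathcal{R}}_k$ be the quantities computed in floating-point arithmetic by the algorithm BCGSI+P-1S (given in the context) applied to $\mathcal{X}$, and assume $O(u)\,\kappa^2(\mathcal{X}_k)\le 1/2$ (for all $k\in\{1,\dots,p\}$). Assume also that for all $X\in\mathbb{R}^{m\times s}$ with $\kappa(X)\le\kappa(\mathcal{X})$, the computed output $[\widehat Q,\widehat R]=\mathrm{IO}_A(X)$ satisfies $$\widehat R^{T}\widehat R=X^{T}X+\Delta D,\quad \|\Delta D\|\le O(u)\|X\|^2,$$ $$X+\Delta X=\widehat Q\widehat R,\quad \|\Delta X\|\le O(u)\|X\|,$$ $$\|I-\widehat Q^{T}\widehat Q\|\le \frac{O(u)}{1-O(u)\,\kappa^2(X)}.$$ Then for all $k\in\{1,\dots,p\}$ there is a matrix $\Delta\mathcal{X}_k$ such that $$\mathcal{X}_k+\Delta\mathcal{X}_k=\widehat{\mathcal{Q}}_k\widehat{\mathcal{R}}_k,\quad \|\Delta\mathcal{X}_k\|\le O(u)\|\mathcal{X}_k\|,$$ $$\|I-\widehat{\mathcal{Q}}_k^{T}\widehat{\mathcal{Q}}_k\|\le O(u).$$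
   Context: Conventions. $\|\cdot\|$ is the 2-norm; $\kappa(M)=\sigma_{\max}(M)/\sigma_{\min}(M)$ for $\sigma_{\min}(M)>0$. $u$ is the unit roundoff, computations follow the standard model of floating-point arithmetic, and hats denote computed quantities. $O(u)$ denotes a quantity bounded by $c\,u$, where $c$ depends only on the dimensions (a modest polynomial in $m,s,p$), not on condition numbers, and may differ at each occurrence. A hypothesis such as "$O(u)\kappa^2\le 1/2$" means this inequality for a suitable such $c$. $\mathrm{chol}(M)$ returns the upper triangular Cholesky factor $C$ with $C^TC=M$. $\mathrm{IO}_A$ is a routine ("intraorthogonalization") that computes a thin QR factorization $X=QR$ of an $m\times s$ block. Algorithm BCGSI+P-1S (input $\mathcal{X}=[X_1,\dots,X_p]$ and the routine $\mathrm{IO}_A$). $S_{1:k,k+1}$, $Y_{1:k,k+1}$, $R_{1:k,k+1}$ denote block columns with $k$ blocks of size $s\times s$; $\mathcal{Q}_k=[Q_1,\dots,Q_k]$; $\mathcal{R}_k=(R_{ij})_{1\le i,j\le k}$ is block upper triangular. 1. $[Q_1,R_{11}]=\mathrm{IO}_A(X_1)$; $S_{12}=Q_1^TX_2$; $T_2=X_2^TX_2$. 2. For $k=1,\dots,p-1$: (a) if $k\ge2$, set $S_{1:k,k+1}=\begin{bmatrix} Z_{k-1}\\ Y_{kk}^{-T}\,(P_k-Y_{1:k-1,k}^TZ_{k-1})\end{bmatrix}$ (for $k=1$ use $S_{12}$ from step 1); (b) $S_{k+1,k+1}=\mathrm{chol}(T_{k+1}-S_{1:k,k+1}^TS_{1:k,k+1})$;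 (c) $U_{k+1}=(X_{k+1}-\mathcal{Q}_kS_{1:k,k+1})S_{k+1,k+1}^{-1}$; (d) compute $Y_{1:k,k+1}=\mathcal{Q}_k^TU_{k+1}$ and $\Omega_{k+1}=U_{k+1}^TU_{k+1}$; if $k<p-1$, also compute in the same synchronization $Z_k=\mathcal{Q}_k^TX_{k+2}$, $P_{k+1}=U_{k+1}^TX_{k+2}$ and $T_{k+2}=X_{k+2}^TX_{k+2}$; (e) $Y_{k+1,k+1}=\mathrm{chol}(\Omega_{k+1}-Y_{1:k,k+1}^TY_{1:k,k+1})$; (f) $Q_{k+1}=(U_{k+1}-\mathcal{Q}_kY_{1:k,k+1})Y_{k+1,k+1}^{-1}$; (g) $R_{1:k,k+1}=S_{1:k,k+1}+Y_{1:k,k+1}S_{k+1,k+1}$ and $R_{k+1,k+1}=Y_{k+1,k+1}S_{k+1,k+1}$. 3. Return $\mathcal{Q}=\mathcal{Q}_p$, $\mathcal{R}=\mathcal{R}_p$. *)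

theory Defs
  imports "Jordan_Normal_Form.Char_Poly" "HOL-Library.Multiset"
begin

definition vnorm :: "real vec \<Rightarrow> real" where
  "vnorm v = sqrt (v \<bullet> v)"

definition mnorm :: "real mat \<Rightarrow> real" where
  "mnorm A = Sup {vnorm (A *\<^sub>v v) | v. v \<in> carrier_vec (dim_col A) \<and> vnorm v = 1}"

text \<open>These are the singular values counted over the columns: a matrix with more columns than
  rows has the singular value 0, so \<open>0 < sigma_min A\<close> says that \<open>A\<close> has full column rank.\<close>

definition singular_values :: "real mat \<Rightarrow> real set" where
  "singular_values A = {sqrt l | l. eigenvalue (transpose_mat A * A) l}"

definition sigma_max :: "real mat \<Rightarrow> real" where
  "sigma_max A = Max (singular_values A)"

definition sigma_min :: "real mat \<Rightarrow> real" where
  "sigma_min A = Min (singular_values A)"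

text \<open>Meaningful only if \<open>0 < sigma_min A\<close>; this is always assumed alongside.\<close>

definition kappa :: "real mat \<Rightarrow> real" where
  "kappa A = sigma_max A / sigma_min A"

definition poly_bounded :: "(nat \<Rightarrow> nat \<Rightarrow> nat \<Rightarrow> real) \<Rightarrow> bool" where
  "poly_bounded c \<longleftrightarrow>
     (\<exists>K d. \<forall>m s p. 0 < m \<and> 0 < s \<and> 0 < p \<longrightarrow>
        0 \<le> c m s p \<and> c m s p \<le> K * real (m * s * p) ^ d)"

definition append_cols :: "real mat \<Rightarrow> real mat \<Rightarrow> real mat" where
  "append_cols A B = four_block_mat A B (0\<^sub>m 0 (dim_col A)) (0\<^sub>m 0 (dim_col B))"

definition lead_cols :: "real mat \<Rightarrow> nat \<Rightarrow> real mat" where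
  "lead_cols A n = mat (dim_row A) n (\<lambda>(i, l). A $$ (i, l))"

text \<open>The block \<open>X\<^sub>j\<close> of \<open>s\<close> columns; blocks are numbered from 1.\<close>

definition col_block :: "nat \<Rightarrow> real mat \<Rightarrow> nat \<Rightarrow> real mat" where
  "col_block s A j = mat (dim_row A) s (\<lambda>(i, l). A $$ (i, (j - 1) * s + l))"

text \<open>The predicates below relate exact inputs to the possible computed results: \<open>rounds u x y\<close>
  says that \<open>y\<close> is a possible computed value of an elementary operation
  (\<open>+\<close>, \<open>-\<close>, \<open>*\<close>, \<open>/\<close>, \<open>sqrt\<close>) whose exact result is \<open>x\<close>. Every arithmetic that
  obeys the standard model is an instance. Negation is exact, so a subtraction is the addition of
  the negated operand.\<close>

definition rounds :: "real \<Rightarrow> real \<Rightarrow> real \<Rightarrow> bool" where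
  "rounds u x y \<longleftrightarrow> (\<exists>\<delta>. \<bar>\<delta>\<bar> \<le> u \<and> y = x * (1 + \<delta>))"

text \<open>A sum evaluated in an arbitrary order (any binary tree of additions).\<close>

inductive fl_sum :: "real \<Rightarrow> real multiset \<Rightarrow> real \<Rightarrow> bool" for u :: real where
  single: "fl_sum u {#x#} x"
| plus: "fl_sum u A x \<Longrightarrow> fl_sum u B y \<Longrightarrow> rounds u (x + y) z \<Longrightarrow> fl_sum u (A + B) z"

text \<open>\<open>t\<close> is a computed value of \<open>c + (\<Sum>l<n. a l * b l)\<close>. Since any order is allowed, this
  includes computing the inner product first and then adding it to \<open>c\<close>.\<close>

definition fl_add_inner ::
    "real \<Rightarrow> real \<Rightarrow> nat \<Rightarrow> (nat \<Rightarrow> real) \<Rightarrow> (nat \<Rightarrow> real) \<Rightarrow> real \<Rightarrow> bool" where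
  "fl_add_inner u c n a b t \<longleftrightarrow>
     (\<exists>q. (\<forall>l<n. rounds u (a l * b l) (q l)) \<and>
          fl_sum u (add_mset c (image_mset q (mset_set {..<n}))) t)"

text \<open>\<open>C\<close> is a computed value of \<open>A * B\<close> (the inner dimension must be positive).\<close>

definition fl_mult :: "real \<Rightarrow> real mat \<Rightarrow> real mat \<Rightarrow> real mat \<Rightarrow> bool" where
  "fl_mult u A B C \<longleftrightarrow> C \<in> carrier_mat (dim_row A) (dim_col B) \<and>
     (\<forall>i<dim_row A. \<forall>j<dim_col B.
        \<exists>q. (\<forall>l<dim_col A. rounds u (A $$ (i, l) * B $$ (l, j)) (q l)) \<and>
            fl_sum u (image_mset q (mset_set {..<dim_col A})) (C $$ (i, j)))"

text \<open>\<open>D\<close> is a computed value of \<open>C + A * B\<close>.\<close>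

definition fl_add_mult :: "real \<Rightarrow> real mat \<Rightarrow> real mat \<Rightarrow> real mat \<Rightarrow> real mat \<Rightarrow> bool" where
  "fl_add_mult u C A B D \<longleftrightarrow> D \<in> carrier_mat (dim_row C) (dim_col C) \<and>
     (\<forall>i<dim_row C. \<forall>j<dim_col C.
        fl_add_inner u (C $$ (i, j)) (dim_col A) (\<lambda>l. A $$ (i, l)) (\<lambda>l. B $$ (l, j))
          (D $$ (i, j)))"

text \<open>\<open>C\<close> is a computed Cholesky factor of \<open>A\<close>, obtained by the usual recurrences; only the upper
  triangle of \<open>A\<close> is accessed. No pivot is assumed to be positive: after a breakdown the
  recurrences continue with the library's values of \<open>sqrt\<close> at negative arguments and of division
  by 0, so a claim about all computed factors does not presuppose that there is no breakdown.\<close>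

definition fl_chol :: "real \<Rightarrow> real mat \<Rightarrow> real mat \<Rightarrow> bool" where
  "fl_chol u A C \<longleftrightarrow> C \<in> carrier_mat (dim_row A) (dim_row A) \<and> upper_triangular C \<and>
     (\<forall>i<dim_row A.
        (\<exists>t. fl_add_inner u (A $$ (i, i)) i (\<lambda>l. - C $$ (l, i)) (\<lambda>l. C $$ (l, i)) t \<and>
             rounds u (sqrt t) (C $$ (i, i))) \<and>
        (\<forall>j. i < j \<and> j < dim_row A \<longrightarrow>
          (\<exists>t. fl_add_inner u (A $$ (i, j)) i (\<lambda>l. - C $$ (l, i)) (\<lambda>l. C $$ (l, j)) t \<and>
               rounds u (t / C $$ (i, i)) (C $$ (i, j)))))"

text \<open>\<open>W\<close> is a computed value of \<open>B * T\<^sup>-\<^sup>1\<close> for upper triangular \<open>T\<close>, obtained by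
  substitution in \<open>W * T = B\<close>, row by row.\<close>

definition fl_tri_solve :: "real \<Rightarrow> real mat \<Rightarrow> real mat \<Rightarrow> real mat \<Rightarrow> bool" where
  "fl_tri_solve u B T W \<longleftrightarrow> W \<in> carrier_mat (dim_row B) (dim_col B) \<and>
     (\<forall>i<dim_row B. \<forall>j<dim_col B.
        \<exists>t. fl_add_inner u (B $$ (i, j)) j (\<lambda>l. - W $$ (i, l)) (\<lambda>l. T $$ (l, j)) t \<and>
            rounds u (t / T $$ (j, j)) (W $$ (i, j)))"

text \<open>\<open>QQ k\<close> and \<open>RR k\<close> are the computed \<open>\<Q>\<^sub>k\<close> and \<open>\<R>\<^sub>k\<close>. In the body, \<open>S k\<close>,
  \<open>Y k\<close>, \<open>R k\<close> stand for the block columns \<open>S\<^sub>1\<^sub>:\<^sub>k\<^sub>,\<^sub>k\<^sub>+\<^sub>1\<close>, \<open>Y\<^sub>1\<^sub>:\<^sub>k\<^sub>,\<^sub>k\<^sub>+\<^sub>1\<close>,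
  \<open>R\<^sub>1\<^sub>:\<^sub>k\<^sub>,\<^sub>k\<^sub>+\<^sub>1\<close>, and \<open>Sd j\<close>, \<open>Yd j\<close>, \<open>Rd j\<close> for the diagonal blocks \<open>S\<^sub>j\<^sub>j\<close>, \<open>Y\<^sub>j\<^sub>j\<close>,
  \<open>R\<^sub>j\<^sub>j\<close>. A product with \<open>Yd\<^sup>-\<^sup>T\<close> from the left is a transposed \<open>fl_tri_solve\<close>.\<close>

definition bcgsi_p_1s ::
  "real \<Rightarrow> (real mat \<Rightarrow> real mat \<times> real mat) \<Rightarrow> nat \<Rightarrow> nat \<Rightarrow> real mat \<Rightarrow>
   (nat \<Rightarrow> real mat) \<Rightarrow> (nat \<Rightarrow> real mat) \<Rightarrow> bool" where
  "bcgsi_p_1s u IO s p XX QQ RR \<longleftrightarrow>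
    (let X = col_block s XX in
     \<exists>Q S Sd Y Yd R Rd U T Z P \<Omega>.
       (Q 1, Rd 1) = IO (X 1) \<and> QQ 1 = Q 1 \<and> RR 1 = Rd 1 \<and>
       (1 < p \<longrightarrow>
          fl_mult u (transpose_mat (Q 1)) (X 2) (S 1) \<and>
          fl_mult u (transpose_mat (X 2)) (X 2) (T 2)) \<and>
       (\<forall>k\<in>{1..<p}.
          (2 \<le> k \<longrightarrow>
            (\<exists>V W.
               fl_add_mult u (P k) (- transpose_mat (Y (k - 1))) (Z (k - 1)) V \<and>
               fl_tri_solve u (transpose_mat V) (Yd k) (transpose_mat W) \<and>
               S k = Z (k - 1) @\<^sub>r W)) \<and>
          (\<exists>M. fl_add_mult u (T (k + 1)) (- transpose_mat (S k)) (S k) M \<and>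
               fl_chol u M (Sd (k + 1))) \<and>
          (\<exists>V. fl_add_mult u (X (k + 1)) (- QQ k) (S k) V \<and>
               fl_tri_solve u V (Sd (k + 1)) (U (k + 1))) \<and>
          fl_mult u (transpose_mat (QQ k)) (U (k + 1)) (Y k) \<and>
          fl_mult u (transpose_mat (U (k + 1))) (U (k + 1)) (\<Omega> (k + 1)) \<and>
          (k < p - 1 \<longrightarrow>
             fl_mult u (transpose_mat (QQ k)) (X (k + 2)) (Z k) \<and>
             fl_mult u (transpose_mat (U (k + 1))) (X (k + 2)) (P (k + 1)) \<and>
             fl_mult u (transpose_mat (X (k + 2))) (X (k + 2)) (T (k + 2))) \<and>
          (\<exists>M. fl_add_mult u (\<Omega> (k + 1)) (- transpose_mat (Y k)) (Y k) M \<and>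
               fl_chol u M (Yd (k + 1))) \<and>
          (\<exists>V. fl_add_mult u (U (k + 1)) (- QQ k) (Y k) V \<and>
               fl_tri_solve u V (Yd (k + 1)) (Q (k + 1))) \<and>
          fl_add_mult u (S k) (Y k) (Sd (k + 1)) (R k) \<and>
          fl_mult u (Yd (k + 1)) (Sd (k + 1)) (Rd (k + 1)) \<and>
          QQ (k + 1) = append_cols (QQ k) (Q (k + 1)) \<and>
          RR (k + 1) = four_block_mat (RR k) (R k) (0\<^sub>m s (k * s)) (Rd (k + 1))))"

text \<open>The hypothesis on the computed output of the intraorthogonalization routine on an
  \<open>m \<times> s\<close> block, with the four constants hidden in the \<open>O(u)\<close> terms.\<close>

definition io_accurate ::
  "real \<Rightarrow> real \<Rightarrow> real \<Rightarrow> real \<Rightarrow> real \<Rightarrow> nat \<Rightarrow> nat \<Rightarrow>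
   (real mat \<Rightarrow> real mat \<times> real mat) \<Rightarrow> real mat \<Rightarrow> bool" where
  "io_accurate a1 a2 a3 a4 u m s IO X \<longleftrightarrow>
    (\<exists>Q R. IO X = (Q, R) \<and>
       Q \<in> carrier_mat m s \<and> R \<in> carrier_mat s s \<and> upper_triangular R \<and>
       (\<exists>D \<in> carrier_mat s s.
          transpose_mat R * R = transpose_mat X * X + D \<and> mnorm D \<le> a1 * u * (mnorm X)\<^sup>2) \<and>
       (\<exists>E \<in> carrier_mat m s. X + E = Q * R \<and> mnorm E \<le> a2 * u * mnorm X) \<and>
       mnorm (1\<^sub>m s - transpose_mat Q * Q) \<le> a3 * u / (1 - a4 * u * (kappa X)\<^sup>2))"

end

theory Submission
  imports "HOL-Analysis.L2_Norm" "HOL-Analysis.Convex" Defs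
begin

text \<open>Each iteration orthogonalizes \<open>X\<^sub>k\<^sub>+\<^sub>1\<close> twice in the same manner: subtract the projection
  onto \<open>\<Q>\<^sub>k\<close> and divide by a Cholesky factor of the Gram matrix of the remainder, which is obtained by
  Pythagoras. Since \<open>\<X>\<^sub>k + \<Delta> = \<Q>\<^sub>k \<R>\<^sub>k\<close> with \<open>\<R>\<^sub>k\<close> nonsingular, the first remainder
  maps \<open>v\<close>, up to a multiple of \<open>\<Delta>\<close>, to the image under \<open>\<X>\<^sub>k\<^sub>+\<^sub>1\<close> of a vector no shorter than \<open>v\<close>.
  So its singular values are at least half of \<open>\<sigma>\<^sub>m\<^sub>i\<^sub>n(\<X>\<^sub>k\<^sub>+\<^sub>1)\<close>, and the condition on
  \<open>O(u) \<kappa>\<^sup>2\<close> excludes a breakdown of the Cholesky factorization. After the first pass \<open>U\<^sub>k\<^sub>+\<^sub>1\<close> is orthonormal up to a small constant and orthogonal to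
  \<open>\<Q>\<^sub>k\<close> up to \<open>O(u) \<kappa>\<close>; in the second pass an error \<open>\<omega>\<close> in the orthogonality of \<open>\<Q>\<^sub>k\<close> enters only
  multiplied by this small quantity. So the new block column adds to \<open>I - \<Q>\<^sup>T \<Q>\<close> an \<open>O(u)\<close> whose
  constant is independent of \<open>\<omega>\<close>. Frobenius norms are used throughout, as they differ from the
  spectral norms by factors that are polynomial in the dimensions.\<close>



section \<open>Finitely supported matrices\<close>

text \<open>For k >= 2 the last rows of the block column \<open>S k\<close> are not computed as
  inner products with the newest basis block; they are recovered from \<open>Z\<close>,
  \<open>P\<close> and \<open>Y\<close>. This costs no condition number, because the recovery
  inverts only the Cholesky factor of the second pass, whose inverse is bounded by a modest
  constant, and not that of the first pass, whose inverse has size 1/\<sigma>. So the error of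
  \<open>S k\<close> keeps one fixed form, which each iteration assumes and reproduces for the next.
  Two circularities shape the estimates. The rounding error of a triangular solve is bounded
  relative to its own result; such bounds are implicit and are resolved because the unknown returns
  with a factor of at most 1/2. And the orthogonality error of the basis is a hypothesis of each
  iteration; what an iteration adds is kept a power of \<open>b\<close> below the assumed amount, so
  that p \<le> b iterations stay within it. Positive pivots cannot be presupposed. The Cholesky
  analysis therefore proves that each pivot is positive together with the error bounds for its
  column.\<close>

text \<open>Matrices of all shapes are put into one ring without unit, so that identities between
  rectangular matrices need no side conditions on dimensions; the norm is the Frobenius norm. The
  shapes are recovered from \<open>dims n m A\<close>, and \<open>idm n\<close> is the identity of size \<open>n\<close>.\<close>

typedef fmat = "{f :: nat \<Rightarrow> nat \<Rightarrow> real. \<exists>N. \<forall>i j. N \<le> i \<or> N \<le> j \<longrightarrow> f i j = 0}"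
  morphisms entry Abs_fmat
  by (rule exI[of _ "\<lambda>_ _. 0"]) simp

setup_lifting type_definition_fmat

text \<open>An upper bound on the support, not the exact shape. It may be enlarged at will, so a
  short vector is also a long one and padding by zeros is no operation at all.\<close>

definition dims :: "nat \<Rightarrow> nat \<Rightarrow> fmat \<Rightarrow> bool" where
  "dims n m A \<longleftrightarrow> (\<forall>i j. n \<le> i \<or> m \<le> j \<longrightarrow> entry A i j = 0)"

lemma fmat_eqI: "(\<And>i j. entry A i j = entry B i j) \<Longrightarrow> A = B"
  by (simp add: entry_inject[symmetric] ext)

lemma ex_dims: "\<exists>N. dims N N A"
  using entry[of A] by (auto simp: dims_def)

lemma dims_mono: "dims n m A \<Longrightarrow> n \<le> n' \<Longrightarrow> m \<le> m' \<Longrightarrow> dims n' m' A"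
  by (auto simp: dims_def)

lemma Abs_fmat_entry:
  assumes "\<And>i j. N \<le> i \<or> N \<le> j \<Longrightarrow> f i j = 0"
  shows "entry (Abs_fmat f) = f"
  using assms by (intro Abs_fmat_inverse) blast

instantiation fmat :: real_vector
begin

lift_definition zero_fmat :: fmat is "\<lambda>_ _. 0" by simp

lift_definition plus_fmat :: "fmat \<Rightarrow> fmat \<Rightarrow> fmat" is "\<lambda>f g i j. f i j + g i j"
  subgoal for f g by (elim exE, rule_tac x = "max N Na" in exI) auto
  done

lift_definition minus_fmat :: "fmat \<Rightarrow> fmat \<Rightarrow> fmat" is "\<lambda>f g i j. f i j - g i j"
  subgoal for f g by (elim exE, rule_tac x = "max N Na" in exI) auto
  done

lift_definition uminus_fmat :: "fmat \<Rightarrow> fmat" is "\<lambda>f i j. - f i j" by simp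

lift_definition scaleR_fmat :: "real \<Rightarrow> fmat \<Rightarrow> fmat" is "\<lambda>c f i j. c * f i j"
  by (metis mult_zero_right)

instance
  by standard (transfer; simp add: fun_eq_iff algebra_simps)+

end

lemma entry_simps [simp]:
  "entry 0 i j = 0" "entry (A + B) i j = entry A i j + entry B i j"
  "entry (A - B) i j = entry A i j - entry B i j" "entry (- A) i j = - entry A i j"
  "entry (c *\<^sub>R A) i j = c * entry A i j"
  by (transfer; simp)+

lift_definition transp :: "fmat \<Rightarrow> fmat" is "\<lambda>f i j. f j i" by blast

lift_definition idm :: "nat \<Rightarrow> fmat" is "\<lambda>n i j. if i = j \<and> i < n then 1 else 0"
  by (metis not_le)

lift_definition absm :: "fmat \<Rightarrow> fmat" is "\<lambda>f i j. \<bar>f i j\<bar>" by (metis abs_zero)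

lift_definition emb :: "real mat \<Rightarrow> fmat" is
  "\<lambda>M i j. if i < dim_row M \<and> j < dim_col M then M $$ (i, j) else 0"
  subgoal for M by (rule exI[of _ "max (dim_row M) (dim_col M)"]) auto
  done

lemma entry_transp [simp]: "entry (transp A) i j = entry A j i"
  by transfer simp

lemma entry_idm [simp]: "entry (idm n) i j = (if i = j \<and> i < n then 1 else 0)"
  by transfer simp

lemma entry_absm [simp]: "entry (absm A) i j = \<bar>entry A i j\<bar>"
  by transfer simp

lemma entry_emb: "entry (emb M) i j = (if i < dim_row M \<and> j < dim_col M then M $$ (i, j) else 0)"
  by (simp add: emb.rep_eq)

instantiation fmat :: ring
begin

text \<open>Summing over the nonzero entries of a row keeps the range finite without choosing a
  size; \<open>entry_mult\<close> replaces it by any range that covers the support of the left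
  factor.\<close>

definition times_fmat :: "fmat \<Rightarrow> fmat \<Rightarrow> fmat" where
  "A * B = Abs_fmat (\<lambda>i j. \<Sum>k | entry A i k \<noteq> 0. entry A i k * entry B k j)"

lemma entry_mult0:
  "entry (A * B) i j = (\<Sum>k | entry A i k \<noteq> 0. entry A i k * entry B k j)"
proof -
  obtain N M where "dims N N A" "dims M M B" using ex_dims by blast
  then show ?thesis
    unfolding times_fmat_def
    by (subst Abs_fmat_entry[of "max N M"]) (auto simp: dims_def intro!: sum.neutral)
qed

lemma entry_mult_row:
  assumes "\<And>k. n \<le> k \<Longrightarrow> entry A i k = 0"
  shows "entry (A * B) i j = (\<Sum>k<n. entry A i k * entry B k j)"
  unfolding entry_mult0
  by (rule sum.mono_neutral_left) (use assms in \<open>auto simp: not_le[symmetric]\<close>)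

lemma entry_mult: "dims m n A \<Longrightarrow> entry (A * B) i j = (\<Sum>k<n. entry A i k * entry B k j)"
  by (rule entry_mult_row) (auto simp: dims_def)

lemma dims2: obtains N where "dims N N A" "dims N N B"
proof -
  obtain N M where "dims N N A" "dims M M B" using ex_dims by blast
  then have "dims (max N M) (max N M) A" "dims (max N M) (max N M) B"
    by (auto elim: dims_mono)
  then show ?thesis using that by blast
qed

lemma dims3: obtains N where "dims N N A" "dims N N B" "dims N N C"
proof -
  obtain N M where "dims N N A" "dims N N B" "dims M M C" using ex_dims dims2 by metis
  then have "dims (max N M) (max N M) A" "dims (max N M) (max N M) B" "dims (max N M) (max N M) C"
    by (auto elim: dims_mono)
  then show ?thesis using that by blast
qed

lemma dims_add: "dims n m A \<Longrightarrow> dims n m B \<Longrightarrow> dims n m (A + B)"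
  and dims_diff: "dims n m A \<Longrightarrow> dims n m B \<Longrightarrow> dims n m (A - B)"
  and dims_scaleR: "dims n m A \<Longrightarrow> dims n m (c *\<^sub>R A)"
  and dims_transp: "dims n m A \<Longrightarrow> dims m n (transp A)"
  and dims_idm: "dims n n (idm n)"
  by (auto simp: dims_def)

lemma dims_mult:
  assumes "dims n k A" "dims l m B" shows "dims n m (A * B)"
  unfolding dims_def
proof (intro allI impI)
  fix i j assume "n \<le> i \<or> m \<le> j"
  then show "entry (A * B) i j = 0"
    using assms by (auto simp: entry_mult[OF assms(1)] dims_def intro!: sum.neutral)
qed

instance
proof
  fix A B C :: fmat
  obtain N where AB: "dims N N A" "dims N N B" "dims N N C" by (rule dims3)
  note AB' = AB dims_add[OF AB(1,2)] dims_mult[OF AB(1,2)]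
  show "A * B * C = A * (B * C)"
  proof (rule fmat_eqI)
    fix i j
    have "entry (A * B * C) i j = (\<Sum>k<N. \<Sum>l<N. entry A i l * entry B l k * entry C k j)"
      by (simp add: AB'(5)[THEN entry_mult] AB(1)[THEN entry_mult] sum_distrib_right)
    also have "\<dots> = (\<Sum>l<N. \<Sum>k<N. entry A i l * entry B l k * entry C k j)"
      by (rule sum.swap)
    also have "\<dots> = entry (A * (B * C)) i j"
      by (simp add: AB(1)[THEN entry_mult] AB(2)[THEN entry_mult] sum_distrib_left mult.assoc)
    finally show "entry (A * B * C) i j = entry (A * (B * C)) i j" .
  qed
  show "(A + B) * C = A * C + B * C"
    by (rule fmat_eqI) (simp add: AB'[THEN entry_mult] sum.distrib distrib_right)
  show "A * (B + C) = A * B + A * C"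
    by (rule fmat_eqI) (simp add: AB'[THEN entry_mult] sum.distrib distrib_left)
qed

end

lemma L2_set_dims:
  assumes "dims n m A"
  shows "L2_set (\<lambda>(i, j). entry A i j) {(i, j). entry A i j \<noteq> 0} =
    L2_set (\<lambda>(i, j). entry A i j) ({..<n} \<times> {..<m})"
  unfolding L2_set_def
  by (rule arg_cong[of _ _ sqrt], rule sum.mono_neutral_left)
    (use assms in \<open>auto simp: dims_def not_le[symmetric]\<close>)

instantiation fmat :: real_normed_vector
begin

definition norm_fmat :: "fmat \<Rightarrow> real" where
  "norm_fmat A = L2_set (\<lambda>(i, j). entry A i j) {(i, j). entry A i j \<noteq> 0}"

definition dist_fmat :: "fmat \<Rightarrow> fmat \<Rightarrow> real" where "dist_fmat A B = norm (A - B)"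

definition sgn_fmat :: "fmat \<Rightarrow> fmat" where "sgn_fmat A = A /\<^sub>R norm A"

definition uniformity_fmat :: "(fmat \<times> fmat) filter" where
  "(uniformity :: (fmat \<times> fmat) filter) = (INF e\<in>{0 <..}. principal {(A, B). dist A B < e})"

definition open_fmat :: "fmat set \<Rightarrow> bool" where
  "open_fmat U = (\<forall>A\<in>U. \<forall>\<^sub>F (B, C) in uniformity. B = A \<longrightarrow> C \<in> U)"

lemma norm_dims: "dims n m A \<Longrightarrow> norm A = L2_set (\<lambda>(i, j). entry A i j) ({..<n} \<times> {..<m})"
  by (simp add: norm_fmat_def L2_set_dims)

instance
proof
  fix A B :: fmat and c :: real
  obtain N where AB: "dims N N A" "dims N N B" by (rule dims2)
  note AB' = AB[THEN norm_dims] dims_add[OF AB, THEN norm_dims] dims_scaleR[OF AB(1), THEN norm_dims]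
  show "(norm A = 0) = (A = 0)"
    using AB(1) by (auto simp: AB'(1) L2_set_eq_0_iff dims_def intro!: fmat_eqI)
      (metis lessThan_iff not_le)
  show "norm (A + B) \<le> norm A + norm B"
    unfolding AB'
    by (rule order_trans[OF eq_refl L2_set_triangle_ineq]) (rule L2_set_cong; auto)
  show "norm (c *\<^sub>R A) = \<bar>c\<bar> * norm A"
    unfolding AB'
    by (simp add: L2_set_def case_prod_unfold power_mult_distrib sum_distrib_left[symmetric]
        real_sqrt_mult)
qed (simp_all add: dist_fmat_def sgn_fmat_def uniformity_fmat_def open_fmat_def)

end

lemma norm_sq_dims:
  assumes "dims n m A" shows "(norm A)\<^sup>2 = (\<Sum>i<n. \<Sum>j<m. (entry A i j)\<^sup>2)"
  by (simp add: norm_dims[OF assms] L2_set_def sum_nonneg sum.cartesian_product case_prod_beta)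

instantiation fmat :: real_inner
begin

text \<open>The trace form of \<open>transp A * B\<close>. On one-column matrices it is the dot
  product, so \<open>inner v (A * v)\<close> is the quadratic form of \<open>A\<close>.\<close>

definition inner_fmat :: "fmat \<Rightarrow> fmat \<Rightarrow> real" where
  "inner A B = (\<Sum>(i, j) | entry A i j \<noteq> 0. entry A i j * entry B i j)"

lemma inner_dims:
  assumes "dims n m A"
  shows "inner A B = (\<Sum>i<n. \<Sum>j<m. entry A i j * entry B i j)"
proof -
  have "{(i, j). entry A i j \<noteq> 0} \<subseteq> {..<n} \<times> {..<m}"
    using assms by (auto simp: dims_def not_le[symmetric])
  then have "inner A B = (\<Sum>(i, j)\<in>{..<n} \<times> {..<m}. entry A i j * entry B i j)"
    unfolding inner_fmat_def
    by (intro sum.mono_neutral_left) auto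
  then show ?thesis by (simp add: sum.cartesian_product)
qed

instance
proof
  fix A B C :: fmat and c :: real
  obtain N where AB: "dims N N A" "dims N N B" "dims N N C" by (rule dims3)
  note AB' = AB dims_add[OF AB(1,2)] dims_scaleR[OF AB(1)]
  show "inner A B = inner B A"
    by (simp add: AB[THEN inner_dims] mult.commute)
  show "inner (A + B) C = inner A C + inner B C"
    by (simp add: AB'[THEN inner_dims] sum.distrib distrib_right)
  show "inner (c *\<^sub>R A) B = c * inner A B"
    by (simp add: AB'[THEN inner_dims] sum_distrib_left mult.assoc)
  show nn: "0 \<le> inner A A"
    by (simp add: AB[THEN inner_dims] sum_nonneg)
  have "inner A A = (norm A)\<^sup>2"
    by (simp add: AB[THEN inner_dims] norm_sq_dims[OF AB(1)]) (simp add: power2_eq_square)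
  then show "(inner A A = 0) = (A = 0)" "norm A = sqrt (inner A A)" by auto
qed

end

instance fmat :: real_normed_algebra
proof
  fix A B :: fmat and c :: real
  obtain N where AB: "dims N N A" "dims N N B" by (rule dims2)
  show "c *\<^sub>R A * B = c *\<^sub>R (A * B)"
    by (rule fmat_eqI)
      (simp add: AB(1)[THEN entry_mult] dims_scaleR[OF AB(1), THEN entry_mult] sum_distrib_left
        mult.assoc)
  show "A * c *\<^sub>R B = c *\<^sub>R (A * B)"
    by (rule fmat_eqI) (simp add: AB(1)[THEN entry_mult] sum_distrib_left mult_ac)
  have "(norm (A * B))\<^sup>2 = (\<Sum>i<N. \<Sum>j<N. (\<Sum>k<N. entry A i k * entry B k j)\<^sup>2)"
    by (simp add: norm_sq_dims[OF dims_mult[OF AB]] entry_mult[OF AB(1)])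
  also have "\<dots> \<le> (\<Sum>i<N. \<Sum>j<N. (\<Sum>k<N. (entry A i k)\<^sup>2) * (\<Sum>k<N. (entry B k j)\<^sup>2))"
    by (intro sum_mono Cauchy_Schwarz_ineq_sum)
  also have "\<dots> = (norm A)\<^sup>2 * (norm B)\<^sup>2"
  proof -
    have "(norm B)\<^sup>2 = (\<Sum>j<N. \<Sum>i<N. (entry B i j)\<^sup>2)"
      unfolding norm_sq_dims[OF AB(2)] by (rule sum.swap)
    then show ?thesis by (simp add: norm_sq_dims[OF AB(1)] sum_product)
  qed
  finally show "norm (A * B) \<le> norm A * norm B"
    by (simp add: power_mult_distrib[symmetric] power2_le_iff_abs_le)
qed


section \<open>Transposition, adjoints and entrywise estimates\<close>

lemma dims_outside: "dims n m A \<Longrightarrow> n \<le> i \<or> m \<le> j \<Longrightarrow> entry A i j = 0"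
  unfolding dims_def by blast

lemma dims_absm: "dims n m A \<Longrightarrow> dims n m (absm A)"
  by (auto simp: dims_def)

lemma dims_emb: "M \<in> carrier_mat n m \<Longrightarrow> dims n m (emb M)"
  by (auto simp: dims_def entry_emb)

lemma transp_simps [simp]:
  "transp (transp A) = A" "transp (A + B) = transp A + transp B" "transp (idm n) = idm n"
  "transp (A - B) = transp A - transp B" "transp (- A) = - transp A" "transp 0 = 0"
  "transp (c *\<^sub>R A) = c *\<^sub>R transp A"
  by (rule fmat_eqI; simp)+

lemma transp_mult [simp]: "transp (A * B) = transp B * transp A"
proof (rule fmat_eqI)
  fix i j
  obtain N where AB: "dims N N A" "dims N N B" by (rule dims2)
  show "entry (transp (A * B)) i j = entry (transp B * transp A) i j"
    by (simp add: entry_mult[OF AB(1)] entry_mult[OF dims_transp[OF AB(2)]] mult.commute)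
qed

lemma inner_transp: "inner (transp A) (transp B) = inner A B"
proof -
  obtain N where "dims N N A" using ex_dims by blast
  then show ?thesis
    by (simp add: inner_dims[of N N A] inner_dims[of N N "transp A"] dims_transp)
      (rule sum.swap)
qed

lemma norm_transp [simp]: "norm (transp A) = norm A"
  by (simp add: norm_eq_sqrt_inner inner_transp)

lemma inner_mult_left: "inner (A * B) C = inner B (transp A * C)"
proof -
  obtain N where AB: "dims N N A" "dims N N B" "dims N N C" by (rule dims3)
  have "inner (A * B) C = (\<Sum>i<N. \<Sum>j<N. \<Sum>k<N. entry A i k * entry B k j * entry C i j)"
    by (simp add: inner_dims[OF dims_mult[OF AB(1,2)]] entry_mult[OF AB(1)] sum_distrib_right)
  also have "\<dots> = (\<Sum>i<N. \<Sum>k<N. \<Sum>j<N. entry A i k * entry B k j * entry C i j)"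
    by (intro sum.cong refl sum.swap)
  also have "\<dots> = (\<Sum>k<N. \<Sum>i<N. \<Sum>j<N. entry A i k * entry B k j * entry C i j)"
    by (rule sum.swap)
  also have "\<dots> = (\<Sum>k<N. \<Sum>j<N. \<Sum>i<N. entry A i k * entry B k j * entry C i j)"
    by (intro sum.cong refl sum.swap)
  also have "\<dots> = inner B (transp A * C)"
    by (simp add: inner_dims[OF AB(2)] entry_mult[OF dims_transp[OF AB(1)]] sum_distrib_left mult_ac)
  finally show ?thesis .
qed

lemma norm_sq_mult: "(norm (A * B))\<^sup>2 = inner B (transp A * A * B)"
  by (simp add: power2_norm_eq_inner inner_mult_left mult.assoc)

lemma abs_inner_mult_le: "\<bar>inner v (A * v)\<bar> \<le> norm A * (norm v)\<^sup>2" for A v :: fmat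
  using Cauchy_Schwarz_ineq2[of v "A * v"] mult_left_mono[OF norm_mult_ineq[of A v] norm_ge_zero[of v]]
  by (simp add: power2_eq_square mult_ac)

lemma norm_absm [simp]: "norm (absm A) = norm A"
proof -
  obtain N where "dims N N A" using ex_dims by blast
  then have "(norm (absm A))\<^sup>2 = (norm A)\<^sup>2"
    by (simp add: norm_sq_dims[of N N] dims_absm)
  then show ?thesis by simp
qed

lemma norm_mono:
  assumes "\<And>i j. \<bar>entry A i j\<bar> \<le> entry B i j" shows "norm A \<le> norm B"
proof -
  obtain N where N: "dims N N A" "dims N N B" by (rule dims2)
  have "(norm A)\<^sup>2 \<le> (norm B)\<^sup>2"
    unfolding norm_sq_dims[OF N(1)] norm_sq_dims[OF N(2)]
    by (intro sum_mono) (metis abs_ge_zero assms power2_abs power_mono)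
  then show ?thesis by (simp add: power2_le_iff_abs_le)
qed

lemma entry_le_norm: "\<bar>entry A i j\<bar> \<le> norm A"
proof -
  obtain N where "dims N N A" using ex_dims by blast
  \<comment> \<open>The bound is enlarged beyond \<open>i\<close> and \<open>j\<close>, so that both
    indices lie in the ranges of the double sum even when the entry is outside the support.\<close>
  then have N: "dims (N + Suc (i + j)) (N + Suc (i + j)) A" (is "dims ?N _ A")
    by (auto elim: dims_mono)
  have "(entry A i j)\<^sup>2 \<le> (\<Sum>j<?N. (entry A i j)\<^sup>2)"
    by (rule member_le_sum[of j _ "\<lambda>j. (entry A i j)\<^sup>2"]) auto
  also have "\<dots> \<le> (norm A)\<^sup>2"
    unfolding norm_sq_dims[OF N]
    by (rule member_le_sum[of i _ "\<lambda>i. \<Sum>j<?N. (entry A i j)\<^sup>2"])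
      (auto intro!: sum_nonneg simp del: sum.lessThan_Suc)
  finally show ?thesis by (simp add: abs_le_square_iff[symmetric])
qed

lemma norm_le_entries:
  assumes "dims n n A" "0 \<le> e" "\<And>i j. i < n \<Longrightarrow> j < n \<Longrightarrow> \<bar>entry A i j\<bar> \<le> e"
  shows "norm A \<le> real n * e"
proof -
  have "(norm A)\<^sup>2 \<le> (\<Sum>i<n. \<Sum>j<n. e\<^sup>2)"
    unfolding norm_sq_dims[OF assms(1)]
    by (intro sum_mono) (metis abs_ge_zero assms(3) lessThan_iff power2_abs power_mono)
  also have "\<dots> = (real n * e)\<^sup>2" by (simp add: power2_eq_square)
  finally show ?thesis using assms(2) by (simp add: power2_le_iff_abs_le)
qed

lemma idm_mult:
  assumes "dims n m A" shows "idm n * A = A"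
proof (rule fmat_eqI)
  fix i j
  have "entry (idm n * A) i j = (\<Sum>k<n. if i = k then entry A k j else 0)"
    unfolding entry_mult[OF dims_idm] by (intro sum.cong) auto
  then show "entry (idm n * A) i j = entry A i j" using assms by (auto simp: dims_def)
qed

lemma mult_idm: "dims m n A \<Longrightarrow> A * idm n = A"
  using idm_mult[of n m "transp A"] dims_transp[of m n A] by (metis transp_mult transp_simps(1,3))

lemma norm_idm: "(norm (idm n))\<^sup>2 = n"
  by (simp add: norm_sq_dims[OF dims_idm] if_distrib[of "\<lambda>x. x\<^sup>2"] cong: if_cong)

lemma emb_mult: "dim_col A = dim_row B \<Longrightarrow> emb (A * B) = emb A * emb B"
  by (rule fmat_eqI, subst entry_mult[OF dims_emb[of A "dim_row A" "dim_col A"]])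
    (auto simp: entry_emb scalar_prod_def atLeast0LessThan intro!: sum.cong)

lemma emb_add: "dim_row A = dim_row B \<Longrightarrow> dim_col A = dim_col B \<Longrightarrow> emb (A + B) = emb A + emb B"
  by (rule fmat_eqI) (auto simp: entry_emb)

lemma emb_diff: "dim_row A = dim_row B \<Longrightarrow> dim_col A = dim_col B \<Longrightarrow> emb (A - B) = emb A - emb B"
  by (rule fmat_eqI) (auto simp: entry_emb)

lemma emb_uminus: "emb (- A) = - emb A"
  by (rule fmat_eqI) (auto simp: entry_emb)

lemma emb_transpose: "emb (transpose_mat A) = transp (emb A)"
  by (rule fmat_eqI) (auto simp: entry_emb)

lemma emb_one: "emb (1\<^sub>m n) = idm n"
  by (rule fmat_eqI) (auto simp: entry_emb)

section \<open>Inverses by way of determinants\<close>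

definition proj :: "nat \<Rightarrow> nat \<Rightarrow> fmat \<Rightarrow> real mat" where
  "proj n m A = mat n m (\<lambda>(i, j). entry A i j)"

lemma proj_carrier [simp]: "proj n m A \<in> carrier_mat n m"
  by (simp add: proj_def)

lemma emb_proj: "dims n m A \<Longrightarrow> emb (proj n m A) = A"
  by (rule fmat_eqI) (auto simp: entry_emb proj_def dims_def not_less)

text \<open>The ring has no unit, so an inverse is one relative to \<open>idm n\<close>. A zero
  determinant would yield a kernel vector, which as a one-column matrix contradicts
  \<open>inj\<close>; a nonzero one makes the matrix a unit, with both one-sided identities.\<close>

lemma inverse_exists:
  assumes G: "dims n n G" and inj: "\<And>V. dims n 1 V \<Longrightarrow> G * V = 0 \<Longrightarrow> V = 0"
  obtains H where "dims n n H" "G * H = idm n" "H * G = idm n"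
proof -
  let ?M = "proj n n G"
  have "det ?M \<noteq> 0"
  proof
    assume "det ?M = 0"
    then obtain v where v: "v \<in> carrier_vec n" "v \<noteq> 0\<^sub>v n" "?M *\<^sub>v v = 0\<^sub>v n"
      using det_0_iff_vec_prod_zero[OF proj_carrier] by blast
    define B where "B = mat n 1 (\<lambda>(i, j). v $ i)"
    have B: "B \<in> carrier_mat n 1" by (simp add: B_def)
    have "?M * B = 0\<^sub>m n 1"
    proof (rule eq_matI)
      fix i j assume ij: "i < dim_row (0\<^sub>m n 1 :: real mat)" "j < dim_col (0\<^sub>m n 1 :: real mat)"
      have "(?M * B) $$ (i, j) = (?M *\<^sub>v v) $ i"
        using ij v(1) by (auto simp: B_def scalar_prod_def proj_def)
      then show "(?M * B) $$ (i, j) = 0\<^sub>m n 1 $$ (i, j)" using ij v by simp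
    qed (auto simp: B_def proj_def)
    then have "G * emb B = emb (0\<^sub>m n 1)"
      using emb_mult[of ?M B] B emb_proj[OF G] by (auto simp: proj_def)
    also have "\<dots> = 0" by (rule fmat_eqI) (auto simp: entry_emb)
    finally have "emb B = 0" using inj dims_emb[OF B] by blast
    then have "entry (emb B) i 0 = 0" for i by simp
    then have "B $$ (i, 0) = 0" if "i < n" for i
      using that B by (metis carrier_matD entry_emb less_one)
    then have "v = 0\<^sub>v n" using v(1) by (intro eq_vecI) (auto simp: B_def)
    then show False using v by simp
  qed
  then obtain N where N: "N \<in> carrier_mat n n" "N * ?M = 1\<^sub>m n" "?M * N = 1\<^sub>m n"
    using det_non_zero_imp_unit[OF proj_carrier, of n G "()"]
    by (auto simp: Units_def ring_mat_def)
  show ?thesis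
  proof (rule that[of "emb N"])
    show "G * emb N = idm n" "emb N * G = idm n"
      using emb_mult[of ?M N] emb_mult[of N ?M] N emb_proj[OF G] emb_one[of n]
        carrier_matD[OF proj_carrier[of n n G]] by auto
  qed (use N dims_emb in auto)
qed


section \<open>Rounding errors\<close>

text \<open>A tree of additions has at least one leaf; this keeps \<open>size A - 1\<close> from
  truncating in the error bound.\<close>

lemma fl_sum_size: "fl_sum u A t \<Longrightarrow> 0 < size A"
  by (induction rule: fl_sum.induct) auto

text \<open>In a tree with n leaves every leaf has depth at most n - 1, so each summand collects at
  most n - 1 factors 1 + \<delta>, in whatever order the sum is evaluated.\<close>

lemma fl_sum_error:
  assumes "fl_sum u A t" and u: "0 \<le> u"
  shows "\<bar>t - sum_mset A\<bar> \<le> ((1 + u) ^ (size A - 1) - 1) * sum_mset (image_mset abs A)"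
  using assms(1)
proof (induction rule: fl_sum.induct)
  case (single x)
  then show ?case by simp
next
  case (plus A x B y z)
  define a where "a = (1 + u) ^ (size A - 1)"
  define b where "b = (1 + u) ^ (size B - 1)"
  define c where "c = (1 + u) ^ (size (A + B) - 1)"
  define p where "p = sum_mset (image_mset abs A)"
  define q where "q = sum_mset (image_mset abs B)"
  have sz: "0 < size A" "0 < size B" using plus.hyps fl_sum_size by auto
  have "\<bar>sum_mset M\<bar> \<le> sum_mset (image_mset abs M)" for M :: "real multiset"
    by (induction M) auto
  then have pq: "\<bar>sum_mset A\<bar> \<le> p" "\<bar>sum_mset B\<bar> \<le> q" "0 \<le> p" "0 \<le> q"
    unfolding p_def q_def by (auto intro: order_trans[OF abs_ge_zero])
  \<comment> \<open>One rounding more than in a subtree fits into the exponent because the other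
    subtree is nonempty.\<close>
  have ab: "(1 + u) * a \<le> c" "(1 + u) * b \<le> c"
    unfolding a_def b_def c_def power_Suc[symmetric] using u sz
    by (auto intro!: power_increasing)
  obtain d where d: "\<bar>d\<bar> \<le> u" "z = (x + y) * (1 + d)"
    using plus.hyps(3) unfolding rounds_def by blast
  define s where "s = x + y - (sum_mset A + sum_mset B)"
  have s: "\<bar>s\<bar> \<le> (a - 1) * p + (b - 1) * q"
    using plus.IH unfolding s_def a_def[symmetric] b_def[symmetric] p_def[symmetric] q_def[symmetric]
    by linarith
  have "z - (sum_mset A + sum_mset B) = s * (1 + d) + d * (sum_mset A + sum_mset B)"
    unfolding d s_def by (simp add: algebra_simps)
  also have "\<bar>\<dots>\<bar> \<le> \<bar>s\<bar> * (1 + u) + u * (p + q)"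
  proof -
    have "\<bar>s * (1 + d)\<bar> \<le> \<bar>s\<bar> * (1 + u)"
      unfolding abs_mult by (rule mult_left_mono) (use d in auto)
    moreover have "\<bar>d * (sum_mset A + sum_mset B)\<bar> \<le> u * (p + q)"
      unfolding abs_mult by (rule mult_mono) (use d pq u in auto)
    ultimately show ?thesis by linarith
  qed
  also have "\<dots> \<le> ((a - 1) * p + (b - 1) * q) * (1 + u) + u * (p + q)"
    using s u by (simp add: mult_right_mono)
  also have "\<dots> = ((1 + u) * a - 1) * p + ((1 + u) * b - 1) * q" by (simp add: algebra_simps)
  also have "\<dots> \<le> (c - 1) * p + (c - 1) * q"
    using ab pq by (intro add_mono mult_right_mono) auto
  finally show ?case
    by (simp add: c_def p_def q_def algebra_simps)
qed

text \<open>The factor 2 absorbs the quadratic term in the bound for the exponential.\<close>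

lemma power_one_plus_le:
  assumes "0 \<le> u" "real n * u \<le> 1"
  shows "(1 + u) ^ n \<le> 1 + 2 * real n * u"
proof -
  have "(1 + u) ^ n \<le> exp u ^ n" using assms by (intro power_mono) auto
  also have "\<dots> = exp (real n * u)" by (simp add: exp_of_nat_mult)
  also have "\<dots> \<le> 1 + real n * u + (real n * u)\<^sup>2" using assms by (intro exp_bound) auto
  also have "(real n * u)\<^sup>2 \<le> real n * u * 1"
    unfolding power2_eq_square using assms by (intro mult_left_mono) auto
  finally show ?thesis by (simp add: mult_ac)
qed

lemma rounds_error: "rounds u x y \<Longrightarrow> \<bar>y - x\<bar> \<le> u * \<bar>x\<bar>"
  unfolding rounds_def by (auto simp: distrib_left abs_mult mult.commute[of x] intro!: mult_right_mono)

text \<open>Rounding a product costs one factor more than the \<open>size A + n - 1\<close>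
  additions. \<open>A\<close> holds the summands that are not products: it is empty for a matrix
  product and \<open>{#c#}\<close> when \<open>c\<close> is added.\<close>

lemma fl_sum_image_error:
  assumes t: "fl_sum u (A + image_mset q (mset_set {..<n})) t"
    and q: "\<And>l. l < n \<Longrightarrow> rounds u (x l) (q l)"
    and u: "0 \<le> u" and sz: "real (size A + n) * u \<le> 1"
  shows "\<bar>t - (sum_mset A + (\<Sum>l<n. x l))\<bar> \<le>
    2 * real (size A + n) * u * (sum_mset (image_mset abs A) + (\<Sum>l<n. \<bar>x l\<bar>))"
proof -
  define k where "k = size A + n - 1"
  have k: "0 < size A + n" using fl_sum_size[OF t] by simp
  have Suc_k: "Suc k = size A + n" using k unfolding k_def by linarith
  define r where "r = (1 + u) ^ k"
  define p where "p = sum_mset (image_mset abs A)"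
  define y where "y = (\<Sum>l<n. \<bar>x l\<bar>)"
  have p: "0 \<le> p" unfolding p_def by (induction A) auto
  have r: "1 \<le> r" unfolding r_def using u by simp
  have "\<bar>(\<Sum>l<n. q l) - (\<Sum>l<n. x l)\<bar> \<le> (\<Sum>l<n. u * \<bar>x l\<bar>)"
    unfolding sum_subtractf[symmetric]
    by (rule order_trans[OF sum_abs]) (auto intro!: sum_mono rounds_error q)
  then have 1: "\<bar>(\<Sum>l<n. q l) - (\<Sum>l<n. x l)\<bar> \<le> u * y"
    by (simp add: y_def sum_distrib_left)
  have "(\<Sum>l<n. \<bar>q l\<bar>) \<le> (\<Sum>l<n. (1 + u) * \<bar>x l\<bar>)"
  proof (rule sum_mono)
    fix l assume "l \<in> {..<n}"
    then have "\<bar>q l - x l\<bar> \<le> u * \<bar>x l\<bar>" using rounds_error q by auto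
    then show "\<bar>q l\<bar> \<le> (1 + u) * \<bar>x l\<bar>" by (simp add: algebra_simps)
  qed
  then have 2: "(\<Sum>l<n. \<bar>q l\<bar>) \<le> (1 + u) * y"
    by (simp add: y_def sum_distrib_left)
  have "\<bar>t - (sum_mset A + (\<Sum>l<n. q l))\<bar> \<le> (r - 1) * (p + (\<Sum>l<n. \<bar>q l\<bar>))"
    using fl_sum_error[OF t u]
    by (simp add: r_def k_def p_def sum_unfold_sum_mset[symmetric] image_mset.compositionality comp_def)
  also have "\<dots> \<le> (r - 1) * (p + (1 + u) * y)"
    using 2 r by (intro mult_left_mono) auto
  finally have "\<bar>t - (sum_mset A + (\<Sum>l<n. x l))\<bar> \<le> (r - 1) * (p + (1 + u) * y) + u * y"
    using 1 by linarith
  \<comment> \<open>The two sides differ by \<open>u * r * p\<close>.\<close>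
  also have "\<dots> \<le> ((1 + u) * r - 1) * (p + y)"
    using mult_nonneg_nonneg[OF mult_nonneg_nonneg[OF u p], of r] r by (simp add: algebra_simps)
  also have "\<dots> \<le> 2 * real (size A + n) * u * (p + y)"
  proof (rule mult_right_mono)
    show "(1 + u) * r - 1 \<le> 2 * real (size A + n) * u"
      using power_one_plus_le[of u "Suc k"] u sz unfolding Suc_k[symmetric] r_def by simp
  qed (auto simp: p y_def intro!: add_nonneg_nonneg sum_nonneg)
  finally show ?thesis by (simp add: p_def y_def)
qed

lemma fl_add_inner_error:
  assumes "fl_add_inner u c n a b t" "0 \<le> u" "real (n + 1) * u \<le> 1" "2 * real (n + 1) * u \<le> g"
  shows "\<bar>t - (c + (\<Sum>l<n. a l * b l))\<bar> \<le> g * (\<bar>c\<bar> + (\<Sum>l<n. \<bar>a l\<bar> * \<bar>b l\<bar>))"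
proof -
  obtain q where q: "\<And>l. l < n \<Longrightarrow> rounds u (a l * b l) (q l)"
    "fl_sum u ({#c#} + image_mset q (mset_set {..<n})) t"
    using assms(1) unfolding fl_add_inner_def by auto
  have "\<bar>t - (c + (\<Sum>l<n. a l * b l))\<bar> \<le>
    2 * real (n + 1) * u * (\<bar>c\<bar> + (\<Sum>l<n. \<bar>a l\<bar> * \<bar>b l\<bar>))"
    using fl_sum_image_error[OF q(2), of "\<lambda>l. a l * b l"] q(1) assms(2,3) by (simp add: abs_mult)
  also have "\<dots> \<le> g * (\<bar>c\<bar> + (\<Sum>l<n. \<bar>a l\<bar> * \<bar>b l\<bar>))"
    using assms(4) by (intro mult_right_mono) (auto intro!: add_nonneg_nonneg sum_nonneg)
  finally show ?thesis .
qed

text \<open>The error is measured against the computed \<open>x * c\<close>, because in the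
  residuals of substitution and of Cholesky this is one of the terms on the right anyway. With
  \<open>u \<le> 1 / 2\<close> the exact \<open>t\<close> is at most twice as large.\<close>

lemma rounds_div_error:
  assumes "rounds u (t / c) x" "c \<noteq> 0" "u \<le> 1 / 2"
  shows "\<bar>x * c - t\<bar> \<le> 2 * u * \<bar>x * c\<bar>"
proof -
  obtain d where d: "\<bar>d\<bar> \<le> u" "x = t / c * (1 + d)"
    using assms(1) unfolding rounds_def by blast
  have xc: "x * c = t * (1 + d)" unfolding d(2) using assms(2) by simp
  have "\<bar>t\<bar> * (1 / 2) \<le> \<bar>t\<bar> * \<bar>1 + d\<bar>" using d assms(3) by (intro mult_left_mono) linarith+
  then have "\<bar>t\<bar> \<le> 2 * \<bar>x * c\<bar>" unfolding xc abs_mult by linarith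
  then have "\<bar>t\<bar> * \<bar>d\<bar> \<le> (2 * \<bar>x * c\<bar>) * u" using d by (intro mult_mono) auto
  moreover have "\<bar>x * c - t\<bar> = \<bar>t\<bar> * \<bar>d\<bar>" unfolding xc by (simp add: algebra_simps abs_mult)
  ultimately show ?thesis by (simp add: mult_ac)
qed

text \<open>Componentwise rounding error bounds become normwise ones because the Frobenius norm is
  submultiplicative and depends on the moduli of the entries only.\<close>

lemma norm_le_componentwise:
  assumes E: "dims n m E" and A: "dims n k A" and g: "0 \<le> g"
    and le: "\<And>i j. i < n \<Longrightarrow> j < m \<Longrightarrow>
      \<bar>entry E i j\<bar> \<le> g * (\<bar>entry C i j\<bar> + (\<Sum>l<k. \<bar>entry A i l\<bar> * \<bar>entry B l j\<bar>))"
  shows "norm E \<le> g * (norm C + norm A * norm B)"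
proof -
  have "norm E \<le> norm (g *\<^sub>R (absm C + absm A * absm B))"
  proof (rule norm_mono)
    fix i j
    have eq: "entry (g *\<^sub>R (absm C + absm A * absm B)) i j =
      g * (\<bar>entry C i j\<bar> + (\<Sum>l<k. \<bar>entry A i l\<bar> * \<bar>entry B l j\<bar>))"
      by (simp add: entry_mult[OF dims_absm[OF A]])
    show "\<bar>entry E i j\<bar> \<le> entry (g *\<^sub>R (absm C + absm A * absm B)) i j"
    proof (cases "i < n \<and> j < m")
      case False
      then have "entry E i j = 0" by (intro dims_outside[OF E]) auto
      then show ?thesis unfolding eq using g by (simp add: sum_nonneg)
    qed (use le eq in auto)
  qed
  also have "\<dots> = g * norm (absm C + absm A * absm B)" using g by simp
  also have "\<dots> \<le> g * (norm C + norm A * norm B)"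
    using norm_mult_ineq[of "absm A" "absm B"] norm_triangle_ineq[of "absm C" "absm A * absm B"] g
    by (intro mult_left_mono) auto
  finally show ?thesis .
qed

lemma fl_mult_error:
  assumes "fl_mult u A B C" "dim_row B = dim_col A" "0 \<le> u" "real (dim_col A) * u \<le> 1"
    "2 * real (dim_col A) * u \<le> g"
  shows "norm (emb C - emb A * emb B) \<le> g * norm (emb A) * norm (emb B)"
proof -
  let ?n = "dim_col A"
  have C: "C \<in> carrier_mat (dim_row A) (dim_col B)" using assms(1) by (simp add: fl_mult_def)
  have A: "dims (dim_row A) ?n (emb A)" by (intro dims_emb) auto
  have "0 \<le> 2 * real ?n * u" using assms(3) by simp
  then have g: "0 \<le> g" using assms(5) by linarith
  have "norm (emb C - emb A * emb B) \<le> g * (norm (0 :: fmat) + norm (emb A) * norm (emb B))"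
  proof (rule norm_le_componentwise[OF _ A g])
    show "dims (dim_row A) (dim_col B) (emb C - emb A * emb B)"
      using C by (intro dims_diff dims_mult[OF A] dims_emb) auto
    fix i j assume ij: "i < dim_row A" "j < dim_col B"
    then obtain q where q: "\<And>l. l < ?n \<Longrightarrow> rounds u (A $$ (i, l) * B $$ (l, j)) (q l)"
      "fl_sum u ({#} + image_mset q (mset_set {..<?n})) (C $$ (i, j))"
      using assms(1) unfolding fl_mult_def by (metis add_0)
    have "\<bar>C $$ (i, j) - (\<Sum>l<?n. A $$ (i, l) * B $$ (l, j))\<bar> \<le>
      2 * real ?n * u * (\<Sum>l<?n. \<bar>A $$ (i, l)\<bar> * \<bar>B $$ (l, j)\<bar>)"
      using fl_sum_image_error[OF q(2), of "\<lambda>l. A $$ (i, l) * B $$ (l, j)"] q(1) assms(3,4)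
      by (simp add: abs_mult)
    also have "\<dots> \<le> g * (\<Sum>l<?n. \<bar>A $$ (i, l)\<bar> * \<bar>B $$ (l, j)\<bar>)"
      using assms(5) by (intro mult_right_mono) (auto intro!: sum_nonneg)
    finally show "\<bar>entry (emb C - emb A * emb B) i j\<bar> \<le>
      g * (\<bar>entry 0 i j\<bar> + (\<Sum>l<?n. \<bar>entry (emb A) i l\<bar> * \<bar>entry (emb B) l j\<bar>))"
      using ij C assms(2) by (simp add: entry_mult[OF A] entry_emb)
  qed
  then show ?thesis by (simp add: mult.assoc)
qed

lemma fl_add_mult_error:
  assumes "fl_add_mult u C A B D" "A \<in> carrier_mat (dim_row C) n" "B \<in> carrier_mat n (dim_col C)"
    "0 \<le> u" "real (n + 1) * u \<le> 1" "2 * real (n + 1) * u \<le> g"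
  shows "norm (emb D - (emb C + emb A * emb B)) \<le> g * (norm (emb C) + norm (emb A) * norm (emb B))"
proof (rule norm_le_componentwise)
  have D: "D \<in> carrier_mat (dim_row C) (dim_col C)" using assms(1) by (simp add: fl_add_mult_def)
  show A: "dims (dim_row C) n (emb A)" using assms by (intro dims_emb) auto
  show "dims (dim_row C) (dim_col C) (emb D - (emb C + emb A * emb B))"
    using D assms(3) by (intro dims_add dims_diff dims_mult[OF A] dims_emb) auto
  have "0 \<le> 2 * real (n + 1) * u" using assms(4) by (intro mult_nonneg_nonneg) auto
  then show "0 \<le> g" using assms(6) by linarith
  fix i j assume ij: "i < dim_row C" "j < dim_col C"
  then have "fl_add_inner u (C $$ (i, j)) n (\<lambda>l. A $$ (i, l)) (\<lambda>l. B $$ (l, j)) (D $$ (i, j))"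
    using assms(1,2) unfolding fl_add_mult_def by auto
  from fl_add_inner_error[OF this assms(4-6)]
  show "\<bar>entry (emb D - (emb C + emb A * emb B)) i j\<bar> \<le>
    g * (\<bar>entry (emb C) i j\<bar> + (\<Sum>l<n. \<bar>entry (emb A) i l\<bar> * \<bar>entry (emb B) l j\<bar>))"
    using ij D assms(2,3) by (simp add: entry_mult[OF A] entry_emb)
qed

text \<open>Substitution leaves a residual of \<open>W * T = B\<close> that is small relative to the
  computed \<open>W\<close>, whatever the conditioning of \<open>T\<close>. The bound is implicit in
  \<open>W\<close>; it is made explicit where an inverse of \<open>T\<close> is at hand.\<close>

lemma fl_tri_solve_error:
  assumes "fl_tri_solve u B T W" "T \<in> carrier_mat (dim_col B) (dim_col B)" "upper_triangular T"
    and nz: "\<And>j. j < dim_col B \<Longrightarrow> T $$ (j, j) \<noteq> 0"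
    and u: "0 \<le> u" "real (dim_col B + 1) * u \<le> 1" "2 * real (dim_col B + 1) * u \<le> g" "u \<le> 1 / 2"
  shows "norm (emb W * emb T - emb B) \<le> g * (norm (emb B) + norm (emb W) * norm (emb T))"
proof (rule norm_le_componentwise)
  let ?n = "dim_col B"
  have W: "W \<in> carrier_mat (dim_row B) ?n" using assms(1) by (simp add: fl_tri_solve_def)
  show dW: "dims (dim_row B) ?n (emb W)" using W by (intro dims_emb) auto
  show "dims (dim_row B) ?n (emb W * emb T - emb B)"
    using assms(2) W by (intro dims_diff dims_mult[OF dW] dims_emb) auto
  have "0 \<le> 2 * real (?n + 1) * u" using u(1) by (intro mult_nonneg_nonneg) auto
  then show "0 \<le> g" using u(3) by linarith
  fix i j assume ij: "i < dim_row B" "j < ?n"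
  then obtain t where
    t: "fl_add_inner u (B $$ (i, j)) j (\<lambda>l. - W $$ (i, l)) (\<lambda>l. T $$ (l, j)) t"
    "rounds u (t / T $$ (j, j)) (W $$ (i, j))"
    using assms(1) unfolding fl_tri_solve_def by blast
  define s where "s = (\<Sum>l<j. W $$ (i, l) * T $$ (l, j))"
  define p where "p = (\<Sum>l<j. \<bar>W $$ (i, l)\<bar> * \<bar>T $$ (l, j)\<bar>)"
  define w where "w = W $$ (i, j) * T $$ (j, j)"
  have ju: "real (j + 1) * u \<le> real (?n + 1) * u" "0 \<le> real (j + 1) * u"
    using ij u(1) by (auto intro!: mult_right_mono)
  have "\<bar>t - (B $$ (i, j) + (\<Sum>l<j. - W $$ (i, l) * T $$ (l, j)))\<bar> \<le>
    g * (\<bar>B $$ (i, j)\<bar> + (\<Sum>l<j. \<bar>- W $$ (i, l)\<bar> * \<bar>T $$ (l, j)\<bar>))"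
    by (rule fl_add_inner_error[OF t(1) u(1)]) (use ju u in linarith)+
  then have 1: "\<bar>t - (B $$ (i, j) - s)\<bar> \<le> g * (\<bar>B $$ (i, j)\<bar> + p)"
    by (simp add: s_def p_def sum_negf)
  have 2: "\<bar>w - t\<bar> \<le> 2 * u * \<bar>w\<bar>"
    unfolding w_def using nz ij u(4) by (intro rounds_div_error t(2)) auto
  have "2 * u * \<bar>w\<bar> \<le> g * \<bar>w\<bar>"
  proof (rule mult_right_mono)
    have "0 \<le> real ?n * u" using u(1) by simp
    then show "2 * u \<le> g" using u(3) by (simp add: algebra_simps)
  qed simp
  then have "\<bar>s + w - B $$ (i, j)\<bar> \<le> g * (\<bar>B $$ (i, j)\<bar> + (p + \<bar>w\<bar>))"
    using 1 2 unfolding distrib_left by linarith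
  \<comment> \<open>Column \<open>j\<close> of the triangular \<open>T\<close> vanishes below the
    diagonal, so the full inner product is the part that the substitution has reached.\<close>
  moreover have trunc: "(\<Sum>l<?n. f l) = (\<Sum>l<Suc j. f l)"
    if "\<And>l. entry (emb T) l j = 0 \<Longrightarrow> f l = 0" for f :: "nat \<Rightarrow> real"
    using ij assms(2,3) that
    by (intro sum.mono_neutral_right) (auto simp: entry_emb upper_triangular_def not_less)
  have "(\<Sum>l<?n. entry (emb W) i l * entry (emb T) l j) = s + w"
    by (subst trunc) (use ij W assms(2) in \<open>auto simp: s_def w_def entry_emb\<close>)
  moreover have "(\<Sum>l<?n. \<bar>entry (emb W) i l\<bar> * \<bar>entry (emb T) l j\<bar>) = p + \<bar>w\<bar>"
    by (subst trunc) (use ij W assms(2) in \<open>auto simp: p_def w_def entry_emb abs_mult\<close>)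
  ultimately show "\<bar>entry (emb W * emb T - emb B) i j\<bar> \<le>
    g * (\<bar>entry (emb B) i j\<bar> + (\<Sum>l<?n. \<bar>entry (emb W) i l\<bar> * \<bar>entry (emb T) l j\<bar>))"
    using ij by (simp add: entry_mult[OF dW] entry_emb[of B])
qed


section \<open>Cholesky factorization\<close>

text \<open>Back substitution: the last unknown is found first and moved to the right-hand
  side.\<close>

lemma triangular_solve:
  fixes c :: "nat \<Rightarrow> nat \<Rightarrow> real"
  assumes "\<And>l. l < n \<Longrightarrow> c l l \<noteq> 0" "\<And>l j. j < l \<Longrightarrow> l < n \<Longrightarrow> c l j = 0"
  shows "\<exists>w. \<forall>l<n. (\<Sum>j<n. c l j * w j) = r l"
  using assms
proof (induction n arbitrary: r)
  case (Suc n)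
  define x where "x = r n / c n n"
  obtain w where w: "\<And>l. l < n \<Longrightarrow> (\<Sum>j<n. c l j * w j) = r l - c l n * x"
    using Suc.IH[of "\<lambda>l. r l - c l n * x"] Suc.prems by auto
  have "(\<Sum>j<Suc n. c l j * (w(n := x)) j) = r l" if "l < Suc n" for l
  proof (cases "l = n")
    case True
    then have "(\<Sum>j<n. c l j * (w(n := x)) j) = 0" using Suc.prems(2) by (intro sum.neutral) auto
    then show ?thesis using True Suc.prems(1)[of n] by (simp add: x_def)
  next
    case False
    then have "(\<Sum>j<n. c l j * (w(n := x)) j) = (\<Sum>j<n. c l j * w j)"
      by (intro sum.cong) auto
    then show ?thesis using w[of l] that False by simp
  qed
  then show ?case by blast
qed simp

lemma abs_prod_le: "\<bar>x\<bar> * \<bar>y\<bar> \<le> (x\<^sup>2 + y\<^sup>2) / 2" for x y :: real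
  using sum_squares_bound[of "\<bar>x\<bar>" "\<bar>y\<bar>"] by simp

lemma sum_abs_sq_le: "(\<Sum>i<n. \<bar>w i\<bar>)\<^sup>2 \<le> real n * (\<Sum>i<n. (w i)\<^sup>2)" for w :: "nat \<Rightarrow> real"
  using Cauchy_Schwarz_ineq_sum[of "\<lambda>_. 1" "\<lambda>i. \<bar>w i\<bar>" "{..<n}"] by simp

text \<open>The kernel vector \<open>(w, -1)\<close> of the first \<open>i\<close> computed rows turns positive definiteness of the
  matrix into a bound on the squared length \<open>g\<close> of the new column above the pivot; this
  needs \<open>h\<close> small against \<open>\<mu>\<close> only, whereas an estimate through the inverse factor would need it
  small against \<open>\<mu>\<^sup>2\<close>.\<close>

lemma cholesky_step:
  fixes c A :: "nat \<Rightarrow> nat \<Rightarrow> real"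
  assumes pd: "\<And>v. \<mu> * (\<Sum>r<Suc i. (v r)\<^sup>2) \<le> (\<Sum>r<Suc i. \<Sum>q<Suc i. v r * v q * A r q)"
    and sym: "\<And>r q. A r q = A q r"
    and bound: "\<And>r q. r < Suc i \<Longrightarrow> q < Suc i \<Longrightarrow> \<bar>A r q\<bar> \<le> a"
    and tri: "\<And>l j. j < l \<Longrightarrow> c l j = 0" and nz: "\<And>l. l < i \<Longrightarrow> c l l \<noteq> 0"
    and cols: "\<And>l. l < i \<Longrightarrow> (\<Sum>r<Suc l. (c r l)\<^sup>2) \<le> 2 * a"
    and err: "\<And>l j. l \<le> j \<Longrightarrow> j < i \<Longrightarrow> \<bar>(\<Sum>r<Suc l. c r l * c r j) - A l j\<bar> \<le> 9 * h * a"
    and err_i: "\<And>l. l < i \<Longrightarrow>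
      \<bar>(\<Sum>r<Suc l. c r l * c r i) - A l i\<bar> \<le> h * (a + (\<Sum>r<Suc l. \<bar>c r l\<bar> * \<bar>c r i\<bar>))"
    and h: "0 \<le> h" and small: "32 * h * real (Suc i) * a \<le> \<mu>" and \<mu>: "0 < \<mu>"
  shows "(1 - h * real i) * (\<Sum>l<i. (c l i)\<^sup>2) + \<mu> / 2 \<le> A i i"
proof -
  obtain w where w: "\<And>l. l < i \<Longrightarrow> (\<Sum>j<i. c l j * w j) = c l i"
    using triangular_solve[of i c "\<lambda>l. c l i"] nz tri by blast
  define W where "W = (\<Sum>l<i. (w l)\<^sup>2)"
  define g where "g = (\<Sum>l<i. (c l i)\<^sup>2)"
  have W0: "0 \<le> W" unfolding W_def by (intro sum_nonneg) auto
  have g0: "0 \<le> g" unfolding g_def by (intro sum_nonneg) auto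
  have a0: "0 \<le> a" using bound[of i i] by linarith
  have trunc: "(\<Sum>r<Suc l. c r l * f r) = (\<Sum>r<i. c r l * f r)" if "l < i" for l f
    using that tri by (intro sum.mono_neutral_left) auto
  define e where "e l j = (\<Sum>r<i. c r l * c r j) - A l j" for l j
  have esym: "e l j = e j l" for l j unfolding e_def using sym[of l j] by (simp add: mult.commute)
  have e1: "\<bar>e l j\<bar> \<le> 9 * h * a" if "l < i" "j < i" for l j
    using err[of l j] err[of j l] that esym[of l j] trunc[of l "\<lambda>r. c r j"] trunc[of j "\<lambda>r. c r l"]
    unfolding e_def by (cases "l \<le> j") (auto simp: sym mult.commute)
  \<comment> \<open>Young's inequality on every product makes \<open>h\<close> multiply only
    \<open>a\<close>, \<open>a * (w l)\<^sup>2\<close> and \<open>g\<close>. The first two are later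
    absorbed by \<open>\<mu>\<close>, and the last one turns into the factor
    \<open>1 - h * real i\<close>.\<close>
  have we: "\<bar>w l\<bar> * \<bar>e l i\<bar> \<le> h * (a / 2 + 2 * a * (w l)\<^sup>2 + g / 2)" if l: "l < i" for l
  proof -
    have "\<bar>e l i\<bar> \<le> h * (a + (\<Sum>r<Suc l. \<bar>c r l\<bar> * \<bar>c r i\<bar>))"
      using err_i[OF l] trunc[OF l, of "\<lambda>r. c r i"] unfolding e_def by simp
    then have "\<bar>w l\<bar> * \<bar>e l i\<bar> \<le> \<bar>w l\<bar> * (h * (a + (\<Sum>r<Suc l. \<bar>c r l\<bar> * \<bar>c r i\<bar>)))"
      by (intro mult_left_mono) auto
    also have "\<dots> = h * (a * \<bar>w l\<bar> + (\<Sum>r<Suc l. \<bar>w l * c r l\<bar> * \<bar>c r i\<bar>))"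
      by (simp add: algebra_simps sum_distrib_left abs_mult)
    also have "\<dots> \<le> h * (a * ((1 + (w l)\<^sup>2) / 2) + (\<Sum>r<Suc l. ((w l * c r l)\<^sup>2 + (c r i)\<^sup>2) / 2))"
      using abs_prod_le[of 1 "w l"] a0 h
      by (intro mult_left_mono add_mono sum_mono abs_prod_le) auto
    also have "(\<Sum>r<Suc l. ((w l * c r l)\<^sup>2 + (c r i)\<^sup>2) / 2) =
      ((w l)\<^sup>2 * (\<Sum>r<Suc l. (c r l)\<^sup>2) + (\<Sum>r<Suc l. (c r i)\<^sup>2)) / 2"
      by (simp only: sum_divide_distrib[symmetric] sum.distrib sum_distrib_left power_mult_distrib)
    also have "h * (a * ((1 + (w l)\<^sup>2) / 2) + \<dots>) \<le>
      h * (a * ((1 + (w l)\<^sup>2) / 2) + ((w l)\<^sup>2 * (2 * a) + g) / 2)"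
      unfolding g_def using cols[OF l] l h
      by (intro mult_left_mono add_left_mono divide_right_mono add_mono mult_left_mono sum_mono2) auto
    also have "\<dots> \<le> h * (a / 2 + 2 * a * (w l)\<^sup>2 + g / 2)"
      using h a0 by (intro mult_left_mono) (auto simp: field_simps)
    finally show ?thesis .
  qed
  define X where "X = (\<Sum>l<i. w l * e l i)"
  define Y where "Y = (\<Sum>l<i. \<Sum>j<i. w l * w j * e l j)"
  have X: "\<bar>X\<bar> \<le> h * (real i * (a / 2) + 2 * a * W + real i * (g / 2))"
  proof -
    have "\<bar>X\<bar> \<le> (\<Sum>l<i. \<bar>w l\<bar> * \<bar>e l i\<bar>)"
      unfolding X_def by (rule order_trans[OF sum_abs]) (simp add: abs_mult)
    also have "\<dots> \<le> (\<Sum>l<i. h * (a / 2 + 2 * a * (w l)\<^sup>2 + g / 2))"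
      by (intro sum_mono we) auto
    also have "\<dots> = h * (real i * (a / 2) + 2 * a * W + real i * (g / 2))"
      by (simp add: W_def sum_distrib_left[symmetric] sum.distrib)
    finally show ?thesis .
  qed
  have Y: "\<bar>Y\<bar> \<le> 9 * h * a * (real i * W)"
  proof -
    have "\<bar>Y\<bar> \<le> (\<Sum>l<i. \<Sum>j<i. \<bar>w l\<bar> * \<bar>w j\<bar> * (9 * h * a))"
      unfolding Y_def
      by (rule order_trans[OF sum_abs], rule sum_mono, rule order_trans[OF sum_abs], rule sum_mono)
        (auto simp: abs_mult intro!: mult_left_mono e1)
    also have "\<dots> = 9 * h * a * (\<Sum>l<i. \<bar>w l\<bar>)\<^sup>2"
      by (simp add: power2_eq_square sum_product sum_distrib_left mult_ac)
    also have "\<dots> \<le> 9 * h * a * (real i * W)"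
      unfolding W_def using h a0 by (intro mult_left_mono sum_abs_sq_le) auto
    finally show ?thesis .
  qed
  \<comment> \<open>\<open>w\<close> was chosen such that C w is the new column. Transposed,
    contracting C^T f with \<open>w\<close> gives the inner product of the new column with
    f.\<close>
  have cc: "(\<Sum>l<i. w l * (\<Sum>r<i. c r l * f r)) = (\<Sum>r<i. c r i * f r)" for f
  proof -
    have "(\<Sum>l<i. w l * (\<Sum>r<i. c r l * f r)) = (\<Sum>r<i. \<Sum>l<i. w l * (c r l * f r))"
      by (simp add: sum_distrib_left) (rule sum.swap)
    also have "\<dots> = (\<Sum>r<i. (\<Sum>l<i. c r l * w l) * f r)"
      by (simp add: sum_distrib_right sum_distrib_left mult_ac)
    finally show ?thesis by (simp add: w)
  qed
  have Xg: "(\<Sum>l<i. w l * A l i) = g - X"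
    using cc[of "\<lambda>r. c r i"] unfolding X_def e_def g_def
    by (simp add: right_diff_distrib sum_subtractf power2_eq_square)
  have "(\<Sum>l<i. \<Sum>j<i. w l * w j * A l j) = (\<Sum>j<i. w j * (\<Sum>l<i. w l * (\<Sum>r<i. c r l * c r j))) - Y"
  proof -
    have "(\<Sum>l<i. \<Sum>j<i. w l * w j * A l j) = (\<Sum>l<i. \<Sum>j<i. w l * w j * (\<Sum>r<i. c r l * c r j)) - Y"
      unfolding Y_def e_def by (simp add: right_diff_distrib sum_subtractf)
    also have "(\<Sum>l<i. \<Sum>j<i. w l * w j * (\<Sum>r<i. c r l * c r j)) =
      (\<Sum>j<i. \<Sum>l<i. w l * w j * (\<Sum>r<i. c r l * c r j))" by (rule sum.swap)
    also have "\<dots> = (\<Sum>j<i. w j * (\<Sum>l<i. w l * (\<Sum>r<i. c r l * c r j)))"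
      by (simp add: sum_distrib_left mult_ac)
    finally show ?thesis .
  qed
  also have "(\<Sum>j<i. w j * (\<Sum>l<i. w l * (\<Sum>r<i. c r l * c r j))) = g"
  proof -
    have "(\<Sum>j<i. w j * (\<Sum>l<i. w l * (\<Sum>r<i. c r l * c r j))) = (\<Sum>j<i. w j * (\<Sum>r<i. c r j * c r i))"
      by (intro sum.cong refl, subst cc) (simp add: mult.commute)
    also have "\<dots> = g" by (simp only: cc) (simp add: g_def power2_eq_square)
    finally show ?thesis .
  qed
  finally have Yg: "(\<Sum>l<i. \<Sum>j<i. w l * w j * A l j) = g - Y" .
  \<comment> \<open>At this vector the quadratic form is
    \<open>A i i - 2 * (g - X) + (g - Y)\<close>, that is \<open>A i i - g\<close> up to the errors
    \<open>2 * X - Y\<close>.\<close>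
  define v where "v r = (if r = i then - 1 else w r)" for r
  have "\<mu> * (W + 1) \<le> (\<Sum>r<Suc i. \<Sum>q<Suc i. v r * v q * A r q)"
    using pd[of v] by (simp add: v_def W_def)
  also have "\<dots> = (\<Sum>r<i. \<Sum>q<i. w r * w q * A r q) - (\<Sum>r<i. w r * A r i) - (\<Sum>q<i. w q * A i q) + A i i"
    by (simp add: v_def sum.distrib sum_negf sum_subtractf)
  also have "(\<Sum>q<i. w q * A i q) = (\<Sum>q<i. w q * A q i)" using sym by simp
  finally have "\<mu> * (W + 1) \<le> A i i - g + 2 * X - Y" unfolding Xg Yg by simp
  moreover have "2 * X - Y \<le> h * real i * g + \<mu> / 2 * (W + 1)"
  proof -
    \<comment> \<open>In units of \<open>\<mu> * W / 32\<close> the errors amount to 4 from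
      \<open>2 * X\<close> and 9 from \<open>Y\<close>; the constant 32 makes these 13 fit into
      \<open>\<mu> / 2 * W\<close>.\<close>
    have hia: "h * real (Suc i) * a \<le> \<mu> / 32" using small by simp
    have "0 \<le> h * real i * a" using h a0 by simp
    have ha: "0 \<le> h * a" using h a0 by simp
    have "h * real i * a \<le> \<mu> / 32" "h * a \<le> \<mu> / 32"
      using hia ha \<open>0 \<le> h * real i * a\<close> by (auto simp: algebra_simps)
    then have "h * real i * a * W \<le> \<mu> / 32 * W" "h * a * W \<le> \<mu> / 32 * W"
      using mult_right_mono[OF _ W0] by blast+
    then have "32 * (h * real i * a * W) \<le> \<mu> * W" "32 * (h * a * W) \<le> \<mu> * W" by simp_all
    moreover have "0 \<le> \<mu> * W" using \<mu> W0 by simp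
    moreover have "2 * X \<le> h * real i * a + 4 * (h * a * W) + h * real i * g"
      using X by (simp add: abs_le_iff algebra_simps)
    moreover have "- Y \<le> 9 * (h * real i * a * W)"
      using Y by (simp add: abs_le_iff algebra_simps)
    moreover have "\<mu> / 2 * (W + 1) = \<mu> * W / 2 + \<mu> / 2" by (simp add: algebra_simps)
    ultimately show ?thesis using \<open>h * real i * a \<le> \<mu> / 32\<close> \<mu> by linarith
  qed
  moreover have "\<mu> * (W + 1) - \<mu> / 2 * (W + 1) \<ge> \<mu> / 2"
  proof -
    have "0 \<le> \<mu> * W" using \<mu> W0 by simp
    then show ?thesis by (simp add: field_simps)
  qed
  ultimately show ?thesis unfolding g_def[symmetric] by (simp add: algebra_simps)
qed

text \<open>Strong induction over the columns with three claims at once: the sizes and errors of the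
  earlier columns are what \<open>cholesky_step\<close> consumes, and its margin
  \<open>\<mu> / 2\<close> exceeds the rounding error of the pivot, so that the square root is taken
  of a positive number.\<close>

lemma cholesky_no_breakdown:
  fixes c A :: "nat \<Rightarrow> nat \<Rightarrow> real"
  assumes pd: "\<And>v. \<mu> * (\<Sum>r<s. (v r)\<^sup>2) \<le> (\<Sum>r<s. \<Sum>q<s. v r * v q * A r q)"
    and sym: "\<And>r q. A r q = A q r"
    and bound: "\<And>r q. r < s \<Longrightarrow> q < s \<Longrightarrow> \<bar>A r q\<bar> \<le> a"
    and tri: "\<And>l j. j < l \<Longrightarrow> c l j = 0"
    and diag: "\<And>i. i < s \<Longrightarrow> \<exists>t. \<bar>t - (A i i - (\<Sum>l<i. (c l i)\<^sup>2))\<bar> \<le> h * (\<bar>A i i\<bar> + (\<Sum>l<i. (c l i)\<^sup>2)) \<and>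
      rounds u (sqrt t) (c i i)"
    and offd: "\<And>i j. i < j \<Longrightarrow> j < s \<Longrightarrow>
      \<exists>t. \<bar>t - (A i j - (\<Sum>l<i. c l i * c l j))\<bar> \<le> h * (\<bar>A i j\<bar> + (\<Sum>l<i. \<bar>c l i\<bar> * \<bar>c l j\<bar>)) \<and>
      rounds u (t / c i i) (c i j)"
    and u: "0 \<le> u" "2 * u \<le> h" "u \<le> 1 / 2"
    and small: "32 * h * real s * a \<le> \<mu>" and \<mu>: "0 < \<mu>"
    and i: "i < s"
  shows "0 < c i i \<and> (\<Sum>l<Suc i. (c l i)\<^sup>2) \<le> 2 * a \<and>
    (\<forall>l\<le>i. \<bar>(\<Sum>r<Suc l. c r l * c r i) - A l i\<bar> \<le> 9 * h * a)"
  using i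
proof (induction i rule: less_induct)
  case (less i)
  have i: "i < s" by fact
  have h: "0 \<le> h" using u by linarith
  have a0: "0 \<le> a" using bound[OF i i] by linarith
  have si: "real (Suc i) \<le> real s" "1 \<le> real s" using i by auto
  have hsa: "0 \<le> h * real s * a" "0 \<le> h * a" using h a0 by auto
  have small_i: "32 * h * real (Suc i) * a \<le> \<mu>"
  proof -
    have "32 * h * real (Suc i) * a \<le> 32 * h * real s * a"
      using si h a0 by (intro mult_right_mono mult_left_mono) auto
    then show ?thesis using small by linarith
  qed
  have nz: "c l l \<noteq> 0" if "l < i" for l using less.IH[of l] that i by force
  define g where "g = (\<Sum>l<i. (c l i)\<^sup>2)"
  have g0: "0 \<le> g" unfolding g_def by (intro sum_nonneg) auto
  have off: "\<bar>(\<Sum>r<Suc l. c r l * c r j) - A l j\<bar> \<le> h * (\<bar>A l j\<bar> + (\<Sum>r<Suc l. \<bar>c r l\<bar> * \<bar>c r j\<bar>))"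
    if l: "l < i" and j: "l < j" "j < s" for l j
  proof -
    obtain t where t: "\<bar>t - (A l j - (\<Sum>r<l. c r l * c r j))\<bar> \<le> h * (\<bar>A l j\<bar> + (\<Sum>r<l. \<bar>c r l\<bar> * \<bar>c r j\<bar>))"
      and r: "rounds u (t / c l l) (c l j)"
      using offd[OF j] by blast
    define z where "z = c l j * c l l"
    have "\<bar>z - t\<bar> \<le> 2 * u * \<bar>z\<bar>"
      unfolding z_def by (rule rounds_div_error[OF r nz[OF l] u(3)])
    also have "\<dots> \<le> h * \<bar>z\<bar>" using mult_right_mono[OF u(2), of "\<bar>z\<bar>"] by simp
    finally have "\<bar>z - t\<bar> \<le> h * \<bar>z\<bar>" .
    then show ?thesis using t by (simp add: z_def distrib_left abs_mult mult.commute[of "c l j"] mult.commute[of "\<bar>c l j\<bar>"])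
  qed
  have "(1 - h * real i) * g + \<mu> / 2 \<le> A i i"
    unfolding g_def
  proof (rule cholesky_step[where a = a and h = h and c = c and A = A and i = i and \<mu> = \<mu>])
    fix v :: "nat \<Rightarrow> real"
    \<comment> \<open>Extension by zero turns positive definiteness of the whole matrix into that of
      its leading block.\<close>
    define v' where "v' r = (if r < Suc i then v r else 0)" for r
    have 1: "(\<Sum>r<s. f r) = (\<Sum>r<Suc i. f r)" if "\<And>r. \<not> r < Suc i \<Longrightarrow> f r = 0" for f :: "nat \<Rightarrow> real"
      using i that by (intro sum.mono_neutral_right) auto
    have "(\<Sum>r<s. (v' r)\<^sup>2) = (\<Sum>r<Suc i. (v r)\<^sup>2)"
      by (subst 1) (auto simp: v'_def)
    moreover have "(\<Sum>r<s. \<Sum>q<s. v' r * v' q * A r q) = (\<Sum>r<Suc i. \<Sum>q<s. v' r * v' q * A r q)"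
      by (rule 1) (auto simp: v'_def)
    moreover have "\<dots> = (\<Sum>r<Suc i. \<Sum>q<Suc i. v' r * v' q * A r q)"
      by (intro sum.cong refl 1) (auto simp: v'_def)
    moreover have "\<dots> = (\<Sum>r<Suc i. \<Sum>q<Suc i. v r * v q * A r q)"
      by (intro sum.cong refl) (auto simp: v'_def)
    ultimately show "\<mu> * (\<Sum>r<Suc i. (v r)\<^sup>2) \<le> (\<Sum>r<Suc i. \<Sum>q<Suc i. v r * v q * A r q)"
      using pd[of v'] by simp
  next
    fix l assume l: "l < i"
    have "\<bar>(\<Sum>r<Suc l. c r l * c r i) - A l i\<bar> \<le> h * (\<bar>A l i\<bar> + (\<Sum>r<Suc l. \<bar>c r l\<bar> * \<bar>c r i\<bar>))"
      by (rule off) (use l i in auto)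
    also have "\<dots> \<le> h * (a + (\<Sum>r<Suc l. \<bar>c r l\<bar> * \<bar>c r i\<bar>))"
      using h bound[of l i] l i by (intro mult_left_mono) auto
    finally show "\<bar>(\<Sum>r<Suc l. c r l * c r i) - A l i\<bar> \<le> h * (a + (\<Sum>r<Suc l. \<bar>c r l\<bar> * \<bar>c r i\<bar>))" .
  next
    fix l j assume "l \<le> j" "j < i"
    then show "\<bar>(\<Sum>r<Suc l. c r l * c r j) - A l j\<bar> \<le> 9 * h * a" using less.IH[of j] i by auto
  qed (use less.IH i nz tri h small_i \<mu> sym bound in auto)
  note step = this
  have Aii: "A i i \<le> a" using bound[OF i i] by linarith
  \<comment> \<open>A unit vector gives \<open>\<mu> \<le> A i i \<le> a\<close>. Hence the
    smallness of \<open>h\<close> relative to \<open>\<mu> / a\<close> is also an absolute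
    one.\<close>
  have mu_le: "\<mu> \<le> a"
  proof -
    define e where "e r = (if r = i then 1 else 0 :: real)" for r
    have "(\<Sum>r<s. (e r)\<^sup>2) = 1" using i by (simp add: e_def if_distrib[of "\<lambda>x. x\<^sup>2"] cong: if_cong)
    moreover have e: "(\<Sum>q<s. e q * f q) = f i" for f
    proof -
      have "(\<Sum>q<s. e q * f q) = (\<Sum>q<s. if q = i then f q else 0)"
        by (intro sum.cong) (auto simp: e_def)
      then show ?thesis using i by simp
    qed
    have "(\<Sum>r<s. \<Sum>q<s. e r * e q * A r q) = (\<Sum>r<s. e r * (\<Sum>q<s. e q * A r q))"
      by (simp add: sum_distrib_left mult.assoc)
    then have "(\<Sum>r<s. \<Sum>q<s. e r * e q * A r q) = A i i" by (simp only: e)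
    ultimately show ?thesis using pd[of e] Aii by simp
  qed
  have hs: "32 * (h * real s) \<le> 1"
  proof -
    have "32 * (h * real s) * a \<le> 1 * a" using small mu_le by (simp add: mult_ac)
    moreover have "0 < a" using \<mu> mu_le by linarith
    ultimately show ?thesis by (simp only: mult_le_cancel_right_pos)
  qed
  have hi: "h * real i \<le> h * real s" "0 \<le> h * real i" "h \<le> h * real s"
    using h si by (auto intro!: mult_left_mono simp: mult_le_cancel_left1)
  have g2: "g \<le> 2 * a"
  proof -
    have "1/2 * g \<le> (1 - h * real i) * g" using g0 hi hs by (intro mult_right_mono) auto
    then show ?thesis using step \<mu> Aii by linarith
  qed
  have hg: "h * g \<le> 2 * (h * a)" using mult_left_mono[OF g2 h] by simp
  have hig: "h * real i * g \<le> 2 * (h * real s * a)"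
  proof -
    have "h * real i * g \<le> h * real s * (2 * a)" using hi g2 g0 h si by (intro mult_mono) auto
    then show ?thesis by simp
  qed
  have haa: "h * a \<le> h * real s * a" using mult_right_mono[OF hi(3) a0] .
  obtain t d where t: "\<bar>t - (A i i - g)\<bar> \<le> h * (\<bar>A i i\<bar> + g)"
    and d: "\<bar>d\<bar> \<le> u" "c i i = sqrt t * (1 + d)"
    using diag[OF i] unfolding rounds_def g_def by blast
  have t2: "\<bar>t - (A i i - g)\<bar> \<le> 3 * (h * a)"
  proof -
    have "h * \<bar>A i i\<bar> \<le> h * a" using bound[OF i i] h by (intro mult_left_mono)
    then show ?thesis using t hg by (simp add: distrib_left)
  qed
  have tpos: "0 < t"
  proof -
    have "(1 - h * real i) * g = g - h * real i * g" by (simp add: algebra_simps)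
    then have "\<mu> / 2 - 2 * (h * real s * a) - 3 * (h * a) \<le> t" using step t2 hig by linarith
    moreover have "32 * (h * real s * a) \<le> \<mu>" using small by (simp add: mult_ac)
    ultimately show ?thesis using haa \<mu> by linarith
  qed
  have pos: "0 < c i i" unfolding d(2) using tpos d u(3) by (intro mult_pos_pos) auto
  have ha32: "32 * (h * a) \<le> a"
  proof -
    have "32 * h \<le> 1" using hs hi(3) by linarith
    from mult_right_mono[OF this a0] show ?thesis by simp
  qed
  \<comment> \<open>The relative error \<open>d * (2 + d)\<close> of the squared pivot is at most 3
    u and \<open>t\<close> is at most \<open>2 * a\<close>, which makes 6; the 3 of
    \<open>t2\<close> completes the constant 9.\<close>
  have cii: "\<bar>(c i i)\<^sup>2 - t\<bar> \<le> 6 * (h * a)"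
  proof -
    have "(c i i)\<^sup>2 - t = t * (d * (2 + d))"
      unfolding d(2) using tpos by (simp add: power_mult_distrib power2_eq_square algebra_simps)
    then have "\<bar>(c i i)\<^sup>2 - t\<bar> = t * (\<bar>d\<bar> * \<bar>2 + d\<bar>)" using tpos by (simp add: abs_mult)
    also have "\<dots> \<le> (2 * a) * (u * 3)"
    proof (rule mult_mono)
      show "t \<le> 2 * a" using t2 ha32 Aii g0 a0 by linarith
      show "\<bar>d\<bar> * \<bar>2 + d\<bar> \<le> u * 3" using d u by (intro mult_mono) auto
    qed (use a0 in auto)
    also have "\<dots> \<le> 6 * (h * a)" using mult_right_mono[of u h a] u h a0 by (simp add: mult_ac)
    finally show ?thesis .
  qed
  have diag_err: "\<bar>g + (c i i)\<^sup>2 - A i i\<bar> \<le> 9 * (h * a)" using cii t2 by linarith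
  have col: "(\<Sum>l<Suc i. (c l i)\<^sup>2) \<le> 2 * a"
    using diag_err ha32 Aii a0 by (simp add: g_def)
  have "\<bar>(\<Sum>r<Suc l. c r l * c r i) - A l i\<bar> \<le> 9 * h * a" if "l \<le> i" for l
  proof (cases "l = i")
    case True
    then show ?thesis using diag_err by (simp add: g_def power2_eq_square mult_ac)
  next
    case False
    then have l: "l < i" using that by simp
    have "(\<Sum>r<Suc l. \<bar>c r l\<bar> * \<bar>c r i\<bar>) \<le> (\<Sum>r<Suc l. ((c r l)\<^sup>2 + (c r i)\<^sup>2) / 2)"
      by (intro sum_mono abs_prod_le)
    also have "\<dots> = ((\<Sum>r<Suc l. (c r l)\<^sup>2) + (\<Sum>r<Suc l. (c r i)\<^sup>2)) / 2"
      by (simp only: sum_divide_distrib[symmetric] sum.distrib)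
    also have "(\<Sum>r<Suc l. (c r i)\<^sup>2) \<le> g" unfolding g_def using l by (intro sum_mono2) auto
    also have "(\<Sum>r<Suc l. (c r l)\<^sup>2) \<le> 2 * a" using less.IH[OF l] l i by auto
    finally have "\<bar>A l i\<bar> + (\<Sum>r<Suc l. \<bar>c r l\<bar> * \<bar>c r i\<bar>) \<le> 3 * a"
      using g2 bound[of l i] l i by simp
    then have "h * (\<bar>A l i\<bar> + (\<Sum>r<Suc l. \<bar>c r l\<bar> * \<bar>c r i\<bar>)) \<le> h * (3 * a)"
      using h by (rule mult_left_mono)
    moreover have "\<bar>(\<Sum>r<Suc l. c r l * c r i) - A l i\<bar> \<le> h * (\<bar>A l i\<bar> + (\<Sum>r<Suc l. \<bar>c r l\<bar> * \<bar>c r i\<bar>))"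
      by (rule off) (use l i in auto)
    ultimately show ?thesis using hsa by linarith
  qed
  then show ?case using pos col by blast
qed


section \<open>Singular values\<close>

text \<open>Vectors become one-column matrices, so that one norm and one inner product serve
  both.\<close>

definition vec_fmat :: "real vec \<Rightarrow> fmat" where
  "vec_fmat v = emb (mat (dim_vec v) 1 (\<lambda>(i, j). v $ i))"

lemma dims_vec_fmat: "dims (dim_vec v) 1 (vec_fmat v)"
  unfolding vec_fmat_def by (intro dims_emb) auto

lemma emb_mult_vec:
  assumes "dim_col A = dim_vec v" shows "vec_fmat (A *\<^sub>v v) = emb A * vec_fmat v"
proof -
  have "mat (dim_row A) 1 (\<lambda>(i, j). (A *\<^sub>v v) $ i) = A * mat (dim_vec v) 1 (\<lambda>(i, j). v $ i)"
    using assms by (intro eq_matI) (auto simp: scalar_prod_def)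
  then show ?thesis using assms emb_mult[of A "mat (dim_vec v) 1 (\<lambda>(i, j). v $ i)"]
    by (simp add: vec_fmat_def)
qed

lemma inner_vec_fmat: "dim_vec w = dim_vec v \<Longrightarrow> inner (vec_fmat v) (vec_fmat w) = scalar_prod v w"
  by (simp add: inner_dims[OF dims_vec_fmat] scalar_prod_def)
    (simp add: vec_fmat_def entry_emb atLeast0LessThan)

lemma norm_vec_fmat: "norm (vec_fmat v) = vnorm v"
  by (simp add: norm_eq_sqrt_inner inner_vec_fmat vnorm_def)

lemma vec_fmat_smult: "vec_fmat (c \<cdot>\<^sub>v v) = c *\<^sub>R vec_fmat v"
  by (rule fmat_eqI) (simp add: vec_fmat_def entry_emb)

lemma ex_vec_fmat:
  assumes "dims n 1 V" obtains v where "v \<in> carrier_vec n" "vec_fmat v = V"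
proof (rule that[of "vec n (\<lambda>i. entry V i 0)"])
  show "vec_fmat (vec n (\<lambda>i. entry V i 0)) = V"
    using assms by (intro fmat_eqI) (auto simp: vec_fmat_def entry_emb dims_def)
qed simp

lemma ex_unit_vector:
  assumes "0 < n" shows "\<exists>E. dims n 1 E \<and> norm E = 1"
proof -
  define E where "E = emb (mat n 1 (\<lambda>(i, j). if i = 0 then 1 else 0 :: real))"
  have E: "dims n 1 E" unfolding E_def by (intro dims_emb) auto
  have "(norm E)\<^sup>2 = (\<Sum>i<n. if i = 0 then 1 else 0)"
    unfolding norm_sq_dims[OF E] by (intro sum.cong) (auto simp: E_def entry_emb)
  then have "(norm E)\<^sup>2 = 1" using assms by simp
  then show ?thesis using E by (auto simp: abs_square_eq_1)
qed

text \<open>The Rayleigh infimum is an eigenvalue: otherwise the shifted form would be positive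
  semidefinite and invertible, and Cauchy-Schwarz for this form would bound it away from 0.\<close>

lemma ex_min_eigenvalue:
  assumes M: "M \<in> carrier_mat n n" and sym: "transpose_mat M = M" and n: "0 < n"
  shows "\<exists>l. eigenvalue M l \<and> (\<forall>V. dims n 1 V \<longrightarrow> l * (norm V)\<^sup>2 \<le> inner V (emb M * V))"
proof -
  let ?M = "emb M"
  have tM: "transp ?M = ?M" using sym emb_transpose[of M] by simp
  define S where "S = {inner V (?M * V) | V. dims n 1 V \<and> norm V = 1}"
  obtain E where E: "dims n 1 E" and nE: "norm E = 1" using ex_unit_vector[OF n] by blast
  have ne: "S \<noteq> {}" unfolding S_def using E nE by blast
  have low: "- norm ?M \<le> x" if x: "x \<in> S" for x
  proof -
    obtain V where V: "x = inner V (?M * V)" "norm V = 1" using x unfolding S_def by blast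
    then show ?thesis using abs_inner_mult_le[of V ?M] by simp
  qed
  then have bdd: "bdd_below S" by (rule bdd_belowI)
  define l where "l = Inf S"
  define N where "N = ?M - l *\<^sub>R idm n"
  have dN: "dims n n N" unfolding N_def by (intro dims_diff dims_scaleR dims_idm dims_emb M)
  have tN: "transp N = N" unfolding N_def by (simp add: tM)
  have NV: "inner V (N * V) = inner V (?M * V) - l * (norm V)\<^sup>2" if "dims n k V" for V k
    using idm_mult[OF that]
    by (simp add: N_def left_diff_distrib inner_diff_right power2_norm_eq_inner)
  have lV: "l * (norm V)\<^sup>2 \<le> inner V (?M * V)" if V: "dims n 1 V" for V
  proof (cases "V = 0")
    case False
    define W where "W = (1 / norm V) *\<^sub>R V"
    have W: "dims n 1 W" "norm W = 1" using V False by (auto simp: W_def intro: dims_scaleR)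
    then have "l \<le> inner W (?M * W)"
      unfolding l_def by (intro cInf_lower bdd) (auto simp: S_def)
    also have "\<dots> = inner V (?M * V) / (norm V)\<^sup>2"
      by (simp add: W_def power2_eq_square)
    finally show ?thesis using False by (simp add: field_simps)
  qed simp
  have psd: "0 \<le> inner V (N * V)" if "dims n 1 V" for V using lV NV that by simp
  have "eigenvalue M l"
  proof (rule ccontr)
    assume ne_l: "\<not> eigenvalue M l"
    have inj: "V = 0" if V: "dims n 1 V" "N * V = 0" for V
    proof (rule ccontr)
      assume "V \<noteq> 0"
      obtain v where v: "v \<in> carrier_vec n" "vec_fmat v = V" using ex_vec_fmat[OF V(1)] .
      have eq: "?M * V = l *\<^sub>R V"
        using V(2) idm_mult[OF V(1)] by (simp add: N_def left_diff_distrib)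
      have "vec_fmat (M *\<^sub>v v) = vec_fmat (l \<cdot>\<^sub>v v)"
        using emb_mult_vec[of M v] M v eq by (simp add: vec_fmat_smult)
      then have "M *\<^sub>v v = l \<cdot>\<^sub>v v"
      proof (intro eq_vecI)
        fix i assume *: "vec_fmat (M *\<^sub>v v) = vec_fmat (l \<cdot>\<^sub>v v)" "i < dim_vec (l \<cdot>\<^sub>v v)"
        show "(M *\<^sub>v v) $ i = (l \<cdot>\<^sub>v v) $ i"
          using arg_cong[OF *(1), of "\<lambda>A. entry A i 0"] *(2) M v(1)
          by (simp add: vec_fmat_def entry_emb)
      qed (use M v in auto)
      moreover have "v \<noteq> 0\<^sub>v n"
      proof
        assume "v = 0\<^sub>v n"
        then have "vec_fmat v = 0" by (intro fmat_eqI) (auto simp: vec_fmat_def entry_emb)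
        then show False using v \<open>V \<noteq> 0\<close> by simp
      qed
      ultimately show False using ne_l v M unfolding eigenvalue_def eigenvector_def by auto
    qed
    obtain H where H: "dims n n H" "N * H = idm n" using inverse_exists[OF dN inj] by metis
    have posb: "(norm V)\<^sup>2 \<le> norm H * inner V (N * V)" if V: "dims n 1 V" for V
    proof -
      define W where "W = H * V"
      have W: "dims n 1 W" "N * W = V"
        using H V idm_mult[OF V] by (auto simp: W_def intro: dims_mult simp: mult.assoc[symmetric])
      have sym': "inner W (N * V) = inner V V"
        using inner_mult_left[of N W V] W(2) tN by simp
      have quad: "0 \<le> inner V (N * V) - 2 * t * inner V V + t\<^sup>2 * inner W V" for t :: real
      proof -
        have "0 \<le> inner (V - t *\<^sub>R W) (N * (V - t *\<^sub>R W))"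
          by (intro psd dims_diff dims_scaleR V W)
        also have "\<dots> = inner V (N * V) - 2 * t * inner V V + t\<^sup>2 * inner W V"
          by (simp add: right_diff_distrib W inner_diff_left inner_diff_right sym' power2_eq_square
              algebra_simps)
        finally show ?thesis .
      qed
      have HV: "inner W V \<le> norm H * (norm V)\<^sup>2"
      proof -
        have "inner W V \<le> norm W * norm V" using Cauchy_Schwarz_ineq2[of W V] by linarith
        also have "\<dots> \<le> norm H * norm V * norm V"
          unfolding W_def by (intro mult_right_mono norm_mult_ineq) auto
        finally show ?thesis by (simp add: power2_eq_square mult.assoc)
      qed
      show ?thesis
      proof (cases "norm H = 0")
        case True
        then have "V = 0" using W by (simp add: W_def)
        then show ?thesis by simp
      next
        case False
        define h where "h = norm H"
        have h: "0 < h" using False by (simp add: h_def)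
        \<comment> \<open>\<open>1 / h\<close> minimizes the upper bound for the quadratic in
          \<open>t\<close>.\<close>
        have "0 \<le> inner V (N * V) - 2 * (1 / h) * (norm V)\<^sup>2 + (1 / h)\<^sup>2 * (h * (norm V)\<^sup>2)"
          using quad[of "1 / h"] mult_left_mono[OF HV, of "(1 / h)\<^sup>2"]
          by (simp add: power2_norm_eq_inner h_def)
        then have "(norm V)\<^sup>2 / h \<le> inner V (N * V)"
          using h by (simp add: power2_eq_square)
        then show ?thesis using h by (simp add: h_def field_simps)
      qed
    qed
    have "1 \<le> norm H * inner E (N * E)" using posb[OF E] nE by simp
    then have "norm H \<noteq> 0" by auto
    then have h: "0 < norm H" by simp
    have "l + 1 / norm H \<le> Inf S"
    proof (rule cInf_greatest[OF ne])
      fix x assume "x \<in> S"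
      then obtain V where V: "x = inner V (?M * V)" "dims n 1 V" "norm V = 1"
        unfolding S_def by blast
      have "1 \<le> norm H * (x - l)" using posb[OF V(2)] NV[OF V(2)] V by simp
      then show "l + 1 / norm H \<le> x" using h by (simp add: field_simps)
    qed
    then show False using h unfolding l_def by simp
  qed
  then show ?thesis using lV by blast
qed

text \<open>Carries the result on the smallest eigenvalue over to the largest one, which is minus
  the smallest eigenvalue of \<open>- M\<close>.\<close>

lemma eigenvalue_uminus:
  assumes M: "M \<in> carrier_mat n n" and ev: "eigenvalue (- M) l" shows "eigenvalue M (- l :: real)"
proof -
  obtain v where v: "v \<in> carrier_vec n" "v \<noteq> 0\<^sub>v n" "(- M) *\<^sub>v v = l \<cdot>\<^sub>v v"
    using ev M unfolding eigenvalue_def eigenvector_def by auto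
  have "M *\<^sub>v v = (- l) \<cdot>\<^sub>v v"
  proof (rule eq_vecI)
    fix i assume i: "i < dim_vec ((- l) \<cdot>\<^sub>v v)"
    then have "((- M) *\<^sub>v v) $ i = - ((M *\<^sub>v v) $ i)"
      using M v(1) by (simp add: scalar_prod_def sum_negf)
    then show "(M *\<^sub>v v) $ i = ((- l) \<cdot>\<^sub>v v) $ i" using v i by simp
  qed (use M v in auto)
  then show ?thesis using M v unfolding eigenvalue_def eigenvector_def by auto
qed

text \<open>The eigenvalues are roots of the characteristic polynomial. Finiteness is what gives
  \<open>Min\<close> and \<open>Max\<close> their meaning.\<close>

lemma finite_singular_values: "finite (singular_values A)"
proof -
  have c: "transpose_mat A * A \<in> carrier_mat (dim_col A) (dim_col A)" by auto
  have "finite {l. poly (char_poly (transpose_mat A * A)) l = 0}"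
    using degree_monic_char_poly[OF c] by (intro poly_roots_finite) auto
  then have "finite {l. eigenvalue (transpose_mat A * A) l}"
    using eigenvalue_root_char_poly[OF c] by simp
  then show ?thesis by (simp add: singular_values_def setcompr_eq_image)
qed

text \<open>The library's \<open>sqrt\<close> is odd, so \<open>0 \<le> x\<close> is not automatic;
  it holds because the eigenvalue is a quotient of two squared norms.\<close>

lemma singular_value_vector:
  assumes "x \<in> singular_values A"
  obtains V where "dims (dim_col A) 1 V" "V \<noteq> 0" "0 \<le> x" "norm (emb A * V) = x * norm V"
proof -
  obtain l v where l: "x = sqrt l" and v: "v \<in> carrier_vec (dim_col A)" "v \<noteq> 0\<^sub>v (dim_col A)"
    "(transpose_mat A * A) *\<^sub>v v = l \<cdot>\<^sub>v v"
    using assms unfolding singular_values_def eigenvalue_def eigenvector_def by auto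
  define V where "V = vec_fmat v"
  have V: "dims (dim_col A) 1 V" using dims_vec_fmat[of v] v by (simp add: V_def)
  have "transp (emb A) * emb A * V = l *\<^sub>R V"
    using emb_mult_vec[of "transpose_mat A * A" v] v emb_mult[of "transpose_mat A" A]
    by (simp add: V_def vec_fmat_smult emb_transpose)
  then have eq: "(norm (emb A * V))\<^sup>2 = l * (norm V)\<^sup>2"
    by (simp add: norm_sq_mult) (simp add: power2_norm_eq_inner)
  have "V \<noteq> 0"
  proof
    assume V0: "V = 0"
    have "v $ i = 0" if "i < dim_col A" for i
      using arg_cong[OF V0, of "\<lambda>A. entry A i 0"] that v(1) by (simp add: V_def vec_fmat_def entry_emb)
    then show False using v by (auto intro!: eq_vecI)
  qed
  moreover from this have "0 \<le> l"
    using eq zero_le_power2[of "norm (emb A * V)"] by (simp add: zero_le_mult_iff)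
  moreover have "norm (emb A * V) = x * norm V"
  proof -
    have "(norm (emb A * V))\<^sup>2 = (x * norm V)\<^sup>2" using eq \<open>0 \<le> l\<close> by (simp add: l power_mult_distrib)
    then show ?thesis using \<open>0 \<le> l\<close> by (simp add: l)
  qed
  ultimately show ?thesis using that V by (simp add: l)
qed

text \<open>The Rayleigh bounds for the Gram matrix and for its negative produce two particular
  singular values, and \<open>Min\<close> and \<open>Max\<close> are at least as extreme as these. A
  positive \<open>n\<close> makes the set of singular values nonempty.\<close>

lemma
  assumes A: "A \<in> carrier_mat m n" and n: "0 < n"
  shows sigma_min_mem: "sigma_min A \<in> singular_values A"
    and sigma_max_mem: "sigma_max A \<in> singular_values A"
    and sigma_min_le: "dims n 1 V \<Longrightarrow> sigma_min A * norm V \<le> norm (emb A * V)"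
    and sigma_max_ge: "dims n 1 V \<Longrightarrow> norm (emb A * V) \<le> sigma_max A * norm V"
proof -
  let ?M = "transpose_mat A * A"
  have M: "?M \<in> carrier_mat n n" "- ?M \<in> carrier_mat n n" using A by auto
  have sym: "transpose_mat ?M = ?M"
    using A by (simp add: transpose_mult[of "transpose_mat A" n m A n])
  have sym': "transpose_mat (- ?M) = - ?M"
    using sym M by (metis transpose_uminus)
  have emb: "emb ?M = transp (emb A) * emb A" using A by (simp add: emb_mult emb_transpose)
  obtain l1 where l1: "eigenvalue ?M l1"
    "\<And>V. dims n 1 V \<Longrightarrow> l1 * (norm V)\<^sup>2 \<le> inner V (emb ?M * V)"
    using ex_min_eigenvalue[OF M(1) sym n] by blast
  obtain l2 where l2: "eigenvalue (- ?M) l2"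
    "\<And>V. dims n 1 V \<Longrightarrow> l2 * (norm V)\<^sup>2 \<le> inner V (emb (- ?M) * V)"
    using ex_min_eigenvalue[OF M(2) sym' n] by blast
  have mem1: "sqrt l1 \<in> singular_values A" using l1 by (auto simp: singular_values_def)
  have mem2: "sqrt (- l2) \<in> singular_values A"
    using eigenvalue_uminus[OF M(1) l2(1)] by (auto simp: singular_values_def)
  have fin: "finite (singular_values A)" by (rule finite_singular_values)
  have ne: "singular_values A \<noteq> {}" using mem1 by blast
  show "sigma_min A \<in> singular_values A" "sigma_max A \<in> singular_values A"
    unfolding sigma_min_def sigma_max_def using Min_in Max_in fin ne by auto
  have nn: "0 \<le> sqrt l1" "0 \<le> sqrt (- l2)"
    using singular_value_vector[OF mem1] singular_value_vector[OF mem2] by blast+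
  assume V: "dims n 1 V"
  have "(sqrt l1 * norm V)\<^sup>2 \<le> (norm (emb A * V))\<^sup>2"
    using l1(2)[OF V] nn by (simp add: norm_sq_mult emb power_mult_distrib)
  then have "sqrt l1 * norm V \<le> norm (emb A * V)" by (rule power2_le_imp_le) simp
  moreover have "sigma_min A * norm V \<le> sqrt l1 * norm V"
    unfolding sigma_min_def using mem1 fin by (intro mult_right_mono Min_le) auto
  ultimately show "sigma_min A * norm V \<le> norm (emb A * V)" by linarith
  have "(norm (emb A * V))\<^sup>2 \<le> (- l2) * (norm V)\<^sup>2"
    using l2(2)[OF V] unfolding norm_sq_mult emb emb_uminus by simp
  also have "- l2 = (sqrt (- l2))\<^sup>2" using nn(2) by (simp only: real_sqrt_ge_0_iff real_sqrt_pow2)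
  finally have "(norm (emb A * V))\<^sup>2 \<le> (sqrt (- l2) * norm V)\<^sup>2"
    by (simp only: power_mult_distrib)
  then have "norm (emb A * V) \<le> sqrt (- l2) * norm V"
    by (rule power2_le_imp_le) (rule mult_nonneg_nonneg[OF nn(2) norm_ge_zero])
  moreover have "sqrt (- l2) * norm V \<le> sigma_max A * norm V"
    unfolding sigma_max_def by (rule mult_right_mono[OF Max_ge[OF fin mem2] norm_ge_zero])
  ultimately show "norm (emb A * V) \<le> sigma_max A * norm V" by linarith
qed

section \<open>From vectors to columns: Frobenius norm against spectral norm\<close>

definition colm :: "nat \<Rightarrow> fmat \<Rightarrow> fmat" where
  "colm j A = Abs_fmat (\<lambda>i k. if k = 0 then entry A i j else 0)"

lemma entry_colm: "entry (colm j A) i k = (if k = 0 then entry A i j else 0)"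
proof -
  obtain N where "dims N N A" using ex_dims by blast
  then show ?thesis unfolding colm_def
    by (subst Abs_fmat_entry[of "Suc N"]) (auto simp: dims_def)
qed

lemma dims_colm: "dims n m A \<Longrightarrow> dims n 1 (colm j A)"
  by (auto simp: dims_def entry_colm)

lemma colm_mult: "colm j (A * B) = A * colm j B"
proof (rule fmat_eqI)
  fix i k
  obtain N where "dims N N A" using ex_dims by blast
  then show "entry (colm j (A * B)) i k = entry (A * colm j B) i k"
    by (simp add: entry_colm entry_mult)
qed

lemma norm_sq_colm: "dims n m A \<Longrightarrow> (norm A)\<^sup>2 = (\<Sum>j<m. (norm (colm j A))\<^sup>2)"
  by (simp add: norm_sq_dims norm_sq_dims[OF dims_colm] entry_colm) (rule sum.swap)

text \<open>The squared Frobenius norm is the sum over the columns, so a lower bound on vectors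
  passes to matrices without loss. It serves to bound an inverse.\<close>

lemma lower_bound_cols:
  assumes "\<And>V. dims n 1 V \<Longrightarrow> \<sigma> * norm V \<le> norm (A * V)" "0 \<le> \<sigma>" "dims n m W" "dims k n A"
  shows "\<sigma> * norm W \<le> norm (A * W)"
proof -
  have "(\<sigma> * norm W)\<^sup>2 = (\<Sum>j<m. (\<sigma> * norm (colm j W))\<^sup>2)"
    by (simp add: power_mult_distrib norm_sq_colm[OF assms(3)] sum_distrib_left)
  also have "\<dots> \<le> (\<Sum>j<m. (norm (colm j (A * W)))\<^sup>2)"
    unfolding colm_mult using assms(1-3)
    by (intro sum_mono power_mono assms(1) dims_colm[of n m] mult_nonneg_nonneg) auto
  also have "\<dots> = (norm (A * W))\<^sup>2" using norm_sq_colm[OF dims_mult[OF assms(4,3)]] by simp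
  finally show ?thesis by (rule power2_le_imp_le) simp
qed

text \<open>The hypothesis is applied to the columns of the identity; the square root is the usual
  price of passing from the spectral to the Frobenius norm.\<close>

lemma norm_le_cols:
  assumes "\<And>V. dims n 1 V \<Longrightarrow> norm V = 1 \<Longrightarrow> norm (A * V) \<le> \<sigma>" "dims k n A" "0 \<le> \<sigma>"
  shows "norm A \<le> sqrt n * \<sigma>"
proof -
  have "(norm A)\<^sup>2 = (\<Sum>j<n. (norm (A * colm j (idm n)))\<^sup>2)"
    unfolding norm_sq_colm[OF assms(2)] colm_mult[symmetric] mult_idm[OF assms(2)] ..
  also have "\<dots> \<le> (\<Sum>j<n. \<sigma>\<^sup>2)"
  proof (intro sum_mono power_mono assms(1) dims_colm[OF dims_idm])
    fix j assume "j \<in> {..<n}"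
    then have "(norm (colm j (idm n)))\<^sup>2 = 1"
      by (subst norm_sq_dims[OF dims_colm[OF dims_idm]])
        (simp add: entry_colm if_distrib[of "\<lambda>x. x\<^sup>2"] cong: if_cong)
    then show "norm (colm j (idm n)) = 1" by (simp add: abs_square_eq_1)
  qed auto
  also have "\<dots> = (sqrt n * \<sigma>)\<^sup>2" by (simp add: power_mult_distrib)
  finally show ?thesis by (rule power2_le_imp_le) (use assms(3) in simp)
qed

text \<open>\<open>mnorm\<close> is a bare supremum: \<open>0 < n\<close> provides a unit vector, so
  the set is nonempty, and the Frobenius norm bounds it from above.\<close>

lemma
  assumes A: "A \<in> carrier_mat m n" and n: "0 < n"
  shows mnorm_le_norm: "mnorm A \<le> norm (emb A)"
    and norm_le_mnorm: "norm (emb A) \<le> sqrt n * mnorm A"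
proof -
  let ?S = "{vnorm (A *\<^sub>v v) | v. v \<in> carrier_vec (dim_col A) \<and> vnorm v = 1}"
  have eq: "vnorm (A *\<^sub>v v) = norm (emb A * vec_fmat v)" if "v \<in> carrier_vec n" for v
    using that A emb_mult_vec[of A v] norm_vec_fmat[of "A *\<^sub>v v"] by simp
  have le: "x \<le> norm (emb A)" if x: "x \<in> ?S" for x
  proof -
    obtain v where v: "v \<in> carrier_vec n" "vnorm v = 1" "x = vnorm (A *\<^sub>v v)" using x A by auto
    then show ?thesis
      using eq[OF v(1)] norm_mult_ineq[of "emb A" "vec_fmat v"] norm_vec_fmat[of v] by simp
  qed
  have "vnorm (unit_vec n 0) = 1" using n by (simp add: vnorm_def)
  then have ne: "vnorm (A *\<^sub>v unit_vec n 0) \<in> ?S" using A by auto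
  show "mnorm A \<le> norm (emb A)"
    unfolding mnorm_def using ne le by (intro cSup_least) auto
  have bdd: "bdd_above ?S" using le by (rule bdd_aboveI)
  have up: "norm (emb A * V) \<le> mnorm A" if V: "dims n 1 V" "norm V = 1" for V
  proof -
    obtain v where v: "v \<in> carrier_vec n" "vec_fmat v = V" using ex_vec_fmat[OF V(1)] .
    have "vnorm (A *\<^sub>v v) \<in> ?S" using v V A norm_vec_fmat[of v] by auto
    then show ?thesis
      unfolding mnorm_def using eq[OF v(1)] v(2) bdd by (metis (no_types, lifting) cSup_upper)
  qed
  have "0 \<le> mnorm A" using cSup_upper[OF ne bdd] unfolding mnorm_def
    by (rule order_trans[rotated]) (simp flip: norm_vec_fmat)
  then show "norm (emb A) \<le> sqrt n * mnorm A"
    by (intro norm_le_cols[OF _ dims_emb[OF A]] up)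
qed

lemma norm_le_sigma_max:
  assumes A: "A \<in> carrier_mat m n" and n: "0 < n"
  shows "norm (emb A) \<le> sqrt n * sigma_max A"
proof (rule norm_le_cols[OF _ dims_emb[OF A]])
  show "0 \<le> sigma_max A" using singular_value_vector[OF sigma_max_mem[OF A n]] by blast
qed (use sigma_max_ge[OF A n] in fastforce)

text \<open>On vectors supported in the first \<open>k\<close> entries \<open>A\<close> and its
  leading columns agree. So the vectors at which the leading columns attain their extreme singular
  values are tested against the bounds for \<open>A\<close>.\<close>

lemma
  assumes A: "A \<in> carrier_mat m n" and k: "0 < k" "k \<le> n"
  shows sigma_min_lead: "sigma_min A \<le> sigma_min (lead_cols A k)"
    and sigma_max_lead: "sigma_max (lead_cols A k) \<le> sigma_max A"
proof -
  let ?B = "lead_cols A k"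
  have B: "?B \<in> carrier_mat m k" using A by (simp add: lead_cols_def)
  have n: "0 < n" using k by simp
  have mult: "emb A * V = emb ?B * V" if V: "dims k 1 V" for V
  proof (rule fmat_eqI)
    fix i j
    have "entry (emb A * V) i j = (\<Sum>l<n. entry (emb A) i l * entry V l j)"
      by (rule entry_mult[OF dims_emb[OF A]])
    also have "\<dots> = (\<Sum>l<k. entry (emb A) i l * entry V l j)"
      using k V by (intro sum.mono_neutral_right) (auto simp: dims_def)
    also have "\<dots> = (\<Sum>l<k. entry (emb ?B) i l * entry V l j)"
      using k A by (intro sum.cong) (auto simp: entry_emb lead_cols_def)
    also have "\<dots> = entry (emb ?B * V) i j" by (rule entry_mult[OF dims_emb[OF B], symmetric])
    finally show "entry (emb A * V) i j = entry (emb ?B * V) i j" .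
  qed
  obtain V where V: "dims k 1 V" "V \<noteq> 0" "norm (emb ?B * V) = sigma_min ?B * norm V"
    using singular_value_vector[OF sigma_min_mem[OF B k(1)]] B by auto
  have "sigma_min A * norm V \<le> sigma_min ?B * norm V"
    using sigma_min_le[OF A n dims_mono[OF V(1)]] k V mult by simp
  then show "sigma_min A \<le> sigma_min ?B" using V by simp
  obtain W where W: "dims k 1 W" "W \<noteq> 0" "norm (emb ?B * W) = sigma_max ?B * norm W"
    using singular_value_vector[OF sigma_max_mem[OF B k(1)]] B by auto
  have "sigma_max ?B * norm W \<le> sigma_max A * norm W"
    using sigma_max_ge[OF A n dims_mono[OF W(1)]] k W mult by simp
  then show "sigma_max ?B \<le> sigma_max A" using W by simp
qed


section \<open>A single orthogonalization pass\<close>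

lemma inner_quadratic:
  assumes B: "dims s s B" and V: "dims s 1 V"
  shows "inner V (B * V) = (\<Sum>r<s. \<Sum>q<s. entry V r 0 * entry V q 0 * entry B r q)"
  by (simp add: inner_dims[OF V] entry_mult[OF B] sum_distrib_left mult_ac)

text \<open>The computed \<open>M\<close> need not be symmetric, and only its upper triangle is
  read. Therefore the factorization is compared with the mirrored upper triangle of
  \<open>M\<close>, which is \<open>B\<close> plus a symmetric perturbation; half of the lower bound
  \<open>2 * \<mu>\<close> pays for this perturbation.\<close>

lemma fl_chol_error:
  assumes chol: "fl_chol u M G" and M: "M \<in> carrier_mat s s"
    and B: "dims s s B" "transp B = B"
    and pd: "\<And>V. dims s 1 V \<Longrightarrow> 2 * \<mu> * (norm V)\<^sup>2 \<le> inner V (B * V)"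
    and e: "norm (emb M - B) \<le> e" and a: "norm B + e \<le> a" and se: "real s * e \<le> \<mu>"
    and u: "0 \<le> u" "real (s + 1) * u \<le> 1" "2 * real (s + 1) * u \<le> h" "u \<le> 1 / 2"
    and small: "32 * h * real s * a \<le> \<mu>" and \<mu>: "0 < \<mu>"
  shows "G \<in> carrier_mat s s" and "upper_triangular G" and "\<And>i. i < s \<Longrightarrow> G $$ (i, i) \<noteq> 0"
    and "(norm (emb G))\<^sup>2 \<le> real s * (2 * a)"
    and "norm (transp (emb G) * emb G - B) \<le> real s * (9 * h * a + e)"
proof -
  show G: "G \<in> carrier_mat s s" and ut: "upper_triangular G"
    using chol M by (auto simp: fl_chol_def)
  define E where "E = emb M - B"
  have dE: "dims s s E" unfolding E_def using M B by (intro dims_diff dims_emb)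
  define A where "A r q = entry B r q + entry E (min r q) (max r q)" for r q
  define c where "c l j = entry (emb G) l j" for l j
  have c: "c l j = G $$ (l, j)" if "l < s" "j < s" for l j
    using that G by (simp add: c_def entry_emb)
  have e0: "0 \<le> e" using e norm_ge_zero order_trans by blast
  have symB: "entry B r q = entry B q r" for r q
    using arg_cong[OF B(2), of "\<lambda>X. entry X r q"] by simp
  have AM: "A r q = M $$ (r, q)" if "r \<le> q" "q < s" for r q
    using that M by (simp add: A_def E_def entry_emb)
  have Ele: "\<bar>entry E r q\<bar> \<le> e" for r q
    using entry_le_norm[of E r q] e by (simp add: E_def)
  have bound: "\<bar>A r q\<bar> \<le> a" for r q
    using entry_le_norm[of B r q] Ele[of "min r q" "max r q"] a unfolding A_def by linarith
  have pdA: "\<mu> * (\<Sum>r<s. (v r)\<^sup>2) \<le> (\<Sum>r<s. \<Sum>q<s. v r * v q * A r q)" for v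
  proof -
    define V where "V = emb (mat s 1 (\<lambda>(i, j). v i))"
    have V: "dims s 1 V" unfolding V_def by (intro dims_emb) auto
    have Vv: "entry V r 0 = v r" if "r < s" for r using that by (simp add: V_def entry_emb)
    have nV: "(norm V)\<^sup>2 = (\<Sum>r<s. (v r)\<^sup>2)" by (simp add: norm_sq_dims[OF V] Vv)
    have "2 * \<mu> * (\<Sum>r<s. (v r)\<^sup>2) \<le> (\<Sum>r<s. \<Sum>q<s. v r * v q * entry B r q)"
      using pd[OF V] by (simp add: inner_quadratic[OF B(1) V] nV Vv)
    moreover have "\<bar>\<Sum>r<s. \<Sum>q<s. v r * v q * entry E (min r q) (max r q)\<bar> \<le> \<mu> * (\<Sum>r<s. (v r)\<^sup>2)"
    proof -
      have "\<bar>\<Sum>r<s. \<Sum>q<s. v r * v q * entry E (min r q) (max r q)\<bar> \<le>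
        (\<Sum>r<s. \<Sum>q<s. \<bar>v r\<bar> * \<bar>v q\<bar> * e)"
        by (rule order_trans[OF sum_abs], rule sum_mono, rule order_trans[OF sum_abs], rule sum_mono)
          (auto simp: abs_mult intro!: mult_left_mono Ele)
      also have "\<dots> = e * (\<Sum>r<s. \<bar>v r\<bar>)\<^sup>2"
        by (simp add: power2_eq_square sum_product sum_distrib_left mult_ac)
      also have "\<dots> \<le> e * (real s * (\<Sum>r<s. (v r)\<^sup>2))"
        using e0 by (intro mult_left_mono sum_abs_sq_le)
      also have "\<dots> = (real s * e) * (\<Sum>r<s. (v r)\<^sup>2)" by simp
      also have "\<dots> \<le> \<mu> * (\<Sum>r<s. (v r)\<^sup>2)" using se by (intro mult_right_mono sum_nonneg) auto
      finally show ?thesis .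
    qed
    moreover have "(\<Sum>r<s. \<Sum>q<s. v r * v q * A r q) =
      (\<Sum>r<s. \<Sum>q<s. v r * v q * entry B r q) +
      (\<Sum>r<s. \<Sum>q<s. v r * v q * entry E (min r q) (max r q))"
      by (simp add: A_def distrib_left sum.distrib)
    ultimately show ?thesis by linarith
  qed
  have rnd: "\<bar>t - (A i j - (\<Sum>l<i. c l i * c l j))\<bar> \<le> h * (\<bar>A i j\<bar> + (\<Sum>l<i. \<bar>c l i\<bar> * \<bar>c l j\<bar>))"
    if t: "fl_add_inner u (M $$ (i, j)) i (\<lambda>l. - G $$ (l, i)) (\<lambda>l. G $$ (l, j)) t" and ij: "i \<le> j" "j < s"
    for i j t
  proof -
    have "real (i + 1) * u \<le> real (s + 1) * u" using ij u(1) by (intro mult_right_mono) auto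
    then have "\<bar>t - (M $$ (i, j) + (\<Sum>l<i. - G $$ (l, i) * G $$ (l, j)))\<bar> \<le>
      h * (\<bar>M $$ (i, j)\<bar> + (\<Sum>l<i. \<bar>- G $$ (l, i)\<bar> * \<bar>G $$ (l, j)\<bar>))"
      using u by (intro fl_add_inner_error[OF t]) linarith+
    then show ?thesis using ij by (simp add: AM c sum_negf)
  qed
  have tri: "c l j = 0" if "j < l" for l j
    using that ut G by (auto simp: c_def entry_emb upper_triangular_def)
  have main: "0 < c i i \<and> (\<Sum>l<Suc i. (c l i)\<^sup>2) \<le> 2 * a \<and>
    (\<forall>l\<le>i. \<bar>(\<Sum>r<Suc l. c r l * c r i) - A l i\<bar> \<le> 9 * h * a)" if i: "i < s" for i
  proof (rule cholesky_no_breakdown[OF pdA _ bound tri _ _ u(1) _ u(4) small \<mu> i])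
    show "A r q = A q r" for r q by (simp add: A_def symB min.commute max.commute)
    show "2 * u \<le> h"
    proof -
      have "0 \<le> 2 * (real s * u)" using u(1) by simp
      then show ?thesis using u(3) by (simp add: algebra_simps)
    qed
    fix i assume i: "i < s"
    obtain t where t: "fl_add_inner u (M $$ (i, i)) i (\<lambda>l. - G $$ (l, i)) (\<lambda>l. G $$ (l, i)) t"
      "rounds u (sqrt t) (G $$ (i, i))"
      using chol M i unfolding fl_chol_def by auto
    show "\<exists>t. \<bar>t - (A i i - (\<Sum>l<i. (c l i)\<^sup>2))\<bar> \<le> h * (\<bar>A i i\<bar> + (\<Sum>l<i. (c l i)\<^sup>2)) \<and>
      rounds u (sqrt t) (c i i)"
      using rnd[OF t(1) order_refl i] t(2) i by (intro exI[of _ t]) (simp add: c power2_eq_square)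
  next
    fix i j assume ij: "i < j" "j < s"
    have "i < s" using ij by simp
    then obtain t where t: "fl_add_inner u (M $$ (i, j)) i (\<lambda>l. - G $$ (l, i)) (\<lambda>l. G $$ (l, j)) t"
      "rounds u (t / G $$ (i, i)) (G $$ (i, j))"
      using chol ij unfolding fl_chol_def carrier_matD(1)[OF M] by blast
    show "\<exists>t. \<bar>t - (A i j - (\<Sum>l<i. c l i * c l j))\<bar> \<le> h * (\<bar>A i j\<bar> + (\<Sum>l<i. \<bar>c l i\<bar> * \<bar>c l j\<bar>)) \<and>
      rounds u (t / c i i) (c i j)"
      using rnd[OF t(1)] t(2) ij by (intro exI[of _ t]) (simp add: c)
  qed
  show "G $$ (i, i) \<noteq> 0" if "i < s" for i using main[OF that] c[OF that that] by simp
  have dG: "dims s s (emb G)" using G by (rule dims_emb)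
  have trunc: "(\<Sum>r<s. c r l * f r) = (\<Sum>r<Suc l. c r l * f r)" if "l < s" for l f
    using that tri by (intro sum.mono_neutral_right) auto
  have "(norm (emb G))\<^sup>2 = (\<Sum>j<s. \<Sum>i<s. (c i j)\<^sup>2)"
    unfolding norm_sq_dims[OF dG] c_def by (rule sum.swap)
  also have "\<dots> = (\<Sum>j<s. \<Sum>i<Suc j. (c i j)\<^sup>2)"
    unfolding power2_eq_square by (intro sum.cong refl trunc) auto
  also have "\<dots> \<le> (\<Sum>j<s. 2 * a)" using main by (intro sum_mono) auto
  finally show "(norm (emb G))\<^sup>2 \<le> real s * (2 * a)" by simp
  have hA0: "0 \<le> 9 * h * a"
  proof -
    have "0 \<le> 2 * real (s + 1) * u" using u(1) by (intro mult_nonneg_nonneg) auto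
    then have "0 \<le> h" using u(3) by linarith
    moreover have "0 \<le> a" using bound[of 0 0] by linarith
    ultimately show ?thesis by simp
  qed
  show "norm (transp (emb G) * emb G - B) \<le> real s * (9 * h * a + e)"
  proof (rule norm_le_entries)
    show "dims s s (transp (emb G) * emb G - B)"
      by (intro dims_diff dims_mult[OF dims_transp[OF dG] dG] B)
    show "0 \<le> 9 * h * a + e" using hA0 e0 by linarith
    fix i j assume ij: "i < s" "j < s"
    define f where "f i j = (\<Sum>r<s. c r i * c r j)" for i j
    have f_sym: "f i j = f j i" for i j by (simp add: f_def mult.commute)
    have le: "\<bar>f i j - entry B i j\<bar> \<le> 9 * h * a + e" if "i \<le> j" "j < s" for i j
    proof -
      have "\<bar>f i j - A i j\<bar> \<le> 9 * h * a"
        using main[of j] that trunc[of i "\<lambda>r. c r j"] by (simp add: f_def)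
      then show ?thesis using Ele[of i j] that unfolding A_def by (simp add: min_def max_def)
    qed
    have "\<bar>f i j - entry B i j\<bar> \<le> 9 * h * a + e"
      using le[of i j] le[of j i] ij by (cases "i \<le> j") (auto simp: f_sym[of i j] symB[of i j])
    then show "\<bar>entry (transp (emb G) * emb G - B) i j\<bar> \<le> 9 * h * a + e"
      by (simp add: entry_mult[OF dims_transp[OF dG]] f_def c_def)
  qed
qed

text \<open>This is why the algorithm may factorize \<open>W\<^sup>T W - S\<^sup>T S\<close> in place of the Gram matrix of
  \<open>W - Q S\<close>.\<close>

lemma gram_defect:
  fixes Q W S :: fmat
  defines "N \<equiv> W - Q * S"
  assumes S: "dims n s S"
    and \<omega>: "norm (idm n - transp Q * Q) \<le> \<omega>" and e: "norm (S - transp Q * W) \<le> e"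
  shows "norm (transp N * N - (transp W * W - transp S * S)) \<le> 2 * e * norm S + \<omega> * (norm S)\<^sup>2"
    and "norm (transp Q * N) \<le> e + \<omega> * norm S"
proof -
  define D where "D = idm n - transp Q * Q"
  define E where "E = S - transp Q * W"
  have nE: "norm E \<le> e" and nD: "norm D \<le> \<omega>" using e \<omega> by (simp_all add: E_def D_def)
  have QQ: "transp Q * Q * S = S - D * S"
    by (simp add: D_def left_diff_distrib idm_mult[OF S])
  have QW: "transp Q * W = S - E" by (simp add: E_def)
  have WQ: "transp W * Q = transp S - transp E"
    using arg_cong[OF QW, of transp] by simp
  have QN: "transp Q * N = D * S - E"
    by (simp add: N_def right_diff_distrib QW QQ mult.assoc[symmetric])
  have "transp N * N = transp W * W - transp W * Q * S - transp S * (transp Q * N)"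
    by (simp add: N_def algebra_simps)
  also have "\<dots> = transp W * W - transp S * S + (transp E * S + transp S * E - transp S * D * S)"
    by (simp add: WQ QN algebra_simps)
  finally have "norm (transp N * N - (transp W * W - transp S * S)) =
    norm (transp E * S + transp S * E - transp S * D * S)" by simp
  also have "\<dots> \<le> norm (transp E * S) + norm (transp S * E) + norm (transp S * D * S)"
    by (intro order_trans[OF norm_triangle_ineq4] add_right_mono norm_triangle_ineq)
  also have "\<dots> \<le> e * norm S + norm S * e + norm S * \<omega> * norm S"
  proof -
    have nE': "norm (transp E) \<le> e" using nE by simp
    have "norm (transp E * S) \<le> e * norm S"
      by (rule order_trans[OF norm_mult_ineq mult_right_mono[OF nE' norm_ge_zero]])
    moreover have "norm (transp S * E) \<le> norm S * e"
      using order_trans[OF norm_mult_ineq mult_left_mono[OF nE norm_ge_zero], of "transp S"] by simp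
    moreover have "norm (transp S * D * S) \<le> norm S * \<omega> * norm S"
    proof -
      have "norm (transp S * D) \<le> norm S * \<omega>"
        using order_trans[OF norm_mult_ineq mult_left_mono[OF nD norm_ge_zero], of "transp S"] by simp
      from order_trans[OF norm_mult_ineq mult_right_mono[OF this norm_ge_zero]] show ?thesis .
    qed
    ultimately show ?thesis by linarith
  qed
  also have "\<dots> = 2 * e * norm S + \<omega> * (norm S)\<^sup>2" by (simp add: power2_eq_square)
  finally show "norm (transp N * N - (transp W * W - transp S * S)) \<le> 2 * e * norm S + \<omega> * (norm S)\<^sup>2" .
  have "norm (transp Q * N) \<le> norm (D * S) + norm E"
    unfolding QN by (rule norm_triangle_ineq4)
  also have "\<dots> \<le> \<omega> * norm S + e"
    by (intro add_mono nE order_trans[OF norm_mult_ineq mult_right_mono[OF nD norm_ge_zero]])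
  finally show "norm (transp Q * N) \<le> e + \<omega> * norm S" by simp
qed

lemma norm_sq_gram: "dims m n A \<Longrightarrow> (norm A)\<^sup>2 = inner (idm n) (transp A * A)"
  using norm_sq_mult[of A "idm n"] mult_idm[of m n A] dims_mult[OF dims_transp, of m n A m n A]
  by (simp add: mult_idm mult.assoc)

text \<open>This is the trace of the Gram matrix: \<open>real n\<close> comes from the identity, the
  rest from Cauchy-Schwarz against it.\<close>

lemma norm_sq_le_gram:
  assumes A: "dims m n A" and e: "norm (transp A * A - idm n) \<le> e"
  shows "(norm A)\<^sup>2 \<le> real n + sqrt n * e"
proof -
  have n: "norm (idm n) = sqrt n" using norm_idm[of n] by (metis norm_ge_zero real_sqrt_unique)
  have "(norm A)\<^sup>2 = inner (idm n) (idm n) + inner (idm n) (transp A * A - idm n)"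
    unfolding norm_sq_gram[OF A] by (simp add: inner_diff_right)
  also have "inner (idm n) (transp A * A - idm n) \<le> sqrt n * e"
    using Cauchy_Schwarz_ineq2[of "idm n" "transp A * A - idm n"] e
      mult_left_mono[OF e, of "sqrt n"] unfolding n by (auto simp: abs_le_iff)
  finally show ?thesis by (simp add: power2_norm_eq_inner[symmetric] norm_idm)
qed

lemma sqrt_le_self: "sqrt (real n) \<le> real n"
  by (cases "n = 0") (auto intro!: real_le_lsqrt simp: power2_eq_square)

text \<open>The factor \<open>sqrt s\<close> is the Frobenius norm of \<open>idm s\<close>, to which
  the lower bound is applied as the product of \<open>G\<close> and its inverse.\<close>

lemma inverse_of_lower_bound:
  assumes G: "dims s s G" and \<tau>: "0 < \<tau>" and lb: "\<And>V. dims s 1 V \<Longrightarrow> \<tau> * norm V \<le> norm (G * V)"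
  obtains H where "dims s s H" "G * H = idm s" "H * G = idm s" "norm H \<le> sqrt s / \<tau>"
proof -
  have "V = 0" if "dims s 1 V" "G * V = 0" for V
    using lb[OF that(1)] that(2) \<tau> by (simp add: mult_le_0_iff)
  then obtain H where H: "dims s s H" "G * H = idm s" "H * G = idm s"
    using inverse_exists[OF G] by blast
  have "\<tau> * norm H \<le> norm (G * H)"
    by (rule lower_bound_cols[OF lb _ H(1) G]) (use \<tau> in auto)
  also have "\<dots> = sqrt s" using norm_idm[of s] H(2) by (metis norm_ge_zero real_sqrt_unique)
  finally show ?thesis using that[OF H] \<tau> by (simp add: field_simps)
qed


text \<open>All constants are powers of one large number \<open>b\<close>; a sum of two terms is absorbed by
  raising the exponent.\<close>

locale scale =
  fixes b u :: real
  assumes b100: "100 \<le> b" and u0: "0 \<le> u"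
begin

lemma pow_pos: "0 < b ^ i"
  using b100 by (intro zero_less_power) linarith

lemma pow_le: "i \<le> j \<Longrightarrow> b ^ i \<le> b ^ j"
  using b100 by (intro power_increasing) auto

lemma pow_step: "i < j \<Longrightarrow> 100 * b ^ i \<le> b ^ j"
proof -
  assume "i < j"
  then have "b ^ Suc i \<le> b ^ j" by (intro pow_le) simp
  moreover have "100 * b ^ i \<le> b * b ^ i" using b100 pow_pos[of i] by (intro mult_right_mono) auto
  ultimately show ?thesis by simp
qed

text \<open>The sign of the unit \<open>z\<close> is recovered from the bounded quantity, so that
  the scaling rules can be chained by their bounds alone.\<close>

lemma nonneg_of: "0 \<le> x \<Longrightarrow> x \<le> b ^ i * z \<Longrightarrow> 0 \<le> z"
  using pow_pos[of i] by (meson not_less order_trans zero_le_mult_iff less_le_not_le)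

lemma scale_up: "0 \<le> x \<Longrightarrow> x \<le> b ^ i * z \<Longrightarrow> i \<le> j \<Longrightarrow> x \<le> b ^ j * z"
  using mult_right_mono[OF pow_le, of i j z] nonneg_of[of x i z] by linarith

lemma scale_step: "0 \<le> x \<Longrightarrow> x \<le> b ^ i * z \<Longrightarrow> i < j \<Longrightarrow> 100 * x \<le> b ^ j * z"
  using mult_right_mono[OF pow_step, of i j z] nonneg_of[of x i z] by linarith

lemma scale_step_coeff:
  assumes "0 \<le> x" "x \<le> b ^ i * z" "i < j" "c \<le> 100"
  shows "c * x \<le> b ^ j * z"
  using scale_step[OF assms(1-3)] mult_right_mono[OF assms(4,1)] by linarith

lemma scale_add:
  assumes "0 \<le> x" "0 \<le> y" "x \<le> b ^ i * z" "y \<le> b ^ j * z" "i < k" "j < k"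
  shows "x + y \<le> b ^ k * z"
  using scale_step[OF assms(1,3,5)] scale_step[OF assms(2,4,6)] assms(1,2) by linarith

text \<open>The product of the two units is a separate equation, so that it can be named in any
  equivalent form such as \<open>u * w\<^sup>2\<close>; the inequality between exponents lets a
  bound be rounded up at the same time.\<close>

lemma scale_mult:
  assumes "0 \<le> x" "0 \<le> y" "x \<le> b ^ i * v" "y \<le> b ^ j * w" "i + j \<le> k" "v * w = z"
  shows "x * y \<le> b ^ k * z"
proof -
  have "0 \<le> v" "0 \<le> w" using nonneg_of assms by blast+
  have "x * y \<le> (b ^ i * v) * (b ^ j * w)"
    using assms pow_pos[of i] \<open>0 \<le> v\<close> by (intro mult_mono) auto
  also have "\<dots> = b ^ (i + j) * z" by (simp add: power_add assms(6)[symmetric])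
  also have "\<dots> \<le> b ^ k * z"
    using \<open>0 \<le> v\<close> \<open>0 \<le> w\<close> assms(6) by (intro mult_right_mono pow_le assms) auto
  finally show ?thesis .
qed

lemma norm_mult_scale:
  fixes A B :: fmat
  assumes "norm A \<le> b ^ i * v" "norm B \<le> b ^ j * w" "i + j \<le> k" "v * w = z"
  shows "norm (A * B) \<le> b ^ k * z"
  using scale_mult[OF norm_ge_zero norm_ge_zero assms] norm_mult_ineq[of A B] by linarith

lemma norm_add_scale:
  fixes A B :: fmat
  assumes "norm A \<le> b ^ i * z" "norm B \<le> b ^ j * z" "i < k" "j < k"
  shows "norm (A + B) \<le> b ^ k * z" "norm (A - B) \<le> b ^ k * z"
  using scale_add[OF norm_ge_zero norm_ge_zero assms] norm_triangle_ineq[of A B]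
    norm_triangle_ineq4[of A B] by linarith+

lemma norm_approx_scale:
  fixes A B :: fmat
  assumes "norm (A - B) \<le> b ^ i * z" "norm B \<le> b ^ j * z" "i < k" "j < k"
  shows "norm A \<le> b ^ k * z"
  using norm_add_scale(1)[OF assms] by simp

lemma norm_trans_scale:
  fixes A B C :: fmat
  assumes "norm (A - B) \<le> b ^ i * z" "norm (B - C) \<le> b ^ j * z" "i < k" "j < k"
  shows "norm (A - C) \<le> b ^ k * z"
  using norm_add_scale(1)[OF assms] by simp

lemma norm_le_of_orthogonal:
  assumes Q: "dims m n Q" and orth: "norm (transp Q * Q - idm n) \<le> 1" and n: "2 * real n \<le> b"
  shows "norm Q \<le> b"
proof -
  have "(norm Q)\<^sup>2 \<le> b"
    using norm_sq_le_gram[OF Q orth] sqrt_le_self[of n] n by linarith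
  also have "b \<le> b\<^sup>2" using pow_le[of 1 2] by simp
  finally show ?thesis using b100 by (simp add: power2_le_iff_abs_le)
qed

lemma rounding_small:
  assumes "2 * real (N + 1) \<le> b" "b ^ 30 * u \<le> 1" "k \<le> N"
  shows "2 * real (k + 1) * u \<le> b * u" "real (k + 1) * u \<le> 1"
proof -
  have "2 * real (k + 1) \<le> b" using assms(1,3) by simp
  then show 1: "2 * real (k + 1) * u \<le> b * u" using u0 by (rule mult_right_mono)
  have "b ^ 1 * u \<le> b ^ 30 * u" using u0 by (intro mult_right_mono pow_le) auto
  then have "2 * (real (k + 1) * u) \<le> 1" using assms(2) 1 by (simp only: mult.assoc power_one_right)
  then show "real (k + 1) * u \<le> 1" by simp
qed

lemma fl_mult_scale:
  assumes "fl_mult u A B C" "dim_row B = dim_col A" "2 * real (N + 1) \<le> b" "b ^ 30 * u \<le> 1"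
    "dim_col A \<le> N" "norm (emb A) \<le> b ^ i * v" "norm (emb B) \<le> b ^ j * w" "1 + i + j \<le> k"
    "u * (v * w) = z"
  shows "norm (emb C - emb A * emb B) \<le> b ^ k * z"
proof -
  have "real (dim_col A) * u \<le> real (dim_col A + 1) * u" using u0 by (intro mult_right_mono) auto
  then have "real (dim_col A) * u \<le> 1" "2 * real (dim_col A) * u \<le> b * u"
    using rounding_small[OF assms(3-5)] by (simp_all only: mult.assoc)
  then have "norm (emb C - emb A * emb B) \<le> b * u * norm (emb A) * norm (emb B)"
    by (rule fl_mult_error[OF assms(1,2) u0])
  also have "\<dots> = b * u * (norm (emb A) * norm (emb B))" by simp
  also have "\<dots> \<le> b ^ k * z"
  proof (rule scale_mult)
    show "norm (emb A) * norm (emb B) \<le> b ^ (i + j) * (v * w)"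
      by (rule scale_mult[OF _ _ assms(6,7)]) auto
    show "b * u \<le> b ^ 1 * u" by simp
  qed (use assms(8,9) u0 b100 in auto)
  finally show ?thesis .
qed

lemma fl_add_mult_scale:
  assumes "fl_add_mult u C A B D" "A \<in> carrier_mat (dim_row C) n" "B \<in> carrier_mat n (dim_col C)"
    "2 * real (N + 1) \<le> b" "b ^ 30 * u \<le> 1" "n \<le> N"
    "norm (emb A) \<le> b ^ i * v" "norm (emb B) \<le> b ^ j * w" "i + j < k" "norm (emb C) \<le> b ^ l * (v * w)" "l < k"
    "u * (v * w) = z"
  shows "norm (emb D - (emb C + emb A * emb B)) \<le> b ^ Suc k * z"
proof -
  have "norm (emb D - (emb C + emb A * emb B)) \<le> b * u * (norm (emb C) + norm (emb A) * norm (emb B))"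
    using rounding_small[OF assms(4-6)] u0 by (intro fl_add_mult_error[OF assms(1-3)]) auto
  also have "\<dots> \<le> b ^ Suc k * z"
  proof (rule scale_mult)
    have "norm (emb A) * norm (emb B) \<le> b ^ (i + j) * (v * w)"
      by (rule scale_mult[OF _ _ assms(7,8)]) auto
    then show "norm (emb C) + norm (emb A) * norm (emb B) \<le> b ^ k * (v * w)"
      using assms by (intro scale_add[OF _ _ assms(10)]) auto
    show "b * u \<le> b ^ 1 * u" by simp
  qed (use assms(12) u0 b100 in auto)
  finally show ?thesis .
qed

text \<open>This covers both halves of an iteration of the algorithm: \<open>T\<close>, \<open>S\<close>, \<open>G\<close>, \<open>U\<close> stand for
  \<open>T\<^sub>k\<^sub>+\<^sub>1\<close>, \<open>S\<^sub>1\<^sub>:\<^sub>k\<^sub>,\<^sub>k\<^sub>+\<^sub>1\<close>, \<open>S\<^sub>k\<^sub>+\<^sub>1\<^sub>,\<^sub>k\<^sub>+\<^sub>1\<close>, \<open>U\<^sub>k\<^sub>+\<^sub>1\<close> first and for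
  \<open>\<Omega>\<^sub>k\<^sub>+\<^sub>1\<close>, \<open>Y\<^sub>1\<^sub>:\<^sub>k\<^sub>,\<^sub>k\<^sub>+\<^sub>1\<close>, \<open>Y\<^sub>k\<^sub>+\<^sub>1\<^sub>,\<^sub>k\<^sub>+\<^sub>1\<close>, \<open>Q\<^sub>k\<^sub>+\<^sub>1\<close> afterwards.\<close>

lemma cholesky_pass:
  fixes Q W S T M G V U :: "real mat"
  assumes Q: "Q \<in> carrier_mat m n" and W: "W \<in> carrier_mat m s" and S: "S \<in> carrier_mat n s"
    and T: "T \<in> carrier_mat s s" and s: "0 < s"
    and sz: "2 * real (m + n + s + 1) \<le> b"
    and w: "norm (emb W) \<le> w"
    and Terr: "norm (emb T - transp (emb W) * emb W) \<le> b ^ 2 * (u * w\<^sup>2)"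
    and Serr: "norm (emb S - transp (emb Q) * emb W) \<le> b ^ 17 * (u * w)"
    and om: "norm (idm n - transp (emb Q) * emb Q) \<le> \<omega>" and om1: "\<omega> \<le> 1"
    and M: "fl_add_mult u T (- transpose_mat S) S M" and G: "fl_chol u M G"
    and V: "fl_add_mult u W (- Q) S V" and U: "fl_tri_solve u V G U"
    and lower: "\<And>v. dims s 1 v \<Longrightarrow> 2 * \<tau>\<^sup>2 * (norm v)\<^sup>2 \<le>
      inner v ((transp (emb W) * emb W - transp (emb S) * emb S) * v)"
    and \<tau>: "0 < \<tau>" and small: "b ^ 30 * (u * w\<^sup>2) \<le> \<tau>\<^sup>2"
    and small_om: "b ^ 5 * (\<omega> * (norm (emb S))\<^sup>2) \<le> \<tau>\<^sup>2"
  obtains H where "G \<in> carrier_mat s s" "upper_triangular G" "\<And>i. i < s \<Longrightarrow> G $$ (i, i) \<noteq> 0"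
    "U \<in> carrier_mat m s"
    "dims s s H" "emb G * H = idm s" "H * emb G = idm s" "norm H \<le> b / \<tau>"
    "norm (emb G) \<le> b ^ 4 * w" "norm (emb U) \<le> b ^ 2"
    "norm (emb U * emb G - (emb W - emb Q * emb S)) \<le> b ^ 8 * (u * w)"
    "norm (transp (emb U) * emb U - idm s) \<le>
      (b / \<tau>)\<^sup>2 * (b ^ 22 * (u * w\<^sup>2) + \<omega> * (norm (emb S))\<^sup>2)"
    "norm (transp (emb Q) * emb U) \<le> (b / \<tau>) * (b ^ 18 * (u * w) + \<omega> * norm (emb S))"
proof -
  let ?Q = "emb Q" and ?W = "emb W" and ?S = "emb S" and ?G = "emb G" and ?U = "emb U"
  define B where "B = transp ?W * ?W - transp ?S * ?S"
  define N where "N = ?W - ?Q * ?S"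
  have dQ: "dims m n ?Q" and dW: "dims m s ?W" and dS: "dims n s ?S"
    using Q W S by (auto intro: dims_emb)
  have dB: "dims s s B" unfolding B_def
    by (intro dims_diff dims_mult[OF dims_transp[OF dW] dW] dims_mult[OF dims_transp[OF dS] dS])
  have dN: "dims m s N" unfolding N_def by (intro dims_diff dW dims_mult[OF dQ dS])
  have om0: "0 \<le> \<omega>" using om norm_ge_zero order_trans by blast
  have w0: "0 \<le> w" using w norm_ge_zero order_trans by blast
  \<comment> \<open>A unit vector shows that \<open>\<tau>\<close> is at most \<open>w\<close>. Thus
    smallness of u w^2 / \<tau>^2 entails smallness of u w / \<tau> and of \<open>u\<close>
    itself.\<close>
  have tw: "2 * \<tau>\<^sup>2 \<le> w\<^sup>2"
  proof -
    obtain E where E: "dims s 1 E" "norm E = 1" using ex_unit_vector[OF s] by blast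
    have "2 * \<tau>\<^sup>2 \<le> (norm (?W * E))\<^sup>2 - (norm (?S * E))\<^sup>2"
      using lower[OF E(1)] E(2) by (simp add: norm_sq_mult left_diff_distrib inner_diff_right)
    also have "\<dots> \<le> (norm (?W * E))\<^sup>2" by simp
    also have "\<dots> \<le> w\<^sup>2"
      using norm_mult_ineq[of ?W E] E(2) w by (intro power_mono) auto
    finally show ?thesis .
  qed
  have wp: "0 < w" using tw \<tau> w0 by (metis less_le not_less power2_less_0 zero_less_mult_iff
    zero_less_numeral zero_less_power order.strict_trans1 power_zero_numeral)
  have \<tau>w: "\<tau> \<le> w"
  proof -
    have "\<tau>\<^sup>2 \<le> w\<^sup>2" using tw zero_le_power2[of \<tau>] by linarith
    then show ?thesis using w0 by (rule power2_le_imp_le)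
  qed
  have bu: "b ^ 30 * u \<le> 1"
  proof -
    have "b ^ 30 * u * w\<^sup>2 \<le> 1 * w\<^sup>2" using small tw zero_le_power2[of \<tau>] by (simp only: mult.assoc mult_1)
    then show ?thesis using wp by (simp only: mult_le_cancel_right_pos zero_less_power)
  qed
  have bu_le: "b ^ i * u \<le> 1" if "i \<le> 30" for i
    using mult_right_mono[OF pow_le[OF that] u0] bu by linarith
  have buw: "b ^ 30 * (u * w) \<le> \<tau>"
  proof -
    have "b ^ 30 * (u * w) * \<tau> \<le> b ^ 30 * (u * w) * w"
      using \<tau>w u0 w0 pow_pos[of 30] by (intro mult_left_mono) auto
    also have "\<dots> \<le> \<tau> * \<tau>" using small by (simp add: power2_eq_square mult_ac)
    finally show ?thesis using \<tau> by (simp only: mult_le_cancel_right_pos)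
  qed
  have u_half: "u \<le> 1 / 2"
    using bu_le[of 1] mult_right_mono[OF b100 u0] u0 by simp
  have sz': "2 * real ((m + n + s) + 1) \<le> b" using sz by simp
  note szu = rounding_small[OF sz' bu]
  have sb: "real s \<le> b ^ 1 * 1" "2 * real s \<le> b" "real n \<le> b" "2 * real n \<le> b" using sz by auto
  have hw: "norm ?W \<le> b ^ 0 * w" using w by simp
  have hq: "norm ?Q \<le> b ^ 1 * 1"
    using norm_le_of_orthogonal[OF dQ _ sb(4)] om om1 by (simp add: norm_minus_commute)
  have absorb: "b ^ i * (u * z) \<le> b ^ 0 * z" if "i \<le> 30" "0 \<le> z" for i z
    using mult_right_mono[OF bu_le[OF that(1)] that(2)] by (simp add: mult.assoc)
  have hSe: "norm (?S - transp ?Q * ?W) \<le> b ^ 0 * w" using order_trans[OF Serr absorb] w0 by simp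
  have hS: "norm ?S \<le> b ^ 2 * w"
    by (rule norm_approx_scale[OF hSe norm_mult_scale[of "transp ?Q" 1 1 ?W 0 w 1]]) (use hq hw in auto)
  have hWW: "norm (transp ?W * ?W) \<le> b ^ 0 * w\<^sup>2"
    by (rule norm_mult_scale[of _ 0 w _ 0 w]) (use hw in \<open>auto simp: power2_eq_square\<close>)
  have hSS: "norm (transp ?S * ?S) \<le> b ^ 4 * w\<^sup>2"
    by (rule norm_mult_scale[of _ 2 w _ 2 w]) (use hS in \<open>auto simp: power2_eq_square\<close>)
  have hB: "norm B \<le> b ^ 5 * w\<^sup>2"
    unfolding B_def by (rule norm_add_scale(2)[OF hWW hSS]) auto
  have hT: "norm (emb T) \<le> b ^ 1 * w\<^sup>2"
    by (rule norm_approx_scale[OF order_trans[OF Terr absorb] hWW]) auto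
  have Mc: "M \<in> carrier_mat s s" using M T by (simp add: fl_add_mult_def)
  have hbu: "b * u \<le> b ^ 1 * u" "0 \<le> b * u" using b100 u0 by auto
  define e where "e = b ^ 7 * (u * w\<^sup>2)"
  have Merr: "norm (emb M - B) \<le> e"
  proof -
    have "norm (emb M - (emb T + emb (- transpose_mat S) * ?S)) \<le> b ^ Suc 5 * (u * w\<^sup>2)"
      by (rule fl_add_mult_scale[OF M _ _ sz' bu, of n 2 w 2 w 5 1])
        (use S T hS hT in \<open>auto simp: emb_uminus emb_transpose power2_eq_square\<close>)
    then have 1: "norm (emb M - (emb T - transp ?S * ?S)) \<le> b ^ 6 * (u * w\<^sup>2)"
      by (simp add: emb_uminus emb_transpose)
    have 2: "norm ((emb T - transp ?S * ?S) - B) \<le> b ^ 2 * (u * w\<^sup>2)"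
      using Terr by (simp add: B_def)
    show ?thesis unfolding e_def by (rule norm_trans_scale[OF 1 2]) auto
  qed
  define a where "a = b ^ 6 * w\<^sup>2"
  have e0: "0 \<le> e" unfolding e_def using u0 b100 by simp
  have Be: "norm B + e \<le> a"
    unfolding a_def e_def using e0 by (intro scale_add[OF _ _ hB absorb]) (auto simp: e_def)
  have se: "real s * e \<le> b ^ 8 * (u * w\<^sup>2)"
    by (rule scale_mult[OF _ e0 sb(1), where j = 7]) (auto simp: e_def)
  have uw0: "0 \<le> u * w\<^sup>2" using u0 by simp
  have to_tau: "c * x \<le> \<tau>\<^sup>2" if "0 \<le> x" "x \<le> b ^ i * (u * w\<^sup>2)" "i < 30" "c \<le> 100" for c x i
    using scale_step_coeff[OF that] small by linarith
  have buh: "b * u * (b ^ 6 * w\<^sup>2) \<le> b ^ 7 * (u * w\<^sup>2)"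
    by (simp add: power_numeral_even power_numeral_odd mult_ac)
  have small': "32 * (b * u) * real s * a \<le> \<tau>\<^sup>2"
  proof -
    have "real s * (b * u * a) \<le> b ^ 8 * (u * w\<^sup>2)"
      by (rule scale_mult[OF _ _ sb(1), where j = 7]) (use buh hbu in \<open>auto simp: a_def\<close>)
    moreover have "0 \<le> real s * (b * u * a)" using hbu(2) by (simp add: a_def)
    ultimately have "32 * (real s * (b * u * a)) \<le> \<tau>\<^sup>2" by (intro to_tau) auto
    then show ?thesis by (simp add: mult_ac)
  qed
  have trB: "transp B = B" by (simp add: B_def)
  have se_tau: "real s * e \<le> \<tau>\<^sup>2" using to_tau[OF _ se, of 1] e0 by simp
  have lower': "2 * \<tau>\<^sup>2 * (norm v)\<^sup>2 \<le> inner v (B * v)" if "dims s 1 v" for v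
    using lower[OF that] by (simp add: B_def)
  have \<tau>2: "0 < \<tau>\<^sup>2" using \<tau> by simp
  note chol = fl_chol_error[OF G Mc dB trB lower' Merr Be se_tau u0 szu(2,1)[of s] u_half small' \<tau>2]
  have Gc: "G \<in> carrier_mat s s" and Gut: "upper_triangular G" and Gnz: "\<And>i. i < s \<Longrightarrow> G $$ (i, i) \<noteq> 0"
    using chol by auto
  have dG: "dims s s ?G" using Gc by (rule dims_emb)
  have hG: "norm ?G \<le> b ^ 4 * w"
  proof (rule power2_le_imp_le)
    have "(norm ?G)\<^sup>2 \<le> (2 * real s) * a" using chol(4) by simp
    also have "\<dots> \<le> b ^ 8 * w\<^sup>2"
      by (rule scale_mult[of _ _ 1 1 6 "w\<^sup>2"]) (use sb in \<open>auto simp: a_def b100\<close>)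
    also have "\<dots> = (b ^ 4 * w)\<^sup>2" by (simp add: power_mult_distrib flip: power_mult)
    finally show "(norm ?G)\<^sup>2 \<le> (b ^ 4 * w)\<^sup>2" .
  qed (use w0 b100 in simp)
  have hE2: "norm (transp ?G * ?G - B) \<le> b ^ 10 * (u * w\<^sup>2)"
  proof -
    have "9 * (b * u) * a \<le> b ^ 8 * (u * w\<^sup>2)"
      using scale_step_coeff[OF mult_nonneg_nonneg[OF hbu(2), of "b ^ 6 * w\<^sup>2"] buh, of 8 9] b100
      by (simp add: a_def mult.assoc)
    then have "9 * (b * u) * a + e \<le> b ^ 9 * (u * w\<^sup>2)"
      using hbu(2) e0 by (intro scale_add[where i = 8 and j = 7]) (auto simp: e_def a_def)
    then have "real s * (9 * (b * u) * a + e) \<le> b ^ 10 * (u * w\<^sup>2)"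
      using hbu(2) e0 by (intro scale_mult[OF _ _ sb(1), where j = 9]) (auto simp: a_def)
    then show ?thesis using chol(5) by simp
  qed
  \<comment> \<open>Of the lower bound \<open>2 * \<tau>\<^sup>2\<close> the factorization error
    takes at most half, so the computed factor still has an inverse of size 1/\<tau>, up to a factor
    in the dimension.\<close>
  have Glow: "\<tau> * norm v \<le> norm (?G * v)" if v: "dims s 1 v" for v
  proof (rule power2_le_imp_le)
    have "\<bar>inner v ((transp ?G * ?G - B) * v)\<bar> \<le> \<tau>\<^sup>2 * (norm v)\<^sup>2"
      using to_tau[OF norm_ge_zero hE2, of 1]
      by (intro order_trans[OF abs_inner_mult_le] mult_right_mono) auto
    then have "inner v (B * v) - \<tau>\<^sup>2 * (norm v)\<^sup>2 \<le> inner v (transp ?G * ?G * v)"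
      by (simp add: left_diff_distrib inner_diff_right)
    then show "(\<tau> * norm v)\<^sup>2 \<le> (norm (?G * v))\<^sup>2"
      using lower'[OF v] by (simp add: norm_sq_mult power_mult_distrib)
  qed simp
  obtain H where H: "dims s s H" "?G * H = idm s" "H * ?G = idm s" "norm H \<le> sqrt s / \<tau>"
    using inverse_of_lower_bound[OF dG \<tau> Glow] by blast
  have hH: "norm H \<le> b / \<tau>"
  proof -
    have "sqrt s \<le> b" using sqrt_le_self[of s] sb(1) by simp
    then have "sqrt s / \<tau> \<le> b / \<tau>" using \<tau> by (simp add: divide_right_mono)
    then show ?thesis using H(4) by linarith
  qed
  have b\<tau>: "0 \<le> b / \<tau>" using b100 \<tau> by simp
  have hQS: "norm (?Q * ?S) \<le> b ^ 3 * w" by (rule norm_mult_scale[OF hq hS]) auto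
  have hN: "norm N \<le> b ^ 4 * w" unfolding N_def by (rule norm_add_scale(2)[OF hw hQS]) auto
  have Vc: "V \<in> carrier_mat m s" using V W by (simp add: fl_add_mult_def)
  have hVN: "norm (emb V - N) \<le> b ^ 5 * (u * w)"
  proof -
    have "norm (emb V - (?W + emb (- Q) * ?S)) \<le> b ^ Suc 4 * (u * w)"
      by (rule fl_add_mult_scale[OF V _ _ sz' bu, of n 1 1 2 w 4 0])
        (use Q S W hq hS hw in \<open>auto simp: emb_uminus\<close>)
    then show ?thesis by (simp add: N_def emb_uminus)
  qed
  have hV: "norm (emb V) \<le> b ^ 5 * w"
    by (rule norm_approx_scale[OF order_trans[OF hVN absorb] hN]) (use w0 in auto)
  have Uc: "U \<in> carrier_mat m s" using U Vc by (simp add: fl_tri_solve_def)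
  have dU: "dims m s ?U" using Uc by (rule dims_emb)
  have UGV: "norm (?U * ?G - emb V) \<le> b * u * (norm (emb V) + norm ?U * norm ?G)"
    by (rule fl_tri_solve_error[OF U _ Gut _ u0 _ _ u_half]) (use Vc Gc Gnz szu[of s] in auto)
  define \<phi> where "\<phi> = b ^ 21 * (u * w\<^sup>2) + \<omega> * (norm ?S)\<^sup>2"
  have oS0: "0 \<le> \<omega> * (norm ?S)\<^sup>2" using om0 by simp
  have hF: "norm (transp N * N - transp ?G * ?G) \<le> \<phi>"
  proof -
    have "norm (transp N * N - B) \<le> 2 * (b ^ 17 * (u * w)) * norm ?S + \<omega> * (norm ?S)\<^sup>2"
      unfolding N_def B_def by (rule gram_defect(1)[OF dS om Serr])
    moreover have "2 * (b ^ 17 * (u * w)) * norm ?S \<le> b ^ 20 * (u * w\<^sup>2)"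
    proof -
      have uw: "0 \<le> b ^ 17 * (u * w)" using u0 w0 b100 by simp
      have "b ^ 17 * (u * w) * norm ?S \<le> b ^ 19 * (u * w\<^sup>2)"
        by (rule scale_mult[OF uw _ order_refl hS]) (auto simp: power2_eq_square)
      from scale_step_coeff[OF mult_nonneg_nonneg[OF uw norm_ge_zero] this, of 20 2]
      show ?thesis by (simp add: mult.assoc)
    qed
    moreover have "norm (B - transp ?G * ?G) \<le> b ^ 10 * (u * w\<^sup>2)"
      using hE2 by (simp add: norm_minus_commute)
    moreover have "b ^ 20 * (u * w\<^sup>2) + b ^ 10 * (u * w\<^sup>2) \<le> b ^ 21 * (u * w\<^sup>2)"
      using uw0 b100 by (intro scale_add[where i = 20 and j = 10]) auto
    ultimately show ?thesis
      using norm_triangle_ineq[of "transp N * N - B" "B - transp ?G * ?G"] unfolding \<phi>_def by simp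
  qed
  have sandwich: "norm (transp H * E * H) \<le> (b / \<tau>)\<^sup>2 * x" if "norm E \<le> x" for E x
  proof -
    have "norm (transp H * E * H) \<le> (norm H * norm E) * norm H"
      using norm_mult_ineq[of "transp H" E]
      by (intro order_trans[OF norm_mult_ineq] mult_right_mono) auto
    also have "\<dots> \<le> ((b / \<tau>) * x) * (b / \<tau>)"
      by (intro mult_mono[OF mult_mono[OF hH that b\<tau> norm_ge_zero] hH _ norm_ge_zero]
          mult_nonneg_nonneg[OF b\<tau> order_trans[OF norm_ge_zero that]])
    finally show ?thesis by (simp add: power2_eq_square mult_ac)
  qed
  have HGGH: "transp H * (transp ?G * ?G) * H = idm s"
  proof -
    have "transp H * (transp ?G * ?G) * H = transp (?G * H) * (?G * H)" by (simp add: mult.assoc)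
    then show ?thesis by (simp add: H idm_mult[OF dims_idm])
  qed
  have phi1: "(b / \<tau>)\<^sup>2 * \<phi> \<le> 1"
  proof -
    have "2 * (b\<^sup>2 * (b ^ 21 * (u * w\<^sup>2))) \<le> \<tau>\<^sup>2"
      by (rule to_tau[of _ 23]) (use u0 b100 in \<open>auto simp: power_add[symmetric] mult.assoc[symmetric]\<close>)
    moreover have "100 * (b\<^sup>2 * (\<omega> * (norm ?S)\<^sup>2)) \<le> \<tau>\<^sup>2"
      using scale_step[of "b\<^sup>2 * (\<omega> * (norm ?S)\<^sup>2)" 2 "\<omega> * (norm ?S)\<^sup>2" 5] small_om oS0 b100 by auto
    ultimately have "b\<^sup>2 * \<phi> \<le> \<tau>\<^sup>2" unfolding \<phi>_def distrib_left using \<tau>2 by linarith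
    then show ?thesis using \<tau>2 by (simp add: power_divide field_simps)
  qed
  \<comment> \<open>\<open>N * H\<close> is what \<open>U\<close> would be without the errors of the
    subtraction and of the substitution. It is nearly orthonormal because \<open>N\<close> and
    \<open>?G\<close> have nearly the same Gram matrix, which bounds it without the factor 1/\<tau>
    of \<open>H\<close>.\<close>
  have hNH: "norm (N * H) \<le> b"
  proof -
    have dNH: "dims m s (N * H)" by (rule dims_mult[OF dN H(1)])
    have "transp (N * H) * (N * H) - idm s = transp H * (transp N * N - transp ?G * ?G) * H"
      unfolding HGGH[symmetric] by (simp add: algebra_simps)
    then have "norm (transp (N * H) * (N * H) - idm s) \<le> 1"
      using sandwich[OF hF] phi1 by simp
    then show ?thesis by (rule norm_le_of_orthogonal[OF dNH _ sb(2)])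
  qed
  have UGH: "?U = ?U * ?G * H" by (simp add: mult.assoc H mult_idm[OF dU])
  have hUGN: "norm (?U * ?G - N) \<le> b ^ 7 * (u * w) + b ^ 5 * (u * w) * norm ?U"
  proof -
    have 1: "b * u * norm (emb V) \<le> b ^ 6 * (u * w)"
      by (rule scale_mult[OF hbu(2) _ hbu(1) hV]) auto
    have 2: "b * u * norm ?G \<le> b ^ 5 * (u * w)"
      by (rule scale_mult[OF hbu(2) _ hbu(1) hG]) auto
    have "norm (?U * ?G - N) \<le> b * u * (norm (emb V) + norm ?U * norm ?G) + norm (emb V - N)"
      using UGV norm_triangle_ineq[of "?U * ?G - emb V" "emb V - N"] by simp
    also have "\<dots> = (b * u * norm (emb V) + norm (emb V - N)) + b * u * norm ?G * norm ?U"
      by (simp add: algebra_simps)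
    also have "\<dots> \<le> b ^ 7 * (u * w) + b ^ 5 * (u * w) * norm ?U"
      using hbu(2) by (intro add_mono mult_right_mono 2 scale_add[OF _ _ 1 hVN]) auto
    finally show ?thesis .
  qed
  \<comment> \<open>The substitution error in \<open>hUGN\<close> contains \<open>norm ?U\<close>;
    after multiplication by \<open>H\<close> its coefficient is at most 1/2, and the term moves to
    the left.\<close>
  have hU: "norm ?U \<le> b ^ 2"
  proof -
    have "?U = N * H + (?U * ?G - N) * H" by (subst UGH) (simp add: algebra_simps)
    then have "norm ?U \<le> norm (N * H) + norm ((?U * ?G - N) * H)" by (metis norm_triangle_ineq)
    also have "norm ((?U * ?G - N) * H) \<le> (b ^ 7 * (u * w) + b ^ 5 * (u * w) * norm ?U) * (b / \<tau>)"
      using hUGN hH u0 w0 b100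
      by (intro order_trans[OF norm_mult_ineq] mult_mono) auto
    also have "\<dots> = (b ^ 8 * (u * w)) / \<tau> + (b ^ 6 * (u * w)) / \<tau> * norm ?U"
    proof -
      have "(x + y * z) * (b / \<tau>) = b * x / \<tau> + b * y / \<tau> * z" for x y z
        by (simp add: algebra_simps add_divide_distrib)
      moreover have "b * (b ^ 7 * z) = b ^ 8 * z" "b * (b ^ 5 * z) = b ^ 6 * z" for z
        by (simp_all add: power_numeral_even power_numeral_odd mult_ac)
      ultimately show ?thesis by (simp only:)
    qed
    also have "\<dots> \<le> 1 + 1 / 2 * norm ?U"
    proof (rule add_mono[OF _ mult_right_mono])
      have uw: "0 \<le> u * w" using u0 w0 by simp
      have "100 * (b ^ 8 * (u * w)) \<le> \<tau>" "100 * (b ^ 6 * (u * w)) \<le> \<tau>"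
        using scale_step[of "b ^ 8 * (u * w)" 8 "u * w" 30] scale_step[of "b ^ 6 * (u * w)" 6 "u * w" 30]
          buw uw b100 by auto
      then show "b ^ 8 * (u * w) / \<tau> \<le> 1" "b ^ 6 * (u * w) / \<tau> \<le> 1 / 2"
        using \<tau> by (auto simp: field_simps)
    qed simp
    finally have "norm ?U \<le> 2 * b + 2" using hNH by linarith
    also have "\<dots> \<le> b ^ 2" proof -
      have "100 * b \<le> b * b" using b100 by (intro mult_right_mono) auto
      then show ?thesis unfolding power2_eq_square using b100 by linarith
    qed
    finally show ?thesis .
  qed
  have hE3: "norm (?U * ?G - N) \<le> b ^ 8 * (u * w)"
  proof -
    have uw: "0 \<le> b ^ 5 * (u * w)" "0 \<le> b ^ 7 * (u * w)" using u0 w0 b100 by simp_all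
    have "b ^ 5 * (u * w) * norm ?U \<le> b ^ 7 * (u * w)"
      by (rule scale_mult[OF uw(1) norm_ge_zero order_refl, where j = 2 and w = 1]) (use hU in auto)
    then have "b ^ 7 * (u * w) + b ^ 5 * (u * w) * norm ?U \<le> b ^ 8 * (u * w)"
      using uw by (intro scale_add[where i = 7 and j = 7]) auto
    then show ?thesis using hUGN by linarith
  qed
  have gramU: "norm (transp ?U * ?U - idm s) \<le> (b / \<tau>)\<^sup>2 * (b ^ 22 * (u * w\<^sup>2) + \<omega> * (norm ?S)\<^sup>2)"
  proof -
    define E where "E = ?U * ?G - N"
    have hE: "norm E \<le> b ^ 8 * (u * w)" using hE3 by (simp add: E_def)
    have hE': "norm E \<le> b ^ 0 * w" using order_trans[OF hE absorb] w0 by simp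
    have UGN: "?U * ?G = N + E" by (simp add: E_def)
    have 1: "norm (transp N * E) \<le> b ^ 12 * (u * w\<^sup>2)"
      by (rule norm_mult_scale[of _ 4 w _ 8 "u * w"]) (use hN hE in \<open>auto simp: power2_eq_square\<close>)
    have 2: "norm (transp E * N) \<le> b ^ 12 * (u * w\<^sup>2)"
      by (rule norm_mult_scale[of _ 8 "u * w" _ 4 w]) (use hN hE in \<open>auto simp: power2_eq_square\<close>)
    have 3: "norm (transp E * E) \<le> b ^ 8 * (u * w\<^sup>2)"
      by (rule norm_mult_scale[of _ 8 "u * w" _ 0 w]) (use hE' hE in \<open>auto simp: power2_eq_square\<close>)
    have 4: "norm (transp N * E + transp E * N + transp E * E) \<le> b ^ 18 * (u * w\<^sup>2)"
      by (rule norm_add_scale(1)[OF norm_add_scale(1)[OF 1 2, of 17] 3]) auto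
    have eq: "transp (?U * ?G) * (?U * ?G) - transp ?G * ?G =
      (transp N * N - transp ?G * ?G) + (transp N * E + transp E * N + transp E * E)"
      unfolding UGN by (simp add: algebra_simps)
    have "norm (transp (?U * ?G) * (?U * ?G) - transp ?G * ?G) \<le> \<phi> + b ^ 18 * (u * w\<^sup>2)"
      unfolding eq using norm_triangle_ineq[of "transp N * N - transp ?G * ?G"
          "transp N * E + transp E * N + transp E * E"] hF 4 by linarith
    also have "\<dots> \<le> b ^ 22 * (u * w\<^sup>2) + \<omega> * (norm ?S)\<^sup>2"
    proof -
      have "b ^ 21 * (u * w\<^sup>2) + b ^ 18 * (u * w\<^sup>2) \<le> b ^ 22 * (u * w\<^sup>2)"
        using uw0 b100 by (intro scale_add[where i = 21 and j = 18]) auto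
      then show ?thesis unfolding \<phi>_def by linarith
    qed
    finally have 5: "norm (transp (?U * ?G) * (?U * ?G) - transp ?G * ?G) \<le>
      b ^ 22 * (u * w\<^sup>2) + \<omega> * (norm ?S)\<^sup>2" .
    \<comment> \<open>Conjugation by \<open>H\<close> removes \<open>?G\<close> on both sides. Its
      two factors 1/\<tau> are where the square of the condition number enters the first
      pass.\<close>
    have "transp ?U * ?U - idm s = transp H * (transp (?U * ?G) * (?U * ?G) - transp ?G * ?G) * H"
    proof -
      have "transp H * (transp (?U * ?G) * (?U * ?G)) * H = transp (?U * ?G * H) * (?U * ?G * H)"
        by (simp add: mult.assoc)
      then have "transp H * (transp (?U * ?G) * (?U * ?G)) * H = transp ?U * ?U"
        unfolding UGH[symmetric] .
      then show ?thesis using HGGH by (simp only: right_diff_distrib left_diff_distrib)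
    qed
    then show ?thesis using sandwich[OF 5] by simp
  qed
  have QU: "norm (transp ?Q * ?U) \<le> (b / \<tau>) * (b ^ 18 * (u * w) + \<omega> * norm ?S)"
  proof -
    have uw: "0 \<le> u * w" using u0 w0 by simp
    have 1: "norm (transp ?Q * N) \<le> b ^ 17 * (u * w) + \<omega> * norm ?S"
      unfolding N_def by (rule gram_defect(2)[OF dS om Serr])
    have 2: "norm (transp ?Q * (?U * ?G - N)) \<le> b ^ 9 * (u * w)"
      by (rule norm_mult_scale[of _ 1 1 _ 8 "u * w"]) (use hq hE3 in auto)
    have 3: "b ^ 17 * (u * w) + b ^ 9 * (u * w) \<le> b ^ 18 * (u * w)"
      using uw b100 by (intro scale_add[where i = 17 and j = 9]) auto
    have "transp ?Q * (?U * ?G) = transp ?Q * N + transp ?Q * (?U * ?G - N)" by (simp add: algebra_simps)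
    then have 4: "norm (transp ?Q * (?U * ?G)) \<le> b ^ 18 * (u * w) + \<omega> * norm ?S"
      using 1 2 3 norm_triangle_ineq[of "transp ?Q * N" "transp ?Q * (?U * ?G - N)"] by simp
    \<comment> \<open>Only one factor \<open>H\<close> occurs here, hence only the first power of
      the condition number.\<close>
    have "transp ?Q * ?U = (transp ?Q * (?U * ?G)) * H" by (subst UGH) (simp add: mult.assoc)
    then have "norm (transp ?Q * ?U) \<le> norm (transp ?Q * (?U * ?G)) * norm H"
      by (metis norm_mult_ineq)
    also have "\<dots> \<le> (b ^ 18 * (u * w) + \<omega> * norm ?S) * (b / \<tau>)"
      using 4 hH order_trans[OF norm_ge_zero 4] by (intro mult_mono) auto
    finally show ?thesis by (simp add: mult.commute)
  qed
  show ?thesis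
    by (rule that[OF Gc Gut Gnz Uc H(1-3) hH hG hU hE3[unfolded N_def] gramU QU])
qed

end


section \<open>Appending block columns\<close>

text \<open>\<open>shift n s\<close> is the block row \<open>[0, I\<^sub>s]\<close> with \<open>n\<close> zero columns, so that
  \<open>A + B * shift n s\<close> appends the block \<open>B\<close> to a matrix \<open>A\<close> with \<open>n\<close> columns.\<close>

definition shift :: "nat \<Rightarrow> nat \<Rightarrow> fmat" where
  "shift n s = emb (mat s (n + s) (\<lambda>(i, j). if j = n + i then 1 else 0))"

lemma dims_shift: "dims s (n + s) (shift n s)"
  unfolding shift_def by (intro dims_emb) auto

lemma entry_shift: "entry (shift n s) i j = (if i < s \<and> j = n + i then 1 else 0)"
  by (auto simp: shift_def entry_emb)

lemma entry_mult_shift: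
  assumes "dims m s B"
  shows "entry (B * shift n s) i j = (if n \<le> j \<and> j < n + s then entry B i (j - n) else 0)"
proof -
  have "entry (B * shift n s) i j = (\<Sum>k<s. if j = n + k \<and> j < n + s then entry B i k else 0)"
    unfolding entry_mult[OF assms] by (intro sum.cong) (auto simp: entry_shift)
  also have "\<dots> = (\<Sum>k<s. if k = j - n then (if n \<le> j \<and> j < n + s then entry B i k else 0) else 0)"
    by (intro sum.cong) auto
  finally show ?thesis by auto
qed

lemma entry_shift_mult:
  assumes "dims s m B"
  shows "entry (transp (shift n s) * B) i j = (if n \<le> i \<and> i < n + s then entry B (i - n) j else 0)"
  using entry_mult_shift[OF dims_transp[OF assms], of n j i]
  by (metis entry_transp transp_mult transp_simps(1))

lemma shift_shift: "shift n s * transp (shift n s) = idm s"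
proof (rule fmat_eqI)
  fix i j
  have "entry (shift n s * transp (shift n s)) i j = entry (transp (shift n s)) (n + i) j" if "i < s"
  proof -
    have "entry (shift n s * transp (shift n s)) i j =
      (\<Sum>k<n + s. if k = n + i then entry (transp (shift n s)) k j else 0)"
      unfolding entry_mult[OF dims_shift] using that
      by (intro sum.cong) (auto simp: entry_shift)
    then show ?thesis using that by simp
  qed
  moreover have "entry (shift n s * transp (shift n s)) i j = 0" if "\<not> i < s"
    using that by (intro dims_outside[OF dims_mult[OF dims_shift dims_transp[OF dims_shift]]]) auto
  ultimately show "entry (shift n s * transp (shift n s)) i j = entry (idm s) i j"
    by (cases "i < s") (auto simp: entry_shift)
qed

lemma shift_mult_zero:
  assumes "dims n m V" shows "shift n s * V = 0"
proof (rule fmat_eqI)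
  fix i j
  show "entry (shift n s * V) i j = entry 0 i j"
    unfolding entry_mult[OF dims_shift] using assms
    by (auto simp: entry_shift dims_def intro!: sum.neutral)
qed

lemma mult_shift_zero: "dims m n A \<Longrightarrow> A * transp (shift n s) = 0"
  using shift_mult_zero[OF dims_transp, of m n A s] by (metis transp_mult transp_simps(1,6))

lemma idm_shift: "idm (n + s) = idm n + transp (shift n s) * shift n s"
  by (rule fmat_eqI) (auto simp: entry_shift_mult[OF dims_shift] entry_shift)

lemma norm_mult_shift: "dims m s B \<Longrightarrow> norm (B * shift n s) = norm B"
proof -
  assume B: "dims m s B"
  have "(norm (transp (shift n s) * transp B))\<^sup>2 = (norm B)\<^sup>2"
    unfolding norm_sq_mult
    by (simp add: shift_shift idm_mult[OF dims_transp[OF B]] power2_norm_eq_inner inner_transp)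
  then have "norm (transp (B * shift n s)) = norm B" by simp
  then show ?thesis by (simp only: norm_transp)
qed

lemma emb_append_cols:
  assumes "A \<in> carrier_mat m n" "B \<in> carrier_mat m s"
  shows "emb (append_cols A B) = emb A + emb B * shift n s"
  using assms by (intro fmat_eqI) (auto simp: entry_mult_shift[OF dims_emb] append_cols_def entry_emb)

lemma emb_append_rows:
  assumes "A \<in> carrier_mat n m" "B \<in> carrier_mat s m"
  shows "emb (A @\<^sub>r B) = emb A + transp (shift n s) * emb B"
  using assms by (intro fmat_eqI) (auto simp: entry_shift_mult[OF dims_emb] append_rows_def entry_emb)

lemma emb_four_block:
  assumes "A \<in> carrier_mat n n" "B \<in> carrier_mat n s" "D \<in> carrier_mat s s"
  shows "emb (four_block_mat A B (0\<^sub>m s n) D) =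
    emb A + emb B * shift n s + transp (shift n s) * emb D * shift n s"
proof -
  have "emb (four_block_mat A B (0\<^sub>m s n) D) = emb A + (emb B + transp (shift n s) * emb D) * shift n s"
    using assms
    by (intro fmat_eqI)
      (auto simp: entry_mult_shift[OF dims_add[OF dims_mono[of n s _ "n + s" s]
            dims_mult[OF dims_transp[OF dims_shift] dims_emb]]] entry_shift_mult[OF dims_emb] entry_emb dims_emb)
  then show ?thesis by (simp add: distrib_right add.assoc)
qed

lemma emb_lead_cols:
  assumes "X \<in> carrier_mat m N" "(k + 1) * s \<le> N"
  shows "emb (lead_cols X ((k + 1) * s)) =
    emb (lead_cols X (k * s)) + emb (col_block s X (k + 1)) * shift (k * s) s"
proof -
  have "col_block s X (k + 1) \<in> carrier_mat m s" using assms by (simp add: col_block_def)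
  from entry_mult_shift[OF dims_emb[OF this]] show ?thesis using assms
    by (intro fmat_eqI) (auto simp: lead_cols_def col_block_def entry_emb)
qed

text \<open>With z = R^{-1} S v and x = (-z, v) one has (W - Q S) v = [X, W] x - D z. As z is a part
  of x, \<open>norm (D * z)\<close> is at most half of \<sigma> times the length of x, however large
  the inverse of \<open>R\<close> may be.\<close>

lemma projected_lower_bound:
  assumes X: "dims m n X" and Q: "dims m n Q" and S: "dims n s S" and R: "dims n n R"
    and D: "dims m n D" "norm D \<le> \<sigma> / 2" and eq: "X + D = Q * R"
    and \<sigma>: "0 < \<sigma>" and lb: "\<And>v. dims (n + s) 1 v \<Longrightarrow> \<sigma> * norm v \<le> norm ((X + W * shift n s) * v)"
    and v: "dims s 1 v"
  shows "\<sigma> / 2 * norm v \<le> norm ((W - Q * S) * v)"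
proof -
  let ?J = "shift n s"
  have Dz: "norm (D * z) \<le> \<sigma> / 2 * norm z" for z
    using D(2) by (intro order_trans[OF norm_mult_ineq] mult_right_mono) auto
  \<comment> \<open>If \<open>R\<close> annihilated \<open>z\<close>, then X z = - D z would be at
    most half as long as the lower bound demands.\<close>
  have inj: "z = 0" if z: "dims n 1 z" "R * z = 0" for z
  proof -
    have "(X + D) * z = 0" unfolding eq by (simp add: mult.assoc z)
    then have "X * z = - (D * z)" by (simp add: distrib_right eq_neg_iff_add_eq_0)
    then have "norm ((X + W * ?J) * z) = norm (D * z)"
      by (simp add: distrib_right mult.assoc shift_mult_zero[OF z(1)])
    then have "\<sigma> * norm z \<le> \<sigma> / 2 * norm z"
      using lb[of z] Dz[of z] dims_mono[OF z(1), of "n + s" 1] by simp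
    then show ?thesis using \<sigma> by (simp add: mult_le_cancel_right)
  qed
  obtain H where H: "dims n n H" "R * H = idm n" using inverse_exists[OF R inj] by metis
  define z where "z = H * (S * v)"
  have z: "dims n 1 z" unfolding z_def by (intro dims_mult[OF H(1) dims_mult[OF S v]])
  have "Q * (S * v) = Q * (R * z)"
    by (simp add: z_def mult.assoc[symmetric] H idm_mult[OF S])
  also have "\<dots> = X * z + D * z" by (simp add: mult.assoc[symmetric] eq[symmetric] distrib_right)
  finally have QSv: "Q * (S * v) = X * z + D * z" .
  define x where "x = transp ?J * v - z"
  have x: "dims (n + s) 1 x" unfolding x_def
    by (intro dims_diff dims_mult[OF dims_transp[OF dims_shift] v] dims_mono[OF z]) auto
  have "?J * x = v" unfolding x_def
    by (simp add: right_diff_distrib mult.assoc[symmetric] shift_shift idm_mult[OF v] shift_mult_zero[OF z])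
  moreover have "X * x = - (X * z)" unfolding x_def
    by (simp add: right_diff_distrib mult.assoc[symmetric] mult_shift_zero[OF X])
  ultimately have Ax: "(X + W * ?J) * x = W * v - X * z"
    by (simp add: distrib_right mult.assoc)
  have "(norm x)\<^sup>2 = (norm v)\<^sup>2 + (norm z)\<^sup>2"
  proof -
    have "inner (transp ?J * v) z = 0"
      by (simp add: inner_mult_left shift_mult_zero[OF z])
    moreover have "inner (transp ?J * v) (transp ?J * v) = inner v v"
      by (simp add: inner_mult_left mult.assoc[symmetric] shift_shift idm_mult[OF v])
    ultimately show ?thesis
      by (simp add: x_def power2_norm_eq_inner inner_diff_left inner_diff_right inner_commute)
  qed
  then have "(norm v)\<^sup>2 \<le> (norm x)\<^sup>2" "(norm z)\<^sup>2 \<le> (norm x)\<^sup>2" by simp_all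
  then have vx: "norm v \<le> norm x" "norm z \<le> norm x" by (simp_all add: power2_le_iff_abs_le)
  have "(W - Q * S) * v = (X + W * ?J) * x - D * z"
    unfolding Ax by (simp add: left_diff_distrib mult.assoc QSv)
  then have "norm ((X + W * ?J) * x) - norm (D * z) \<le> norm ((W - Q * S) * v)"
    by (simp add: norm_triangle_ineq2)
  moreover have "\<sigma> / 2 * norm z \<le> \<sigma> / 2 * norm x" "\<sigma> / 2 * norm v \<le> \<sigma> / 2 * norm x"
    using vx \<sigma> by (simp_all add: mult_left_mono)
  ultimately show ?thesis using lb[OF x] Dz[of z] by linarith
qed


section \<open>The block algorithm\<close>

context scale
begin

lemma le_of_add3_half:
  fixes x y z t v :: real
  assumes "v \<le> x + y + z + 1 / 2 * v" "100 * x \<le> t" "100 * y \<le> t" "100 * z \<le> t" "0 \<le> t"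
  shows "v \<le> t"
  using assms by linarith

text \<open>As q D is close to U - Q Y, transposing and multiplying by W shows that D^T q^T W is
  close to P - Y^T Z. Solving with D therefore yields the product q^T W, and the bound on the
  inverse \<open>H\<close> is free of condition numbers, so the error is, up to powers of
  \<open>b\<close>, that of a directly computed product.\<close>

lemma next_S:
  fixes Q q U W Y D Z P V B :: "real mat"
  assumes Q: "Q \<in> carrier_mat m n" and q: "q \<in> carrier_mat m s" and U: "U \<in> carrier_mat m s"
    and W: "W \<in> carrier_mat m s" and Y: "Y \<in> carrier_mat n s"
    and D: "D \<in> carrier_mat s s" "upper_triangular D" "\<And>i. i < s \<Longrightarrow> D $$ (i, i) \<noteq> 0"
    and sz: "2 * real (m + n + s + 1) \<le> b" and bu: "b ^ 30 * u \<le> 1"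
    and hQ: "norm (emb Q) \<le> b ^ 1 * 1" and hq: "norm (emb q) \<le> b ^ 2 * 1"
    and hU: "norm (emb U) \<le> b ^ 2 * 1" and hY: "norm (emb Y) \<le> b ^ 0 * 1"
    and hD: "norm (emb D) \<le> b ^ 6 * 1"
    and H: "dims s s H" "emb D * H = idm s" and hH: "norm H \<le> b ^ 2 * 1"
    and hE: "norm (emb q * emb D - (emb U - emb Q * emb Y)) \<le> b ^ 10 * u"
    and Z: "fl_mult u (transpose_mat Q) W Z" and P: "fl_mult u (transpose_mat U) W P"
    and V: "fl_add_mult u P (- transpose_mat Y) Z V"
    and B: "fl_tri_solve u (transpose_mat V) D (transpose_mat B)"
  shows "Z \<in> carrier_mat n s" "B \<in> carrier_mat s s"
    "norm (emb (Z @\<^sub>r B) - transp (emb Q + emb q * shift n s) * emb W) \<le> b ^ 17 * (u * norm (emb W))"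
proof -
  define w where "w = norm (emb W)"
  have w0: "0 \<le> w" by (simp add: w_def)
  have hW: "norm (emb W) \<le> b ^ 0 * w" by (simp add: w_def)
  let ?Q = "emb Q" and ?q = "emb q" and ?U = "emb U" and ?W = "emb W" and ?Y = "emb Y" and ?D = "emb D"
  have sz': "2 * real ((m + n + s) + 1) \<le> b" using sz by simp
  have tr: "norm (emb (transpose_mat A)) = norm (emb A)" for A :: "real mat" by (simp add: emb_transpose)
  have bu_le: "b ^ i * u \<le> 1" if "i \<le> 30" for i
    using mult_right_mono[OF pow_le[OF that] u0] bu by linarith
  show Zc: "Z \<in> carrier_mat n s" using Z Q W by (simp add: fl_mult_def)
  have Pc: "P \<in> carrier_mat s s" using P U W by (simp add: fl_mult_def)
  have Vc: "V \<in> carrier_mat s s" using V Pc by (simp add: fl_add_mult_def)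
  show Bc: "B \<in> carrier_mat s s" using B Vc by (simp add: fl_tri_solve_def)
  have eZ: "norm (emb Z - transp ?Q * ?W) \<le> b ^ 2 * (u * w)"
    unfolding emb_transpose[symmetric]
    by (rule fl_mult_scale[OF Z _ sz' bu, of 1 1 0 w]) (use Q W hQ hW in \<open>auto simp: emb_transpose\<close>)
  have eP: "norm (emb P - transp ?U * ?W) \<le> b ^ 3 * (u * w)"
    unfolding emb_transpose[symmetric]
    by (rule fl_mult_scale[OF P _ sz' bu, of 2 1 0 w]) (use U W hU hW in \<open>auto simp: emb_transpose\<close>)
  have uw: "b ^ i * (u * w) \<le> b ^ 0 * w" if "i \<le> 30" for i
    using mult_right_mono[OF bu_le[OF that] w0] by (simp add: mult.assoc)
  have hZ: "norm (emb Z) \<le> b ^ 2 * w"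
  proof (rule norm_approx_scale[OF order_trans[OF eZ uw]])
    show "norm (transp ?Q * ?W) \<le> b ^ 1 * w" by (rule norm_mult_scale[of _ 1 1 _ 0 w]) (use hQ hW in auto)
  qed auto
  have hP: "norm (emb P) \<le> b ^ 3 * w"
  proof (rule norm_approx_scale[OF order_trans[OF eP uw]])
    show "norm (transp ?U * ?W) \<le> b ^ 2 * w" by (rule norm_mult_scale[of _ 2 1 _ 0 w]) (use hU hW in auto)
  qed auto
  have "norm (emb V - (emb P + emb (- transpose_mat Y) * emb Z)) \<le> b ^ Suc 4 * (u * w)"
    by (rule fl_add_mult_scale[OF V _ _ sz' bu, of _ 0 1 2 w])
      (use Y Zc Pc hY hZ hP in \<open>auto simp: emb_uminus emb_transpose\<close>)
  then have eV: "norm (emb V - (emb P - transp ?Y * emb Z)) \<le> b ^ 5 * (u * w)"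
    by (simp add: emb_uminus emb_transpose)
  define E where "E = ?q * ?D - (?U - ?Q * ?Y)"
  have 1: "norm (transp ?Y * (emb Z - transp ?Q * ?W)) \<le> b ^ 2 * (u * w)"
    by (rule norm_mult_scale[OF _ eZ]) (use hY in auto)
  have 2: "norm (transp E * ?W) \<le> b ^ 10 * (u * w)"
    by (rule norm_mult_scale[OF _ hW]) (use hE in \<open>auto simp: E_def simp del: transp_simps transp_mult\<close>)
  have eq: "emb V - transp (?q * ?D) * ?W = (emb V - (emb P - transp ?Y * emb Z)) +
    ((emb P - transp ?U * ?W) - transp ?Y * (emb Z - transp ?Q * ?W)) - transp E * ?W"
    unfolding E_def by (simp add: algebra_simps)
  have eVq: "norm (emb V - transp (?q * ?D) * ?W) \<le> b ^ 12 * (u * w)"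
    unfolding eq
    by (rule norm_add_scale(2)[OF norm_add_scale(1)[OF eV norm_add_scale(2)[OF eP 1, of 4], of 11] 2]) auto
  have hqW: "norm (transp ?q * ?W) \<le> b ^ 2 * w" by (rule norm_mult_scale[of _ 2 1 _ 0 w]) (use hq hW in auto)
  have hV: "norm (emb V) \<le> b ^ 9 * w"
  proof (rule norm_approx_scale[OF order_trans[OF eVq uw]])
    show "norm (transp (?q * ?D) * ?W) \<le> b ^ 8 * w"
      unfolding transp_mult mult.assoc by (rule norm_mult_scale[of _ 6 1 _ 2 w]) (use hD hqW in auto)
  qed auto
  \<comment> \<open>The unknown error \<open>x\<close> reappears in the residual through the size of
    \<open>B\<close>; it is isolated at the end, where its coefficient is at most 1/2.\<close>
  define x where "x = norm (emb B - transp ?q * ?W)"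
  have hB: "norm (emb B) \<le> b ^ 2 * w + x"
    using norm_triangle_ineq[of "emb B - transp ?q * ?W" "transp ?q * ?W"] hqW by (simp add: x_def)
  have "norm (emb (transpose_mat B) * ?D - emb (transpose_mat V)) \<le>
    b * u * (norm (emb (transpose_mat V)) + norm (emb (transpose_mat B)) * norm ?D)"
  proof (rule fl_tri_solve_error[OF B _ D(2) _ u0])
    show "u \<le> 1 / 2" using bu_le[of 1] mult_right_mono[OF b100 u0] u0 by simp
  qed (use Vc D rounding_small[OF sz' bu, of s] in auto)
  also have "\<dots> = b * u * norm (emb V) + b * u * norm ?D * norm (emb B)"
    by (simp add: tr algebra_simps)
  also have "\<dots> \<le> b ^ 10 * (u * w) + b ^ 7 * u * (b ^ 2 * w + x)"
  proof (rule add_mono[OF _ mult_mono[OF _ hB]])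
    show "b * u * norm (emb V) \<le> b ^ 10 * (u * w)"
      by (rule scale_mult[OF _ _ _ hV, of _ 1 u]) (use u0 b100 in auto)
    show "b * u * norm ?D \<le> b ^ 7 * u"
      by (rule scale_mult[OF _ _ _ hD, of _ 1 u]) (use u0 b100 in auto)
  qed (use u0 b100 in auto)
  finally have tri: "norm (emb (transpose_mat B) * ?D - emb (transpose_mat V)) \<le>
    b ^ 10 * (u * w) + b ^ 7 * u * (b ^ 2 * w + x)" .
  have "emb (transpose_mat B) * ?D - emb (transpose_mat V) = transp (transp ?D * emb B - emb V)"
    by (simp add: emb_transpose)
  with tri have tri: "norm (transp ?D * emb B - emb V) \<le> b ^ 10 * (u * w) + b ^ 7 * u * (b ^ 2 * w + x)"
    by (simp only: norm_transp)
  have HD: "transp H * transp ?D = idm s" using arg_cong[OF H(2), of transp] by simp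
  have dB: "dims s s (emb B - transp ?q * ?W)"
    by (intro dims_diff dims_mult[OF dims_transp[OF dims_emb[OF q]] dims_emb[OF W]] dims_emb Bc)
  have "emb B - transp ?q * ?W = transp H * (transp ?D * (emb B - transp ?q * ?W))"
    by (simp only: mult.assoc[symmetric] HD idm_mult[OF dB])
  also have "transp ?D * (emb B - transp ?q * ?W) =
    (transp ?D * emb B - emb V) + (emb V - transp (?q * ?D) * ?W)"
    by (simp add: algebra_simps)
  finally have "x = norm (transp H * ((transp ?D * emb B - emb V) + (emb V - transp (?q * ?D) * ?W)))"
    by (simp add: x_def)
  also have "\<dots> \<le> norm H * norm ((transp ?D * emb B - emb V) + (emb V - transp (?q * ?D) * ?W))"
    using norm_mult_ineq[of "transp H"] by simp
  also have "\<dots> \<le> b ^ 2 * (b ^ 10 * (u * w) + b ^ 7 * u * (b ^ 2 * w + x) + b ^ 12 * (u * w))"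
    using hH tri eVq norm_triangle_ineq[of "transp ?D * emb B - emb V" "emb V - transp (?q * ?D) * ?W"]
    by (intro mult_mono) auto
  also have "\<dots> = b ^ 12 * (u * w) + b ^ 11 * (u * w) + b ^ 14 * (u * w) + b ^ 9 * u * x"
    by (simp add: algebra_simps flip: power_add)
  also have "\<dots> \<le> b ^ 12 * (u * w) + b ^ 11 * (u * w) + b ^ 14 * (u * w) + 1 / 2 * x"
  proof (rule add_left_mono, rule mult_right_mono)
    have "100 * (b ^ 9 * u) \<le> b ^ 30 * u" using u0 b100 by (intro scale_step[OF _ order_refl]) auto
    then show "b ^ 9 * u \<le> 1 / 2" using bu by linarith
  qed (simp add: x_def)
  finally have x2: "x \<le> b ^ 12 * (u * w) + b ^ 11 * (u * w) + b ^ 14 * (u * w) + 1 / 2 * x" .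
  have uw0: "0 \<le> u * w" using u0 w0 by simp
  have "100 * (b ^ 12 * (u * w)) \<le> b ^ 16 * (u * w)" "100 * (b ^ 11 * (u * w)) \<le> b ^ 16 * (u * w)"
    "100 * (b ^ 14 * (u * w)) \<le> b ^ 16 * (u * w)" "0 \<le> b ^ 16 * (u * w)"
    using uw0 b100 by (auto intro!: scale_step[OF _ order_refl])
  then have "x \<le> b ^ 16 * (u * w)" using le_of_add3_half[OF x2] by blast
  then have eB: "norm (transp (shift n s) * (emb B - transp ?q * ?W)) \<le> b ^ 16 * (u * w)"
    using norm_mult_shift[OF dims_transp[OF dB], of n]
      norm_transp[of "transp (shift n s) * (emb B - transp ?q * ?W)"]
    by (simp only: transp_mult transp_simps(1) norm_transp x_def)
  have "emb (Z @\<^sub>r B) - transp (?Q + ?q * shift n s) * ?W =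
    (emb Z - transp ?Q * ?W) + transp (shift n s) * (emb B - transp ?q * ?W)"
    by (simp add: emb_append_rows[OF Zc Bc] algebra_simps)
  then show "norm (emb (Z @\<^sub>r B) - transp (?Q + ?q * shift n s) * ?W) \<le> b ^ 17 * (u * norm ?W)"
    using norm_add_scale(1)[OF eZ eB, of 17] by (simp add: w_def)
qed

text \<open>The exponents 23 and 30 do not depend on the exponent 32 in the assumption on \<open>\<Q>\<^sub>k\<close>. Hence
  the loss of orthogonality grows only linearly in \<open>k\<close>.\<close>

lemma bcgs_step:
  fixes Q R X W S T M G V U Y Om M2 D V2 q Rc Rd :: "real mat" and \<Delta> :: fmat
  assumes Q: "Q \<in> carrier_mat m n" and R: "R \<in> carrier_mat n n" and X: "X \<in> carrier_mat m n"
    and W: "W \<in> carrier_mat m s" and S: "S \<in> carrier_mat n s" and s: "0 < s"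
    and sz: "2 * real (m + n + s + 1) \<le> b"
    and om: "norm (idm n - transp (emb Q) * emb Q) \<le> b ^ 32 * u"
    and \<Delta>: "dims m n \<Delta>" "emb X + \<Delta> = emb Q * emb R" "norm \<Delta> \<le> b ^ 18 * (u * \<chi>)"
    and \<chi>: "norm (emb X + emb W * shift n s) \<le> \<chi>" "norm (emb W) \<le> \<chi>"
    and \<sigma>: "0 < \<sigma>"
    and lb: "\<And>v. dims (n + s) 1 v \<Longrightarrow> \<sigma> * norm v \<le> norm ((emb X + emb W * shift n s) * v)"
    and small: "b ^ 120 * (u * \<chi>\<^sup>2) \<le> \<sigma>\<^sup>2"
    and Serr: "norm (emb S - transp (emb Q) * emb W) \<le> b ^ 17 * (u * \<chi>)"
    and T: "fl_mult u (transpose_mat W) W T"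
    and M: "fl_add_mult u T (- transpose_mat S) S M" and G: "fl_chol u M G"
    and V: "fl_add_mult u W (- Q) S V" and U: "fl_tri_solve u V G U"
    and Y: "fl_mult u (transpose_mat Q) U Y" and Om: "fl_mult u (transpose_mat U) U Om"
    and M2: "fl_add_mult u Om (- transpose_mat Y) Y M2" and D: "fl_chol u M2 D"
    and V2: "fl_add_mult u U (- Q) Y V2" and q: "fl_tri_solve u V2 D q"
    and Rc: "fl_add_mult u S Y G Rc" and Rd: "fl_mult u D G Rd"
  obtains H where "U \<in> carrier_mat m s" "Y \<in> carrier_mat n s" "D \<in> carrier_mat s s"
    "upper_triangular D" "\<And>i. i < s \<Longrightarrow> D $$ (i, i) \<noteq> 0"
    "q \<in> carrier_mat m s" "Rc \<in> carrier_mat n s" "Rd \<in> carrier_mat s s"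
    "dims s s H" "emb D * H = idm s" "norm H \<le> b ^ 2 * 1"
    "norm (emb Q) \<le> b ^ 1 * 1" "norm (emb q) \<le> b ^ 2 * 1" "norm (emb U) \<le> b ^ 2 * 1"
    "norm (emb Y) \<le> b ^ 0 * 1" "norm (emb D) \<le> b ^ 6 * 1"
    "norm (emb q * emb D - (emb U - emb Q * emb Y)) \<le> b ^ 10 * u"
    "norm (transp (emb Q) * emb q) \<le> b ^ 23 * u"
    "norm (transp (emb q) * emb q - idm s) \<le> b ^ 30 * u"
    "norm (emb Q * emb Rc + emb q * emb Rd - emb W) \<le> b ^ 17 * (u * \<chi>)"
proof -
  let ?Q = "emb Q" and ?W = "emb W" and ?S = "emb S" and ?G = "emb G" and ?U = "emb U"
  let ?Y = "emb Y" and ?D = "emb D" and ?q = "emb q"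
  have dQ: "dims m n ?Q" and dW: "dims m s ?W" and dS: "dims n s ?S" and dX: "dims m n (emb X)"
    and dR: "dims n n (emb R)"
    using Q W S X R by (auto intro: dims_emb)
  have sz': "2 * real ((m + n + s) + 1) \<le> b" using sz by simp
  have \<sigma>\<chi>: "\<sigma> \<le> \<chi>"
  proof -
    obtain e where e: "dims (n + s) 1 e" "norm e = 1" using ex_unit_vector[of "n + s"] s by auto
    have "\<sigma> \<le> norm ((emb X + ?W * shift n s) * e)" using lb[OF e(1)] e(2) by simp
    also have "\<dots> \<le> \<chi>" using norm_mult_ineq[of "emb X + ?W * shift n s" e] e(2) \<chi>(1) by simp
    finally show ?thesis .
  qed
  have \<chi>0: "0 < \<chi>" using \<sigma> \<sigma>\<chi> by linarith
  have \<sigma>2: "\<sigma>\<^sup>2 \<le> \<chi>\<^sup>2" using \<sigma> \<sigma>\<chi> by (intro power_mono) auto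
  have u\<chi>: "b ^ 120 * (u * \<chi>) \<le> \<sigma>"
  proof -
    have "b ^ 120 * (u * \<chi>) * \<sigma> \<le> b ^ 120 * (u * \<chi>) * \<chi>"
      using \<sigma>\<chi> u0 \<chi>0 pow_pos[of 120] by (intro mult_left_mono) auto
    also have "\<dots> \<le> \<sigma> * \<sigma>" using small by (simp add: power2_eq_square mult_ac)
    finally show ?thesis using \<sigma> by (simp only: mult_le_cancel_right_pos)
  qed
  \<comment> \<open>\<open>y\<close> is u times the condition number. The hypothesis is used in the
    two forms \<open>by1\<close> and \<open>byy\<close>: what is linear in \<open>y\<close> is tiny,
    and what is quadratic in \<open>y\<close> is tiny even relative to \<open>u\<close>.\<close>
  define y where "y = u * \<chi> / \<sigma>"
  have y0: "0 \<le> y" using u0 \<chi>0 \<sigma> by (simp add: y_def)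
  have uy: "u \<le> y"
  proof -
    have "u * \<sigma> \<le> u * \<chi>" using \<sigma>\<chi> u0 by (intro mult_left_mono) auto
    then show ?thesis using \<sigma> by (simp add: y_def field_simps)
  qed
  have by1: "b ^ 120 * y \<le> 1" using u\<chi> \<sigma> by (simp add: y_def field_simps)
  have byy: "b ^ 120 * y\<^sup>2 \<le> u"
  proof -
    have "u * (b ^ 120 * (u * \<chi>\<^sup>2)) \<le> u * \<sigma>\<^sup>2" using small u0 by (rule mult_left_mono)
    then show ?thesis using \<sigma> by (simp add: y_def power_divide power_mult_distrib field_simps power2_eq_square)
  qed
  have bu120: "b ^ 120 * u \<le> 1"
    using mult_left_mono[OF uy, of "b ^ 120"] by1 pow_pos[of 120] by linarith
  have bu: "b ^ 30 * u \<le> 1" using mult_right_mono[OF pow_le[of 30 120] u0] bu120 by linarith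
  have tiny: "100 * (b ^ i * u) \<le> 1" "100 * (b ^ i * y) \<le> 1" if "i < 120" for i
    using scale_step[OF _ order_refl that, of u] scale_step[OF _ order_refl that, of y] bu120 by1
      u0 y0 pow_pos[of i] by auto
  have om1: "b ^ 32 * u \<le> 1" using tiny(1)[of 32] u0 pow_pos[of 32] by (simp add: zero_le_mult_iff)
  have hW: "norm ?W \<le> b ^ 0 * \<chi>" using \<chi>(2) by simp
  have hQ: "norm ?Q \<le> b ^ 1 * 1"
    using norm_le_of_orthogonal[OF dQ] om om1 sz by (simp add: norm_minus_commute)
  have hS: "norm ?S \<le> b ^ 2 * \<chi>"
  proof (rule norm_approx_scale[OF _ norm_mult_scale[of "transp ?Q" 1 1 ?W 0 \<chi> 1]])
    have "100 * (b ^ 17 * u) * \<chi> \<le> 1 * \<chi>" using tiny(1)[of 17] \<chi>0 by (intro mult_right_mono) auto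
    moreover have "0 \<le> b ^ 17 * (u * \<chi>)" using u0 \<chi>0 b100 by simp
    ultimately show "norm (?S - transp ?Q * ?W) \<le> b ^ 0 * \<chi>" using Serr by (simp add: mult.assoc)
  qed (use hQ hW in auto)
  have omS: "b ^ 32 * u * (norm ?S)\<^sup>2 \<le> b ^ 36 * (u * \<chi>\<^sup>2)"
  proof (rule scale_mult[of _ _ 32 u 4 "\<chi>\<^sup>2"])
    show "(norm ?S)\<^sup>2 \<le> b ^ 4 * \<chi>\<^sup>2"
      using power_mono[OF hS norm_ge_zero, of 2] by (simp add: power_mult_distrib flip: power_mult)
  qed (use u0 b100 in auto)
  have omS1: "b ^ 32 * u * norm ?S \<le> b ^ 34 * (u * \<chi>)"
    by (rule scale_mult[OF _ _ _ hS, of _ 32 u]) (use u0 b100 in auto)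
  have Tc: "T \<in> carrier_mat s s" using T W by (simp add: fl_mult_def)
  have Terr: "norm (emb T - transp ?W * ?W) \<le> b ^ 2 * (u * \<chi>\<^sup>2)"
    unfolding emb_transpose[symmetric]
    by (rule fl_mult_scale[OF T _ sz' bu, of 0 \<chi> 0 \<chi>])
      (use W hW in \<open>auto simp: emb_transpose power2_eq_square\<close>)
  define N where "N = ?W - ?Q * ?S"
  define B where "B = transp ?W * ?W - transp ?S * ?S"
  have u\<chi>0: "0 \<le> u * \<chi>" "0 \<le> u * \<chi>\<^sup>2" using u0 \<chi>0 by auto
  have small_i: "c * x \<le> \<sigma>\<^sup>2" if "0 \<le> x" "x \<le> b ^ i * (u * \<chi>\<^sup>2)" "i < 120" "c \<le> 100" for c x i
    using scale_step_coeff[OF that] small by linarith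
  have hF: "64 * norm (transp N * N - B) \<le> \<sigma>\<^sup>2"
  proof (rule small_i[OF norm_ge_zero])
    have "norm (transp N * N - B) \<le> 2 * (b ^ 17 * (u * \<chi>)) * norm ?S + b ^ 32 * u * (norm ?S)\<^sup>2"
      unfolding N_def B_def by (rule gram_defect(1)[OF dS om Serr])
    also have "\<dots> \<le> b ^ 37 * (u * \<chi>\<^sup>2)"
    proof (rule scale_add[OF _ _ _ omS])
      have "2 * (b ^ 17 * (u * \<chi>)) \<le> b ^ 18 * (u * \<chi>)"
        using u\<chi>0 b100 by (intro scale_step_coeff[OF _ order_refl]) auto
      then show "2 * (b ^ 17 * (u * \<chi>)) * norm ?S \<le> b ^ 20 * (u * \<chi>\<^sup>2)"
        using u\<chi>0 b100 by (intro scale_mult[OF _ _ _ hS]) (auto simp: power2_eq_square)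
    qed (use u0 \<chi>0 b100 in auto)
    finally show "norm (transp N * N - B) \<le> b ^ 37 * (u * \<chi>\<^sup>2)" .
  qed auto
  have \<Delta>_small: "norm \<Delta> \<le> \<sigma> / 2"
  proof -
    have "100 * (b ^ 18 * (u * \<chi>)) \<le> b ^ 120 * (u * \<chi>)"
      using u\<chi>0 b100 by (intro scale_step[OF _ order_refl]) auto
    then show ?thesis using \<Delta>(3) u\<chi> \<sigma> by linarith
  qed
  \<comment> \<open>Of (\<sigma>/2)^2 = \<sigma>^2/4 the Gram defect takes at most \<sigma>^2/64,
    and 2 (\<sigma>/4)^2 = \<sigma>^2/8 is left; so the first pass runs with \<tau> =
    \<sigma>/4.\<close>
  have lower: "2 * (\<sigma> / 4)\<^sup>2 * (norm v)\<^sup>2 \<le> inner v (B * v)" if v: "dims s 1 v" for v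
  proof -
    have "\<sigma> / 2 * norm v \<le> norm (N * v)"
      unfolding N_def
      by (rule projected_lower_bound[OF dX dQ dS dR \<Delta>(1) \<Delta>_small \<Delta>(2) \<sigma> lb v])
    then have "(\<sigma> / 2 * norm v)\<^sup>2 \<le> (norm (N * v))\<^sup>2"
      using \<sigma> by (intro power_mono) auto
    then have 1: "\<sigma>\<^sup>2 * (norm v)\<^sup>2 / 4 \<le> inner v (transp N * N * v)"
      by (simp add: norm_sq_mult power_mult_distrib power_divide)
    have "\<bar>inner v ((transp N * N - B) * v)\<bar> \<le> \<sigma>\<^sup>2 / 64 * (norm v)\<^sup>2"
      using hF by (intro order_trans[OF abs_inner_mult_le] mult_right_mono) auto
    also have "\<dots> = \<sigma>\<^sup>2 * (norm v)\<^sup>2 / 64" by simp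
    finally have 2: "inner v (transp N * N * v) - inner v (B * v) \<le> \<sigma>\<^sup>2 * (norm v)\<^sup>2 / 64"
      unfolding left_diff_distrib inner_diff_right abs_le_iff by linarith
    have "2 * (\<sigma> / 4)\<^sup>2 * (norm v)\<^sup>2 = \<sigma>\<^sup>2 * (norm v)\<^sup>2 / 8" by (simp add: power_divide)
    moreover have "0 \<le> \<sigma>\<^sup>2 * (norm v)\<^sup>2" by simp
    ultimately show ?thesis using 1 2 by linarith
  qed
  have small1: "b ^ 30 * (u * \<chi>\<^sup>2) \<le> (\<sigma> / 4)\<^sup>2"
    using small_i[OF _ order_refl, of 30 16] u\<chi>0 b100 by (simp add: power_divide)
  have small_om1: "b ^ 5 * (b ^ 32 * u * (norm ?S)\<^sup>2) \<le> (\<sigma> / 4)\<^sup>2"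
  proof -
    have "b ^ 5 * (b ^ 32 * u * (norm ?S)\<^sup>2) \<le> b ^ 41 * (u * \<chi>\<^sup>2)"
      by (rule scale_mult[OF _ _ _ omS, of _ 5 1]) (use u0 b100 in auto)
    from small_i[OF _ this, of 16] show ?thesis using u0 b100 by (simp add: power_divide)
  qed
  obtain H1 where p1: "G \<in> carrier_mat s s" "upper_triangular G" "\<And>i. i < s \<Longrightarrow> G $$ (i, i) \<noteq> 0"
    "U \<in> carrier_mat m s"
    "dims s s H1" "?G * H1 = idm s" "H1 * ?G = idm s" "norm H1 \<le> b / (\<sigma> / 4)"
    "norm ?G \<le> b ^ 4 * \<chi>" "norm ?U \<le> b ^ 2"
    "norm (?U * ?G - (?W - ?Q * ?S)) \<le> b ^ 8 * (u * \<chi>)"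
    "norm (transp ?U * ?U - idm s) \<le>
      (b / (\<sigma> / 4))\<^sup>2 * (b ^ 22 * (u * \<chi>\<^sup>2) + b ^ 32 * u * (norm ?S)\<^sup>2)"
    "norm (transp ?Q * ?U) \<le> (b / (\<sigma> / 4)) * (b ^ 18 * (u * \<chi>) + b ^ 32 * u * norm ?S)"
    by (rule cholesky_pass[OF Q W S Tc s sz \<chi>(2) Terr Serr om om1 M G V U lower[unfolded B_def] _ small1 small_om1])
      (use \<sigma> in auto)
  note Uc = p1(4)
  have dU: "dims m s ?U" using Uc by (rule dims_emb)
  have hU: "norm ?U \<le> b ^ 2 * 1" using p1(10) by simp
  have QU: "norm (transp ?Q * ?U) \<le> b ^ 37 * y"
  proof -
    have 1: "b ^ 18 * (u * \<chi>) + b ^ 32 * u * norm ?S \<le> b ^ 35 * (u * \<chi>)"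
      using u\<chi>0 u0 b100 by (intro scale_add[OF _ _ order_refl omS1]) auto
    have "(b / (\<sigma> / 4)) * (b ^ 18 * (u * \<chi>) + b ^ 32 * u * norm ?S) \<le> (b / (\<sigma> / 4)) * (b ^ 35 * (u * \<chi>))"
      using 1 b100 \<sigma> by (intro mult_left_mono) auto
    also have "\<dots> = (4 * b) * (b ^ 35 * y)" using \<sigma> by (simp add: y_def field_simps)
    also have "\<dots> \<le> b ^ 37 * y"
    proof (rule scale_mult[of _ _ 2 1 35 y])
      show "4 * b \<le> b ^ 2 * 1" using pow_step[of 1 2] b100 by simp
    qed (use y0 b100 in auto)
    finally show ?thesis using p1(13) by linarith
  qed
  have gramU: "norm (transp ?U * ?U - idm s) \<le> 1 / 8"
  proof -
    have 1: "b ^ 22 * (u * \<chi>\<^sup>2) + b ^ 32 * u * (norm ?S)\<^sup>2 \<le> b ^ 37 * (u * \<chi>\<^sup>2)"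
      using u\<chi>0 u0 b100 by (intro scale_add[OF _ _ order_refl omS]) auto
    have "(b / (\<sigma> / 4))\<^sup>2 * (b ^ 22 * (u * \<chi>\<^sup>2) + b ^ 32 * u * (norm ?S)\<^sup>2) \<le>
      (b / (\<sigma> / 4))\<^sup>2 * (b ^ 37 * (u * \<chi>\<^sup>2))"
      using 1 by (intro mult_left_mono) auto
    also have "\<dots> = 16 * (b ^ 39 * (u * \<chi>\<^sup>2)) / \<sigma>\<^sup>2"
      using \<sigma> by (simp add: power_divide field_simps flip: power_add)
    also have "\<dots> \<le> 1 / 8"
    proof -
      have "16 * (b ^ 39 * (u * \<chi>\<^sup>2)) \<le> b ^ 40 * (u * \<chi>\<^sup>2)"
        using u\<chi>0 b100 by (intro scale_step_coeff[OF _ order_refl]) auto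
      moreover have "100 * (b ^ 40 * (u * \<chi>\<^sup>2)) \<le> \<sigma>\<^sup>2"
        using u\<chi>0 b100 by (intro small_i[OF _ order_refl]) auto
      ultimately have "16 * (b ^ 39 * (u * \<chi>\<^sup>2)) \<le> 1 / 8 * \<sigma>\<^sup>2"
        using zero_le_power2[of \<sigma>] by linarith
      then show ?thesis by (simp only: pos_divide_le_eq[OF zero_less_power[OF \<sigma>]])
    qed
    finally show ?thesis using p1(12) by linarith
  qed
  have Yc: "Y \<in> carrier_mat n s" using Y Q Uc by (simp add: fl_mult_def)
  have dY: "dims n s ?Y" using Yc by (rule dims_emb)
  have Yerr: "norm (?Y - transp ?Q * ?U) \<le> b ^ 4 * u"
    unfolding emb_transpose[symmetric]
    by (rule fl_mult_scale[OF Y _ sz' bu, of 1 1 2 1]) (use Q Uc hQ hU in \<open>auto simp: emb_transpose\<close>)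
  have hY: "norm ?Y \<le> b ^ 38 * y"
    by (rule norm_approx_scale[OF order_trans[OF Yerr mult_left_mono[OF uy]] QU]) (use b100 in auto)
  have hY1: "norm ?Y \<le> 1 / 100" using hY tiny(2)[of 38] by simp
  have hYY: "(norm ?Y)\<^sup>2 \<le> b ^ 76 * y\<^sup>2"
    using power_mono[OF hY norm_ge_zero, of 2] by (simp add: power_mult_distrib flip: power_mult)
  \<comment> \<open>\<open>Y\<close> contributes \<open>b ^ 76 * y\<^sup>2\<close>. As 32 + 76 is
    below 120, \<open>byy\<close> absorbs all powers of \<open>b\<close>, and the old orthogonality
    error contributes no more than \<open>u\<close>.\<close>
  have omYY: "b ^ 32 * u * (norm ?Y)\<^sup>2 \<le> u"
  proof -
    have "b ^ 32 * (norm ?Y)\<^sup>2 \<le> b ^ 120 * y\<^sup>2"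
      by (rule scale_mult[OF _ _ _ hYY, of _ 32 1]) (use b100 in auto)
    also have "\<dots> \<le> 1" using byy bu120 mult_right_mono[OF pow_le[of 0 120] u0] by simp
    finally show ?thesis using mult_left_mono[OF _ u0, of "b ^ 32 * (norm ?Y)\<^sup>2" 1] by (simp add: mult_ac)
  qed
  have omY: "b ^ 32 * u * norm ?Y \<le> u"
  proof -
    have "b ^ 32 * norm ?Y \<le> b ^ 120 * y"
      by (rule scale_mult[OF _ _ _ hY, of _ 32 1]) (use b100 in auto)
    then have "b ^ 32 * norm ?Y \<le> 1" using by1 by linarith
    then show ?thesis using mult_left_mono[OF _ u0, of "b ^ 32 * norm ?Y" 1] by (simp add: mult_ac)
  qed
  have Omc: "Om \<in> carrier_mat s s" using Om Uc by (simp add: fl_mult_def)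
  have Omerr: "norm (emb Om - transp ?U * ?U) \<le> b ^ 2 * (u * (b ^ 2)\<^sup>2)"
    unfolding emb_transpose[symmetric]
    by (rule fl_mult_scale[OF Om _ sz' bu, of 0 "b ^ 2" 0 "b ^ 2"])
      (use Uc p1(10) in \<open>auto simp: emb_transpose power2_eq_square\<close>)
  have Yerr2: "norm (?Y - transp ?Q * ?U) \<le> b ^ 17 * (u * b ^ 2)"
    using scale_up[OF norm_ge_zero Yerr, of 19] by (simp add: mult_ac flip: power_add)
  \<comment> \<open>1 - 1/8 - 1/10000 exceeds 1/2, so the second pass runs with \<tau> = 1/2, and no
    condition number remains in its bounds.\<close>
  have lower2: "2 * (1 / 2)\<^sup>2 * (norm v)\<^sup>2 \<le> inner v ((transp ?U * ?U - transp ?Y * ?Y) * v)"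
    if v: "dims s 1 v" for v
  proof -
    have "\<bar>inner v ((transp ?U * ?U - idm s) * v)\<bar> \<le> 1 / 8 * (norm v)\<^sup>2"
      using gramU by (intro order_trans[OF abs_inner_mult_le] mult_right_mono) auto
    then have 1: "(norm v)\<^sup>2 - inner v (transp ?U * ?U * v) \<le> (norm v)\<^sup>2 / 8"
      unfolding left_diff_distrib inner_diff_right idm_mult[OF v] power2_norm_eq_inner by linarith
    have "norm (?Y * v) \<le> 1 / 100 * norm v"
      using hY1 by (intro order_trans[OF norm_mult_ineq] mult_right_mono) auto
    from power_mono[OF this norm_ge_zero, of 2]
    have 2: "inner v (transp ?Y * ?Y * v) \<le> (norm v)\<^sup>2 / 10000"
      by (simp add: norm_sq_mult power_mult_distrib power_divide)
    have "2 * (1 / 2)\<^sup>2 * (norm v)\<^sup>2 = (norm v)\<^sup>2 / 2" by (simp add: power_divide)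
    then show ?thesis using 1 2 zero_le_power2[of "norm v"]
      by (simp only: left_diff_distrib inner_diff_right)
  qed
  have small2: "b ^ 30 * (u * (b ^ 2)\<^sup>2) \<le> (1 / 2)\<^sup>2"
    using tiny(1)[of 34] by (simp add: mult_ac power_divide flip: power_add power_mult)
  have small_om2: "b ^ 5 * (b ^ 32 * u * (norm ?Y)\<^sup>2) \<le> (1 / 2)\<^sup>2"
  proof -
    have "b ^ 5 * (b ^ 32 * u * (norm ?Y)\<^sup>2) \<le> b ^ 5 * u" using omYY b100 by (intro mult_left_mono) auto
    then show ?thesis using tiny(1)[of 5] by (simp add: power_divide)
  qed
  obtain H where p2: "D \<in> carrier_mat s s" "upper_triangular D" "\<And>i. i < s \<Longrightarrow> D $$ (i, i) \<noteq> 0"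
    "q \<in> carrier_mat m s"
    "dims s s H" "?D * H = idm s" "H * ?D = idm s" "norm H \<le> b / (1 / 2)"
    "norm ?D \<le> b ^ 4 * b ^ 2" "norm ?q \<le> b ^ 2"
    "norm (?q * ?D - (?U - ?Q * ?Y)) \<le> b ^ 8 * (u * b ^ 2)"
    "norm (transp ?q * ?q - idm s) \<le>
      (b / (1 / 2))\<^sup>2 * (b ^ 22 * (u * (b ^ 2)\<^sup>2) + b ^ 32 * u * (norm ?Y)\<^sup>2)"
    "norm (transp ?Q * ?q) \<le> (b / (1 / 2)) * (b ^ 18 * (u * b ^ 2) + b ^ 32 * u * norm ?Y)"
    by (rule cholesky_pass[OF Q Uc Yc Omc s sz p1(10) Omerr Yerr2 om om1 M2 D V2 q lower2 _ small2 small_om2]) auto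
  have hq: "norm ?q \<le> b ^ 2 * 1" using p2(10) by simp
  have hD: "norm ?D \<le> b ^ 6 * 1" using p2(9) by (simp flip: power_add)
  have hE: "norm (?q * ?D - (?U - ?Q * ?Y)) \<le> b ^ 10 * u"
    using p2(11) by (simp add: mult_ac flip: power_add)
  have hH: "norm H \<le> b ^ 2 * 1" using p2(8) pow_step[of 1 2] b100 by simp
  have Qq: "norm (transp ?Q * ?q) \<le> b ^ 23 * u"
  proof -
    have "b ^ 18 * (u * b ^ 2) + b ^ 32 * u * norm ?Y \<le> b ^ 21 * u"
      using omY u0 b100
      by (intro scale_add[where i = 20 and j = 0]) (auto simp: mult_ac simp flip: power_add)
    then have "(b / (1 / 2)) * (b ^ 18 * (u * b ^ 2) + b ^ 32 * u * norm ?Y) \<le> b ^ 23 * u"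
      using pow_step[of 1 2] u0 b100 by (intro scale_mult[of _ _ 2 1 21 u]) auto
    then show ?thesis using p2(13) by linarith
  qed
  have qq: "norm (transp ?q * ?q - idm s) \<le> b ^ 30 * u"
  proof -
    have "b ^ 22 * (u * (b ^ 2)\<^sup>2) + b ^ 32 * u * (norm ?Y)\<^sup>2 \<le> b ^ 27 * u"
      using omYY u0 b100
      by (intro scale_add[where i = 26 and j = 0]) (auto simp: mult_ac simp flip: power_add power_mult)
    moreover have "(b / (1 / 2))\<^sup>2 \<le> b ^ 3 * 1"
    proof -
      have "(b / (1 / 2))\<^sup>2 = 4 * b\<^sup>2" by (simp add: power_mult_distrib)
      then show ?thesis using pow_step[of 2 3] zero_le_power2[of b] by linarith
    qed
    ultimately have "(b / (1 / 2))\<^sup>2 * (b ^ 22 * (u * (b ^ 2)\<^sup>2) + b ^ 32 * u * (norm ?Y)\<^sup>2) \<le> b ^ 30 * u"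
      using u0 b100 by (intro scale_mult[of _ _ 3 1 27 u]) auto
    then show ?thesis using p2(12) by linarith
  qed
  have Rcc: "Rc \<in> carrier_mat n s" using Rc S by (simp add: fl_add_mult_def)
  have Rdc: "Rd \<in> carrier_mat s s" using Rd p1(1) p2(1) by (simp add: fl_mult_def)
  have hY0: "norm ?Y \<le> b ^ 0 * 1" using hY1 by simp
  have eRc: "norm (emb Rc - (?S + ?Y * ?G)) \<le> b ^ 6 * (u * \<chi>)"
    using fl_add_mult_scale[OF Rc _ _ sz' bu, of s 0 1 4 \<chi> 5 2 "u * \<chi>"] S Yc p1(1,9) hY0 hS by simp
  have eRd: "norm (emb Rd - ?D * ?G) \<le> b ^ 11 * (u * \<chi>)"
    by (rule fl_mult_scale[OF Rd _ sz' bu, of 6 1 4 \<chi>]) (use p1(1,9) p2(1) hD in auto)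
  have res: "norm (?Q * emb Rc + ?q * emb Rd - ?W) \<le> b ^ 17 * (u * \<chi>)"
  proof -
    have 1: "norm ((?q * ?D - (?U - ?Q * ?Y)) * ?G) \<le> b ^ 14 * (u * \<chi>)"
      by (rule norm_mult_scale[OF hE p1(9)]) auto
    have 2: "norm (?Q * (emb Rc - (?S + ?Y * ?G))) \<le> b ^ 7 * (u * \<chi>)"
      by (rule norm_mult_scale[OF hQ eRc]) auto
    have 3: "norm (?q * (emb Rd - ?D * ?G)) \<le> b ^ 13 * (u * \<chi>)"
      by (rule norm_mult_scale[OF hq eRd]) auto
    \<comment> \<open>With S + Y G and D G in place of \<open>Rc\<close> and \<open>Rd\<close> the
      terms U G and Q Y G cancel; the residuals of the two passes and the two roundings
      remain.\<close>
    have eq: "?Q * emb Rc + ?q * emb Rd - ?W =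
      ((?U * ?G - (?W - ?Q * ?S)) + (?q * ?D - (?U - ?Q * ?Y)) * ?G) +
      (?Q * (emb Rc - (?S + ?Y * ?G)) + ?q * (emb Rd - ?D * ?G))"
      by (simp add: algebra_simps)
    show ?thesis unfolding eq
      by (rule norm_add_scale(1)[OF norm_add_scale(1)[OF p1(11) 1, of 16] norm_add_scale(1)[OF 2 3, of 16]]) auto
  qed
  show ?thesis
    by (rule that[OF Uc Yc p2(1-3,4) Rcc Rdc p2(5,6) hH hQ hq hU hY0 hD hE Qq qq res])
qed

end


section \<open>Gram matrices and products of appended blocks\<close>

lemma norm_shift_mult: "dims s m B \<Longrightarrow> norm (transp (shift n s) * B) = norm B"
  using norm_mult_shift[OF dims_transp, of s m B n] norm_transp[of "transp (shift n s) * B"] by simp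

lemma norm_le_append:
  assumes A: "dims m n A" and B: "dims m s B"
  shows "norm A \<le> norm (A + B * shift n s)" "norm B \<le> norm (A + B * shift n s)"
proof -
  have "norm A \<le> norm (absm (A + B * shift n s))"
    using A by (intro norm_mono) (auto simp: entry_mult_shift[OF B] dims_def)
  then show "norm A \<le> norm (A + B * shift n s)" by simp
  have "norm (B * shift n s) \<le> norm (absm (A + B * shift n s))"
    using A by (intro norm_mono) (auto simp: entry_mult_shift[OF B] dims_def)
  then show "norm B \<le> norm (A + B * shift n s)" by (simp add: norm_mult_shift[OF B])
qed

text \<open>The enlarged Gram matrix splits into four blocks, and the off-diagonal one occurs twice,
  once transposed.\<close>

lemma gram_append:
  assumes Q: "dims m n Q" and q: "dims m s q"
    and 1: "norm (idm n - transp Q * Q) \<le> e1" and 2: "norm (transp Q * q) \<le> e2"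
    and 3: "norm (transp q * q - idm s) \<le> e3"
  shows "norm (idm (n + s) - transp (Q + q * shift n s) * (Q + q * shift n s)) \<le> e1 + 2 * e2 + e3"
proof -
  let ?J = "shift n s"
  have dQq: "dims n s (transp Q * q)" by (rule dims_mult[OF dims_transp[OF Q] q])
  have dE: "dims s s (transp q * q - idm s)"
    by (intro dims_diff dims_mult[OF dims_transp[OF q] q] dims_idm)
  have n2: "norm (transp Q * q * ?J) \<le> e2" using 2 by (simp add: norm_mult_shift[OF dQq])
  have n2': "norm (transp ?J * transp (transp Q * q)) \<le> e2"
    using 2 by (simp only: norm_shift_mult[OF dims_transp[OF dQq]] norm_transp)
  have n3: "norm (transp ?J * ((transp q * q - idm s) * ?J)) \<le> e3"
    using 3 by (simp add: norm_shift_mult[OF dims_mult[OF dE dims_shift]] norm_mult_shift[OF dE])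
  have eq: "idm (n + s) - transp (Q + q * ?J) * (Q + q * ?J) =
    (idm n - transp Q * Q) - (transp Q * q * ?J + transp ?J * transp (transp Q * q)) -
    transp ?J * ((transp q * q - idm s) * ?J)"
    by (simp add: idm_shift algebra_simps idm_mult[OF dims_shift])
  show ?thesis unfolding eq
    using norm_triangle_ineq4[of "(idm n - transp Q * Q) - (transp Q * q * ?J + transp ?J * transp (transp Q * q))"
        "transp ?J * ((transp q * q - idm s) * ?J)"]
      norm_triangle_ineq4[of "idm n - transp Q * Q" "transp Q * q * ?J + transp ?J * transp (transp Q * q)"]
      norm_triangle_ineq[of "transp Q * q * ?J" "transp ?J * transp (transp Q * q)"] 1 n2 n2' n3
    by linarith
qed

lemma product_append:
  assumes Q: "dims m n Q" and R: "dims n n R" and Rc: "dims n s Rc" and Rd: "dims s s Rd"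
  shows "(Q + q * shift n s) * (R + Rc * shift n s + transp (shift n s) * Rd * shift n s) =
    Q * R + (Q * Rc + q * Rd) * shift n s"
proof -
  let ?J = "shift n s"
  have "Q * (transp ?J * Rd * ?J) = 0"
    using mult_shift_zero[OF Q] by (simp add: mult.assoc[symmetric])
  moreover have "q * ?J * R = 0" "q * ?J * (Rc * ?J) = 0"
    using shift_mult_zero[OF R] shift_mult_zero[OF Rc] by (simp_all add: mult.assoc)
      (simp add: mult.assoc[symmetric])
  moreover have "q * ?J * (transp ?J * Rd * ?J) = q * Rd * ?J"
  proof -
    have "q * ?J * (transp ?J * Rd * ?J) = q * (?J * transp ?J) * Rd * ?J" by (simp only: mult.assoc)
    also have "\<dots> = q * (idm s * Rd) * ?J" by (simp only: shift_shift mult.assoc)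
    finally show ?thesis by (simp only: idm_mult[OF Rd])
  qed
  ultimately show ?thesis by (simp add: distrib_left distrib_right mult.assoc)
qed

context scale
begin

text \<open>The errors are carried with the factor \<open>real k\<close> and not with a growing
  power of \<open>b\<close>: each iteration adds at most \<open>b ^ 31 * u\<close>, respectively
  \<open>b ^ 17 * u\<close> relative to the leading columns. Only \<open>orth\<close> and
  \<open>res\<close> trade \<open>real k \<le> b\<close> for one more power, to meet the hypotheses
  of \<open>bcgs_step\<close>.\<close>

lemma bcgsi_p_1s_bounds:
  assumes alg: "bcgsi_p_1s u IO s p XX QQ RR"
    and XX: "XX \<in> carrier_mat m (p * s)" and s: "0 < s"
    and sz: "2 * real (m + p * s + s + 1) \<le> b" and pb: "real p \<le> b"
    and \<sigma>: "\<And>k. k \<in> {1..p} \<Longrightarrow> 0 < \<sigma> k"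
    and lb: "\<And>k v. k \<in> {1..p} \<Longrightarrow> dims (k * s) 1 v \<Longrightarrow>
      \<sigma> k * norm v \<le> norm (emb (lead_cols XX (k * s)) * v)"
    and small: "\<And>k. k \<in> {1..p} \<Longrightarrow> b ^ 120 * (u * (norm (emb (lead_cols XX (k * s))))\<^sup>2) \<le> (\<sigma> k)\<^sup>2"
    and IO: "IO (col_block s XX 1) = (Q1, R1)" "Q1 \<in> carrier_mat m s" "R1 \<in> carrier_mat s s"
    and IO_res: "norm (emb Q1 * emb R1 - emb (col_block s XX 1)) \<le> b ^ 17 * (u * norm (emb (col_block s XX 1)))"
    and IO_orth: "norm (idm s - transp (emb Q1) * emb Q1) \<le> b ^ 31 * u"
    and k: "1 \<le> k" "k \<le> p"
  shows "QQ k \<in> carrier_mat m (k * s) \<and> RR k \<in> carrier_mat (k * s) (k * s) \<and>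
    norm (idm (k * s) - transp (emb (QQ k)) * emb (QQ k)) \<le> b ^ 32 * u \<and>
    norm (emb (QQ k) * emb (RR k) - emb (lead_cols XX (k * s))) \<le>
      b ^ 18 * (u * norm (emb (lead_cols XX (k * s))))"
  using alg unfolding bcgsi_p_1s_def Let_def
proof (elim exE conjE, goal_cases)
  case (1 Q S Sd Y Yd R Rd U T Z P Om)
  let ?X = "col_block s XX"
  let ?L = "\<lambda>k. emb (lead_cols XX (k * s))"
  note loop = bspec[OF 1(5)]
  have Xc: "?X j \<in> carrier_mat m s" for j using XX by (simp add: col_block_def)
  have Lc: "lead_cols XX (k * s) \<in> carrier_mat m (k * s)" for k using XX by (simp add: lead_cols_def)
  have Lstep: "?L (k + 1) = ?L k + emb (?X (k + 1)) * shift (k * s) s" if "k < p" for k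
    using mult_le_mono1[of "k + 1" p s] that by (intro emb_lead_cols[OF XX]) auto
  have X1: "lead_cols XX (1 * s) = ?X 1"
    using XX by (intro eq_matI) (auto simp: lead_cols_def col_block_def)
  \<comment> \<open>\<open>T (k + 1)\<close> is produced one iteration earlier, and for
    \<open>k = 1\<close> in the initial step.\<close>
  have Tk: "fl_mult u (transpose_mat (?X (k + 1))) (?X (k + 1)) (T (k + 1))" if "1 \<le> k" "k < p" for k
  proof (cases "k = 1")
    case True
    then show ?thesis using 1(4) that by (simp add: numeral_2_eq_2)
  next
    case False
    then have "k - 1 \<in> {1..<p}" "k - 1 < p - 1" "k - 1 + 2 = k + 1" using that by auto
    then show ?thesis using loop[of "k - 1"] by (metis (no_types, lifting))
  qed
  \<comment> \<open>The last clause stops before \<open>p\<close>, since \<open>S k\<close> belongs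
    to the block \<open>k + 1\<close>.\<close>
  define Inv where "Inv k \<longleftrightarrow> QQ k \<in> carrier_mat m (k * s) \<and> RR k \<in> carrier_mat (k * s) (k * s) \<and>
    norm (idm (k * s) - transp (emb (QQ k)) * emb (QQ k)) \<le> real k * (b ^ 31 * u) \<and>
    norm (emb (QQ k) * emb (RR k) - ?L k) \<le> real k * (b ^ 17 * (u * norm (?L k))) \<and>
    (k < p \<longrightarrow> S k \<in> carrier_mat (k * s) s \<and>
      norm (emb (S k) - transp (emb (QQ k)) * emb (?X (k + 1))) \<le> b ^ 17 * (u * norm (emb (?X (k + 1)))))" for k
  have kb: "real k \<le> b ^ 1 * 1" if "k \<le> p" for k using that pb by simp
  have orth: "norm (idm (k * s) - transp (emb (QQ k)) * emb (QQ k)) \<le> b ^ 32 * u"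
    and res: "norm (emb (QQ k) * emb (RR k) - ?L k) \<le> b ^ 18 * (u * norm (?L k))"
    if "Inv k" "k \<le> p" for k
  proof -
    have "real k * (b ^ 31 * u) \<le> b ^ 32 * u"
      using u0 b100 by (intro scale_mult[OF _ _ kb[OF that(2)] order_refl]) auto
    then show "norm (idm (k * s) - transp (emb (QQ k)) * emb (QQ k)) \<le> b ^ 32 * u"
      using that(1) unfolding Inv_def by linarith
    have "real k * (b ^ 17 * (u * norm (?L k))) \<le> b ^ 18 * (u * norm (?L k))"
      using u0 b100 by (intro scale_mult[OF _ _ kb[OF that(2)] order_refl]) auto
    then show "norm (emb (QQ k) * emb (RR k) - ?L k) \<le> b ^ 18 * (u * norm (?L k))"
      using that(1) unfolding Inv_def by linarith
  qed
  have bu120: "b ^ 120 * u \<le> 1"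
  proof -
    have p1: "1 \<in> {1..p}" using k by simp
    obtain e where e: "dims (1 * s) 1 e" "norm e = 1" using ex_unit_vector[of "1 * s"] s by auto
    have "\<sigma> 1 \<le> norm (?L 1 * e)" using lb[OF p1 e(1)] e(2) by simp
    also have "\<dots> \<le> norm (?L 1)" using norm_mult_ineq[of "?L 1" e] e(2) by simp
    finally have le: "\<sigma> 1 \<le> norm (?L 1)" .
    then have "(\<sigma> 1)\<^sup>2 \<le> (norm (?L 1))\<^sup>2" using \<sigma>[OF p1] by (intro power_mono) auto
    then have "b ^ 120 * u * (norm (?L 1))\<^sup>2 \<le> 1 * (norm (?L 1))\<^sup>2"
      using small[OF p1] by (simp only: mult.assoc mult_1)
    moreover have "0 < (norm (?L 1))\<^sup>2"
      by (rule zero_less_power) (use le \<sigma>[OF p1] in linarith)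
    ultimately show ?thesis by (simp only: mult_le_cancel_right_pos)
  qed
  have bu: "b ^ 30 * u \<le> 1" using mult_right_mono[OF pow_le[of 30 120] u0] bu120 by linarith
  have "Inv k" using k
  proof (induction k rule: nat_induct_at_least)
    case base
    have QR1: "QQ 1 = Q1" "RR 1 = R1" using 1(1-3) IO(1) by auto
    have "S 1 \<in> carrier_mat (1 * s) s \<and>
      norm (emb (S 1) - transp (emb (QQ 1)) * emb (?X (1 + 1))) \<le> b ^ 17 * (u * norm (emb (?X (1 + 1))))"
      if p: "1 < p"
    proof
      have S1: "fl_mult u (transpose_mat Q1) (?X 2) (S 1)" using 1(2,4) QR1 p by simp
      then show "S 1 \<in> carrier_mat (1 * s) s" using IO(2) Xc[of 2] by (simp add: fl_mult_def)
      have om1: "norm (transp (emb Q1) * emb Q1 - idm s) \<le> 1"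
      proof -
        have "b ^ 31 * u \<le> 1" using mult_right_mono[OF pow_le[of 31 120] u0] bu120 by linarith
        then show ?thesis using IO_orth norm_minus_commute[of "idm s"] by simp
      qed
      have "2 * real s \<le> 2 * real (m + p * s + s + 1)" by simp
      from norm_le_of_orthogonal[OF dims_emb[OF IO(2)] om1 order_trans[OF this sz]]
      have hQ: "norm (emb Q1) \<le> b ^ 1 * 1" by simp
      show "norm (emb (S 1) - transp (emb (QQ 1)) * emb (?X (1 + 1))) \<le> b ^ 17 * (u * norm (emb (?X (1 + 1))))"
        unfolding emb_transpose[symmetric] QR1 one_add_one
        by (rule fl_mult_scale[OF S1 _ sz bu, of 1 1 0 "norm (emb (?X 2))"])
          (use IO(2) Xc[of 2] hQ in \<open>auto simp: emb_transpose\<close>)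
    qed
    moreover have "b ^ 31 * u = real 1 * (b ^ 31 * u)" "b ^ 17 * z = real 1 * (b ^ 17 * z)" for z by auto
    ultimately show ?case
      unfolding Inv_def X1 QR1 using IO IO_res IO_orth by simp
  next
    case (Suc k)
    have kp: "k < p" "k \<le> p" "1 \<le> k" "k \<in> {1..<p}" "k + 1 \<in> {1..p}" using Suc by auto
    have inv: "Inv k" using Suc.IH kp by simp
    let ?n = "k * s" and ?W = "?X (k + 1)" and ?\<chi> = "norm (?L (k + 1))"
    obtain M V M2 V2 where L:
      "fl_add_mult u (T (k + 1)) (- transpose_mat (S k)) (S k) M" "fl_chol u M (Sd (k + 1))"
      "fl_add_mult u ?W (- QQ k) (S k) V" "fl_tri_solve u V (Sd (k + 1)) (U (k + 1))"
      "fl_mult u (transpose_mat (QQ k)) (U (k + 1)) (Y k)"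
      "fl_mult u (transpose_mat (U (k + 1))) (U (k + 1)) (Om (k + 1))"
      "fl_add_mult u (Om (k + 1)) (- transpose_mat (Y k)) (Y k) M2" "fl_chol u M2 (Yd (k + 1))"
      "fl_add_mult u (U (k + 1)) (- QQ k) (Y k) V2" "fl_tri_solve u V2 (Yd (k + 1)) (Q (k + 1))"
      "fl_add_mult u (S k) (Y k) (Sd (k + 1)) (R k)"
      "fl_mult u (Yd (k + 1)) (Sd (k + 1)) (Rd (k + 1))"
      "QQ (k + 1) = append_cols (QQ k) (Q (k + 1))"
      "RR (k + 1) = four_block_mat (RR k) (R k) (0\<^sub>m s (k * s)) (Rd (k + 1))"
      using loop[OF kp(4)] by blast
    have c: "QQ k \<in> carrier_mat m ?n" "RR k \<in> carrier_mat ?n ?n" "S k \<in> carrier_mat ?n s"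
      using inv kp by (auto simp: Inv_def)
    have szk: "2 * real (m + ?n + s + 1) \<le> b"
    proof -
      have "m + ?n + s + 1 \<le> m + p * s + s + 1" using kp by (intro add_mono mult_le_mono1) auto
      from order_trans[OF mult_left_mono[OF of_nat_mono[OF this], of 2] sz] show ?thesis by simp
    qed
    define \<Delta> where "\<Delta> = emb (QQ k) * emb (RR k) - ?L k"
    have Ln: "norm (?L k) \<le> ?\<chi>" and Wn: "norm (emb ?W) \<le> ?\<chi>"
      using norm_le_append[OF dims_emb[OF Lc[of k]] dims_emb[OF Xc[of "k + 1"]]]
      by (simp_all only: Lstep[OF kp(1)])
    have le\<chi>: "b ^ i * (u * norm (?L k)) \<le> b ^ i * (u * ?\<chi>)" "b ^ i * (u * norm (emb ?W)) \<le> b ^ i * (u * ?\<chi>)" for i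
      using Ln Wn u0 b100 by (auto intro!: mult_left_mono)
    have \<Delta>: "dims m ?n \<Delta>" "?L k + \<Delta> = emb (QQ k) * emb (RR k)" "norm \<Delta> \<le> b ^ 18 * (u * ?\<chi>)"
      using c dims_emb[OF Lc[of k]] order_trans[OF res[OF inv kp(2)] le\<chi>(1)]
      by (auto simp: \<Delta>_def intro!: dims_diff dims_mult[OF dims_emb dims_emb])
    have Serr: "norm (emb (S k) - transp (emb (QQ k)) * emb ?W) \<le> b ^ 17 * (u * ?\<chi>)"
      using order_trans[OF _ le\<chi>(2)] inv kp(1) unfolding Inv_def by blast
    have lb': "\<sigma> (k + 1) * norm v \<le> norm ((?L k + emb ?W * shift ?n s) * v)" if "dims (?n + s) 1 v" for v
      using lb[OF kp(5), of v] that unfolding Lstep[OF kp(1)] by (simp add: add.commute)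
    obtain H where H: "U (k + 1) \<in> carrier_mat m s" "Y k \<in> carrier_mat ?n s" "Yd (k + 1) \<in> carrier_mat s s"
      "upper_triangular (Yd (k + 1))" "\<And>i. i < s \<Longrightarrow> Yd (k + 1) $$ (i, i) \<noteq> 0"
      "Q (k + 1) \<in> carrier_mat m s" "R k \<in> carrier_mat ?n s" "Rd (k + 1) \<in> carrier_mat s s"
      "dims s s H" "emb (Yd (k + 1)) * H = idm s" "norm H \<le> b ^ 2 * 1"
      "norm (emb (QQ k)) \<le> b ^ 1 * 1" "norm (emb (Q (k + 1))) \<le> b ^ 2 * 1" "norm (emb (U (k + 1))) \<le> b ^ 2 * 1"
      "norm (emb (Y k)) \<le> b ^ 0 * 1" "norm (emb (Yd (k + 1))) \<le> b ^ 6 * 1"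
      "norm (emb (Q (k + 1)) * emb (Yd (k + 1)) - (emb (U (k + 1)) - emb (QQ k) * emb (Y k))) \<le> b ^ 10 * u"
      "norm (transp (emb (QQ k)) * emb (Q (k + 1))) \<le> b ^ 23 * u"
      "norm (transp (emb (Q (k + 1))) * emb (Q (k + 1)) - idm s) \<le> b ^ 30 * u"
      "norm (emb (QQ k) * emb (R k) + emb (Q (k + 1)) * emb (Rd (k + 1)) - emb ?W) \<le> b ^ 17 * (u * ?\<chi>)"
      by (rule bcgs_step[OF c(1,2) Lc Xc c(3) s szk orth[OF inv kp(2)] \<Delta> eq_refl[OF arg_cong[OF Lstep[OF kp(1), symmetric]]]
          Wn \<sigma>[OF kp(5)] lb' small[OF kp(5)] Serr Tk[OF kp(3,1)] L(1-12)], assumption) (rule that; blast)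
    have ks: "Suc k * s = ?n + s" by simp
    have embQ: "emb (QQ (k + 1)) = emb (QQ k) + emb (Q (k + 1)) * shift ?n s"
      unfolding L(13) by (rule emb_append_cols[OF c(1) H(6)])
    have embR: "emb (RR (k + 1)) = emb (RR k) + emb (R k) * shift ?n s +
      transp (shift ?n s) * emb (Rd (k + 1)) * shift ?n s"
      unfolding L(14) by (rule emb_four_block[OF c(2) H(7,8)])
    have "norm (idm (?n + s) - transp (emb (QQ (k + 1))) * emb (QQ (k + 1))) \<le>
      real k * (b ^ 31 * u) + 2 * (b ^ 23 * u) + b ^ 30 * u"
      unfolding embQ using inv H(18,19)
      by (intro gram_append[OF dims_emb[OF c(1)] dims_emb[OF H(6)]]) (auto simp: Inv_def)
    also have "\<dots> \<le> real (Suc k) * (b ^ 31 * u)"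
    proof -
      have "100 * (b ^ 23 * u) \<le> b ^ 31 * u" "100 * (b ^ 30 * u) \<le> b ^ 31 * u" "0 \<le> b ^ 31 * u"
        using u0 b100 by (auto intro!: scale_step[OF _ order_refl])
      moreover have "real (Suc k) * (b ^ 31 * u) = real k * (b ^ 31 * u) + b ^ 31 * u"
        by (simp add: algebra_simps)
      ultimately show ?thesis by linarith
    qed
    finally have orth': "norm (idm (?n + s) - transp (emb (QQ (k + 1))) * emb (QQ (k + 1))) \<le>
      real (Suc k) * (b ^ 31 * u)" .
    have QR: "emb (QQ (k + 1)) * emb (RR (k + 1)) - ?L (k + 1) =
      \<Delta> + (emb (QQ k) * emb (R k) + emb (Q (k + 1)) * emb (Rd (k + 1)) - emb ?W) * shift ?n s"
      unfolding embQ embR product_append[OF dims_emb[OF c(1)] dims_emb[OF c(2)] dims_emb[OF H(7)] dims_emb[OF H(8)]]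
        Lstep[OF kp(1)] \<Delta>_def by (simp add: algebra_simps)
    have dres: "dims m s (emb (QQ k) * emb (R k) + emb (Q (k + 1)) * emb (Rd (k + 1)) - emb ?W)"
      using c H Xc by (intro dims_diff dims_add dims_mult[OF dims_emb dims_emb] dims_emb)
    have "norm (emb (QQ (k + 1)) * emb (RR (k + 1)) - ?L (k + 1)) \<le> norm \<Delta> + b ^ 17 * (u * ?\<chi>)"
      unfolding QR using H(20) norm_mult_shift[OF dres, of ?n]
      by (intro order_trans[OF norm_triangle_ineq]) simp
    also have "norm \<Delta> \<le> real k * (b ^ 17 * (u * norm (?L k)))" using inv by (simp add: Inv_def \<Delta>_def)
    also have "\<dots> \<le> real k * (b ^ 17 * (u * ?\<chi>))" by (rule mult_left_mono[OF le\<chi>(1)]) simp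
    finally have res': "norm (emb (QQ (k + 1)) * emb (RR (k + 1)) - ?L (k + 1)) \<le>
      real (Suc k) * (b ^ 17 * (u * ?\<chi>))" by (simp add: algebra_simps)
    have carr: "QQ (k + 1) \<in> carrier_mat m (?n + s)" "RR (k + 1) \<in> carrier_mat (?n + s) (?n + s)"
      unfolding L(13,14) append_cols_def using c H(6-8) by auto
    have "S (k + 1) \<in> carrier_mat (?n + s) s \<and>
      norm (emb (S (k + 1)) - transp (emb (QQ (k + 1))) * emb (?X (k + 1 + 1))) \<le>
        b ^ 17 * (u * norm (emb (?X (k + 1 + 1))))" if kp1: "k + 1 < p"
    proof -
      \<comment> \<open>\<open>S (k + 1)\<close> is formed at the start of iteration
        \<open>k + 1\<close> out of \<open>Z k\<close> and \<open>P (k + 1)\<close>, which iteration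
        \<open>k\<close> has left behind.\<close>
      have "k < p - 1" "k + 1 \<in> {1..<p}" "2 \<le> k + 1" "k + 1 - 1 = k" "k + 2 = k + 1 + 1"
        using kp1 kp by auto
      note idx = this
      have ZP: "fl_mult u (transpose_mat (QQ k)) (?X (k + 1 + 1)) (Z k)"
        "fl_mult u (transpose_mat (U (k + 1))) (?X (k + 1 + 1)) (P (k + 1))"
        using loop[OF kp(4)] idx(1) unfolding idx(5) by blast+
      obtain V B where VB: "fl_add_mult u (P (k + 1)) (- transpose_mat (Y k)) (Z k) V"
        "fl_tri_solve u (transpose_mat V) (Yd (k + 1)) (transpose_mat B)" "S (k + 1) = Z k @\<^sub>r B"
        using loop[OF idx(2)] idx(3) unfolding idx(4) by blast
      note nS = next_S[OF c(1) H(6,1) Xc H(2,3,4,5) szk bu H(12-16) H(9,10,11) H(17) ZP VB(1,2)]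
      show ?thesis unfolding VB(3) embQ
        using nS(3) carrier_append_rows[OF nS(1,2)] by simp
    qed
    then show ?case
      unfolding Inv_def ks using orth' res' carr ks by (simp add: add.commute[of s])
  qed
  then show ?case using orth res k unfolding Inv_def by blast
qed

end

section \<open>Polynomially bounded constants and the return to spectral norms\<close>

lemma poly_bounded_add:
  assumes "poly_bounded f" "poly_bounded g" shows "poly_bounded (\<lambda>m s p. f m s p + g m s p)"
proof -
  obtain K d L e where f: "\<And>m s p. 0 < m \<and> 0 < s \<and> 0 < p \<Longrightarrow> 0 \<le> f m s p \<and> f m s p \<le> K * real (m * s * p) ^ d"
    and g: "\<And>m s p. 0 < m \<and> 0 < s \<and> 0 < p \<Longrightarrow> 0 \<le> g m s p \<and> g m s p \<le> L * real (m * s * p) ^ e"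
    using assms unfolding poly_bounded_def by metis
  \<comment> \<open>Evaluation at 1, 1, 1 gives the signs of \<open>K\<close> and \<open>L\<close>,
    on which the passage to a common exponent depends.\<close>
  have K: "0 \<le> K" and L: "0 \<le> L" using f[of 1 1 1] g[of 1 1 1] by auto
  show ?thesis unfolding poly_bounded_def
  proof (intro exI[of _ "K + L"] exI[of _ "max d e"] allI impI)
    fix m s p :: nat assume pos: "0 < m \<and> 0 < s \<and> 0 < p"
    then have "1 \<le> real (m * s * p)" by (simp add: Suc_le_eq del: of_nat_mult)
    then have "K * real (m * s * p) ^ d \<le> K * real (m * s * p) ^ max d e"
      "L * real (m * s * p) ^ e \<le> L * real (m * s * p) ^ max d e"
      using K L by (auto intro!: mult_left_mono power_increasing)
    then show "0 \<le> f m s p + g m s p \<and> f m s p + g m s p \<le> (K + L) * real (m * s * p) ^ max d e"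
      using f[OF pos] g[OF pos] unfolding distrib_right by linarith
  qed
qed

lemma poly_bounded_power:
  assumes "poly_bounded f" shows "poly_bounded (\<lambda>m s p. f m s p ^ n)"
proof -
  obtain K d where f: "\<And>m s p. 0 < m \<and> 0 < s \<and> 0 < p \<Longrightarrow> 0 \<le> f m s p \<and> f m s p \<le> K * real (m * s * p) ^ d"
    using assms unfolding poly_bounded_def by metis
  show ?thesis unfolding poly_bounded_def
  proof (intro exI[of _ "K ^ n"] exI[of _ "d * n"] allI impI)
    fix m s p :: nat assume pos: "0 < m \<and> 0 < s \<and> 0 < p"
    have "f m s p ^ n \<le> (K * real (m * s * p) ^ d) ^ n" using f[OF pos] by (intro power_mono) auto
    then show "0 \<le> f m s p ^ n \<and> f m s p ^ n \<le> K ^ n * real (m * s * p) ^ (d * n)"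
      using f[OF pos] by (simp add: power_mult_distrib power_mult)
  qed
qed

lemma poly_bounded_dims: "poly_bounded (\<lambda>m s p. 100 * real (m * s * p))"
  unfolding poly_bounded_def by (rule exI[of _ 100], rule exI[of _ 1]) simp


lemma sigma_max_nonneg: "A \<in> carrier_mat m n \<Longrightarrow> 0 < n \<Longrightarrow> 0 \<le> sigma_max A"
  using singular_value_vector[OF sigma_max_mem] by blast

text \<open>For the first block this gives a condition number within the range for which
  \<open>io_accurate\<close> is assumed.\<close>

lemma kappa_lead:
  assumes A: "A \<in> carrier_mat m n" and k: "0 < k" "k \<le> n" and pos: "0 < sigma_min A"
  shows "kappa (lead_cols A k) \<le> kappa A"
proof -
  have "lead_cols A k \<in> carrier_mat m k" using A by (simp add: lead_cols_def)
  then show ?thesis unfolding kappa_def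
    using sigma_min_lead[OF A k] sigma_max_lead[OF A k] sigma_max_nonneg[OF A] k pos
    by (intro frac_le) auto
qed

text \<open>The change of norms explains the exponents: 122 is 120 plus 2 for the square of the
  factor between the Frobenius norm and \<open>sigma_max\<close>; 19 is 18 plus 1 for the factor
  between the Frobenius norm and \<open>mnorm\<close> on the right; 32 stays, since
  \<open>mnorm\<close> is at most the Frobenius norm.\<close>

lemma (in scale) bcgsi_p_1s_stable:
  fixes IO :: "real mat \<Rightarrow> real mat \<times> real mat" and QQ RR :: "nat \<Rightarrow> real mat"
  assumes pos: "0 < m" "0 < s" "0 < p" and N: "100 * real (m * s * p) \<le> b"
    and a: "0 \<le> a2" "a2 \<le> b" "0 \<le> a3" "a3 \<le> b" "a4 \<le> b"
    and XX: "XX \<in> carrier_mat m (p * s)" and alg: "bcgsi_p_1s u IO s p XX QQ RR"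
    and hyp: "\<forall>k\<in>{1..p}. 0 < sigma_min (lead_cols XX (k * s)) \<and>
      b ^ 122 * u * (kappa (lead_cols XX (k * s)))\<^sup>2 \<le> 1 / 2"
    and io: "\<forall>X \<in> carrier_mat m s. 0 < sigma_min X \<and> kappa X \<le> kappa XX \<longrightarrow>
      io_accurate a1 a2 a3 a4 u m s IO X"
    and k: "k \<in> {1..p}"
  shows "\<exists>\<Delta> \<in> carrier_mat m (k * s). lead_cols XX (k * s) + \<Delta> = QQ k * RR k \<and>
      mnorm \<Delta> \<le> b ^ 19 * u * mnorm (lead_cols XX (k * s))"
    and "mnorm (1\<^sub>m (k * s) - transpose_mat (QQ k) * QQ k) \<le> b ^ 32 * u"
proof -
  let ?L = "\<lambda>k. lead_cols XX (k * s)"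
  have Lc: "?L k \<in> carrier_mat m (k * s)" for k using XX by (simp add: lead_cols_def)
  have le_N: "m \<le> m * s * p" "s \<le> m * s * p" "p \<le> m * s * p" "p * s \<le> m * s * p" "1 \<le> m * s * p"
    using pos by (auto simp: Suc_le_eq mult.assoc mult.commute[of s p])
  have nb: "real n \<le> b" if "n \<le> m * s * p" for n
  proof -
    have "real n \<le> real (m * s * p)" using that by (rule of_nat_mono)
    then show ?thesis using N by linarith
  qed
  have sqb: "sqrt (real n) \<le> b" if "n \<le> m * s * p" for n
    using sqrt_le_self[of n] nb[OF that] by linarith
  have sz: "2 * real (m + p * s + s + 1) \<le> b"
  proof -
    have "m + p * s + s + 1 \<le> 4 * (m * s * p)" using le_N by linarith
    then have "real (m + p * s + s + 1) \<le> real (4 * (m * s * p))" by (rule of_nat_mono)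
    also have "\<dots> = 4 * real (m * s * p)" by simp
    finally have "2 * real (m + p * s + s + 1) \<le> 2 * (4 * real (m * s * p))"
      by (rule mult_left_mono) simp
    also have "\<dots> = 8 * real (m * s * p)" by simp
    also have "\<dots> \<le> b" using N by linarith
    finally show ?thesis .
  qed
  have ks: "0 < k * s" "k * s \<le> m * s * p" if "k \<in> {1..p}" for k
    using that pos order_trans[OF mult_le_mono1[of k p s] le_N(4)] by auto
  have small: "b ^ 120 * (u * (norm (emb (?L k)))\<^sup>2) \<le> (sigma_min (?L k))\<^sup>2" if k: "k \<in> {1..p}" for k
  proof -
    have \<sigma>: "0 < sigma_min (?L k)" and h: "b ^ 122 * u * (kappa (?L k))\<^sup>2 \<le> 1 / 2" using hyp k by auto
    have M0: "0 \<le> sigma_max (?L k)" using sigma_max_nonneg[OF Lc ks(1)[OF k]] .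
    have "norm (emb (?L k)) \<le> b ^ 1 * sigma_max (?L k)"
      using norm_le_sigma_max[OF Lc ks(1)[OF k]] mult_right_mono[OF sqb[OF ks(2)[OF k]] M0]
      by (simp add: power_one_right)
    from power_mono[OF this norm_ge_zero, of 2]
    have "(norm (emb (?L k)))\<^sup>2 \<le> b ^ 2 * (sigma_max (?L k))\<^sup>2" by (simp add: power_mult_distrib)
    then have "b ^ 120 * u * (norm (emb (?L k)))\<^sup>2 \<le> b ^ 122 * (u * (sigma_max (?L k))\<^sup>2)"
      by (rule scale_mult[of _ _ 120 u 2, rotated 3]) (use u0 b100 in auto)
    also have "\<dots> = (b ^ 122 * u * (kappa (?L k))\<^sup>2) * (sigma_min (?L k))\<^sup>2"
      using \<sigma> by (simp add: kappa_def power_divide)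
    also have "\<dots> \<le> 1 / 2 * (sigma_min (?L k))\<^sup>2" using h by (intro mult_right_mono) auto
    also have "\<dots> \<le> (sigma_min (?L k))\<^sup>2" by simp
    finally show ?thesis by (simp only: mult.assoc)
  qed
  let ?X1 = "col_block s XX 1"
  have X1: "?X1 = ?L 1" using XX by (intro eq_matI) (auto simp: lead_cols_def col_block_def)
  have X1c: "?X1 \<in> carrier_mat m s" using Lc[of 1] X1 by simp
  have p1: "1 \<in> {1..p}" "p \<in> {1..p}" using pos by auto
  have Lp: "?L p = XX" using XX by (intro eq_matI) (auto simp: lead_cols_def)
  have "0 < sigma_min XX" using hyp p1(2) Lp by metis
  then have "kappa ?X1 \<le> kappa XX"
    unfolding X1 using kappa_lead[OF XX, of "1 * s"] pos by simp
  moreover have hyp1: "0 < sigma_min ?X1" "b ^ 122 * u * (kappa ?X1)\<^sup>2 \<le> 1 / 2"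
    using bspec[OF hyp p1(1)] unfolding X1 by blast+
  ultimately have "io_accurate a1 a2 a3 a4 u m s IO ?X1" using io X1c by blast
  then obtain Q1 R1 E where IO: "IO ?X1 = (Q1, R1)" "Q1 \<in> carrier_mat m s" "R1 \<in> carrier_mat s s"
    and E: "E \<in> carrier_mat m s" "?X1 + E = Q1 * R1" "mnorm E \<le> a2 * u * mnorm ?X1"
    and orth1: "mnorm (1\<^sub>m s - transpose_mat Q1 * Q1) \<le> a3 * u / (1 - a4 * u * (kappa ?X1)\<^sup>2)"
    unfolding io_accurate_def by blast
  have hs: "sqrt (real s) \<le> b ^ 1 * 1" using sqb[OF le_N(2)] by simp
  have IO_res: "norm (emb Q1 * emb R1 - emb ?X1) \<le> b ^ 17 * (u * norm (emb ?X1))"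
  proof -
    have "emb Q1 * emb R1 - emb ?X1 = emb E"
      using arg_cong[OF E(2), of emb] emb_add[of ?X1 E] emb_mult[of Q1 R1] E(1) X1c IO by simp
    then have "norm (emb Q1 * emb R1 - emb ?X1) \<le> sqrt s * mnorm E"
      using norm_le_mnorm[OF E(1) pos(2)] by simp
    also have "\<dots> \<le> sqrt s * (a2 * u * norm (emb ?X1))"
      using E(3) mult_left_mono[OF mnorm_le_norm[OF X1c pos(2)], of "a2 * u"] a u0
      by (intro mult_left_mono) (auto intro: order_trans)
    also have "\<dots> \<le> b ^ 17 * (u * norm (emb ?X1))"
    proof (rule scale_mult[OF _ _ hs, where j = 1])
      show "a2 * u * norm (emb ?X1) \<le> b ^ 1 * (u * norm (emb ?X1))"
        using a u0 by (simp add: mult.assoc mult_right_mono)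
    qed (use a u0 in auto)
    finally show ?thesis .
  qed
  have IO_orth: "norm (idm s - transp (emb Q1) * emb Q1) \<le> b ^ 31 * u"
  proof -
    have c: "1\<^sub>m s - transpose_mat Q1 * Q1 \<in> carrier_mat s s" using IO(2) by auto
    have "emb (1\<^sub>m s - transpose_mat Q1 * Q1) = idm s - transp (emb Q1) * emb Q1"
      using IO(2) by (simp add: emb_diff emb_mult emb_transpose emb_one)
    then have 1: "norm (idm s - transp (emb Q1) * emb Q1) \<le> sqrt s * mnorm (1\<^sub>m s - transpose_mat Q1 * Q1)"
      using norm_le_mnorm[OF c pos(2)] by simp
    \<comment> \<open>Since \<open>a4 \<le> b\<close>, the hypothesis on \<open>kappa\<close> keeps
      the denominator of the assumed orthogonality bound at least 1/2.\<close>
    have "a4 * (u * (kappa ?X1)\<^sup>2) \<le> b ^ 122 * (u * (kappa ?X1)\<^sup>2)"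
      using a(5) pow_le[of 1 122] u0 by (intro mult_right_mono) auto
    also have "\<dots> \<le> 1 / 2" using hyp1(2) by (simp only: mult.assoc)
    finally have "1 / 2 \<le> 1 - a4 * u * (kappa ?X1)\<^sup>2" by (simp add: mult.assoc)
    then have "a3 * u / (1 - a4 * u * (kappa ?X1)\<^sup>2) \<le> a3 * u / (1 / 2)"
      using a u0 by (intro divide_left_mono) auto
    also have "\<dots> = 2 * (a3 * u)" by simp
    also have "\<dots> \<le> b ^ 2 * u"
      using a u0 by (intro scale_step_coeff[of "a3 * u" 1 u 2 2]) (auto intro: mult_right_mono)
    finally have 2: "mnorm (1\<^sub>m s - transpose_mat Q1 * Q1) \<le> b ^ 2 * u" using orth1 by linarith
    have "sqrt s * mnorm (1\<^sub>m s - transpose_mat Q1 * Q1) \<le> sqrt s * (b ^ 2 * u)"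
      using 2 by (intro mult_left_mono) auto
    also have "\<dots> \<le> b ^ 31 * u" using u0 b100 by (intro scale_mult[OF _ _ hs order_refl]) auto
    finally show ?thesis using 1 by linarith
  qed
  have bounds: "QQ k \<in> carrier_mat m (k * s) \<and> RR k \<in> carrier_mat (k * s) (k * s) \<and>
    norm (idm (k * s) - transp (emb (QQ k)) * emb (QQ k)) \<le> b ^ 32 * u \<and>
    norm (emb (QQ k) * emb (RR k) - emb (?L k)) \<le> b ^ 18 * (u * norm (emb (?L k)))"
  proof (rule bcgsi_p_1s_bounds[OF alg XX pos(2) sz nb[OF le_N(3)] _ _ small IO IO_res IO_orth])
    show "sigma_min (?L k) * norm v \<le> norm (emb (?L k) * v)" if "k \<in> {1..p}" "dims (k * s) 1 v" for k v
      using sigma_min_le[OF Lc ks(1)[OF that(1)] that(2)] .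
  qed (use hyp k in auto)
  let ?D = "QQ k * RR k - ?L k"
  have c: "QQ k \<in> carrier_mat m (k * s)" "RR k \<in> carrier_mat (k * s) (k * s)" "?D \<in> carrier_mat m (k * s)"
    using bounds Lc[of k] by auto
  have eD: "emb ?D = emb (QQ k) * emb (RR k) - emb (?L k)"
    using c Lc[of k] by (simp add: emb_diff emb_mult)
  have "mnorm ?D \<le> b ^ 18 * (u * norm (emb (?L k)))"
    using mnorm_le_norm[OF c(3) ks(1)[OF k]] bounds unfolding eD by linarith
  also have "\<dots> \<le> b ^ 19 * (u * mnorm (?L k))"
  proof -
    have m0: "0 \<le> mnorm (?L k)"
      using norm_le_mnorm[OF Lc ks(1)[OF k]] ks(1)[OF k] order_trans[OF norm_ge_zero]
      by (metis mult_le_0_iff not_le of_nat_0_less_iff real_sqrt_gt_0_iff less_le_not_le mult_neg_pos mult.commute)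
    have "norm (emb (?L k)) \<le> b * mnorm (?L k)"
      using norm_le_mnorm[OF Lc ks(1)[OF k]] mult_right_mono[OF sqb[OF ks(2)[OF k]] m0] by linarith
    then have le: "u * norm (emb (?L k)) \<le> b ^ 1 * (u * mnorm (?L k))"
      using mult_left_mono[OF _ u0] by (fastforce simp: mult_ac)
    show ?thesis
      by (rule scale_mult[OF _ _ _ le, of _ 18 1]) (use u0 b100 in auto)
  qed
  finally have "mnorm ?D \<le> b ^ 19 * u * mnorm (?L k)" by (simp add: mult.assoc)
  moreover have "?L k + ?D = QQ k * RR k" using c Lc[of k] by (intro eq_matI) auto
  ultimately show "\<exists>\<Delta> \<in> carrier_mat m (k * s). ?L k + \<Delta> = QQ k * RR k \<and>
      mnorm \<Delta> \<le> b ^ 19 * u * mnorm (?L k)" using c(3) by blast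
  have oc: "1\<^sub>m (k * s) - transpose_mat (QQ k) * QQ k \<in> carrier_mat (k * s) (k * s)" using c(1) by auto
  have "emb (1\<^sub>m (k * s) - transpose_mat (QQ k) * QQ k) = idm (k * s) - transp (emb (QQ k)) * emb (QQ k)"
    using c(1) by (simp add: emb_diff emb_mult emb_transpose emb_one)
  then show "mnorm (1\<^sub>m (k * s) - transpose_mat (QQ k) * QQ k) \<le> b ^ 32 * u"
    using mnorm_le_norm[OF oc ks(1)[OF k]] bounds by simp
qed

theorem theorem1:
  fixes a1 a2 a3 a4 :: "nat \<Rightarrow> nat \<Rightarrow> nat \<Rightarrow> real"
  assumes "poly_bounded a1" and "poly_bounded a2" and "poly_bounded a3" and "poly_bounded a4"
  shows "\<exists>c1 c2 c3. poly_bounded c1 \<and> poly_bounded c2 \<and> poly_bounded c3 \<and>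
    (\<forall>(m::nat) (s::nat) (p::nat) (u::real) (XX::real mat)
       (IO :: real mat \<Rightarrow> real mat \<times> real mat)
       (QQ :: nat \<Rightarrow> real mat) (RR :: nat \<Rightarrow> real mat).
       0 < m \<longrightarrow> 0 < s \<longrightarrow> 0 < p \<longrightarrow> 0 < u \<longrightarrow>
       XX \<in> carrier_mat m (p * s) \<longrightarrow>
       bcgsi_p_1s u IO s p XX QQ RR \<longrightarrow>
       (\<forall>k\<in>{1..p}. 0 < sigma_min (lead_cols XX (k * s)) \<and>
          c1 m s p * u * (kappa (lead_cols XX (k * s)))\<^sup>2 \<le> 1 / 2) \<longrightarrow>
       (\<forall>X \<in> carrier_mat m s. 0 < sigma_min X \<and> kappa X \<le> kappa XX \<longrightarrow>
          io_accurate (a1 m s p) (a2 m s p) (a3 m s p) (a4 m s p) u m s IO X) \<longrightarrow>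
       (\<forall>k\<in>{1..p}.
          (\<exists>\<Delta> \<in> carrier_mat m (k * s).
             lead_cols XX (k * s) + \<Delta> = QQ k * RR k \<and>
             mnorm \<Delta> \<le> c2 m s p * u * mnorm (lead_cols XX (k * s))) \<and>
          mnorm (1\<^sub>m (k * s) - transpose_mat (QQ k) * QQ k) \<le> c3 m s p * u))"
proof -
  \<comment> \<open>The first summand dominates all dimension counts and gives
    \<open>100 \<le> b\<close>; the others dominate the constants in the residual and orthogonality
    bounds of the intraorthogonalization.\<close>
  define b where "b m s p = 100 * real (m * s * p) + a2 m s p + a3 m s p + a4 m s p" for m s p
  have pb: "poly_bounded b"
    unfolding b_def[abs_def] by (intro poly_bounded_add poly_bounded_dims assms)
  have nonneg: "0 \<le> f m s p" if "poly_bounded f" "0 < m" "0 < s" "0 < p" for f m s p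
    using that unfolding poly_bounded_def by blast
  have b: "scale (b m s p) u" "100 * real (m * s * p) \<le> b m s p" "a2 m s p \<le> b m s p" "a3 m s p \<le> b m s p"
    "a4 m s p \<le> b m s p" "0 \<le> a2 m s p" "0 \<le> a3 m s p"
    if "0 < m" "0 < s" "0 < p" "0 < u" for m s p u
  proof -
    note nn = nonneg[OF assms(2) that(1-3)] nonneg[OF assms(3) that(1-3)] nonneg[OF assms(4) that(1-3)]
    have "1 \<le> m * s * p" using that by simp
    then have "real 1 \<le> real (m * s * p)" by (rule of_nat_mono)
    with nn show "100 * real (m * s * p) \<le> b m s p" "a2 m s p \<le> b m s p" "a3 m s p \<le> b m s p"
      "a4 m s p \<le> b m s p" "0 \<le> a2 m s p" "0 \<le> a3 m s p" and "scale (b m s p) u"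
      using that(4) unfolding b_def scale_def by linarith+
  qed
  show ?thesis
  proof (rule exI[of _ "\<lambda>m s p. b m s p ^ 122"], rule exI[of _ "\<lambda>m s p. b m s p ^ 19"],
      rule exI[of _ "\<lambda>m s p. b m s p ^ 32"], intro conjI poly_bounded_power[OF pb] allI impI ballI, goal_cases)
    case (1 m s p u XX IO QQ RR k)
    note B = b[OF 1(1-4)]
    show ?case by (rule scale.bcgsi_p_1s_stable(1)[OF B(1) 1(1-3) B(2,6,3,7,4,5) 1(5-9)])
  next
    case (2 m s p u XX IO QQ RR k)
    note B = b[OF 2(1-4)]
    show ?case by (rule scale.bcgsi_p_1s_stable(2)[OF B(1) 2(1-3) B(2,6,3,7,4,5) 2(5-9)])
  qed
qed

end
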